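(* Let $f\colon\mathbb{Z}\to\mathbb{R}$ be a bounded generalised polynomial map and let $d\in\mathbb{N}$. Then there exist a connected, simply connected nilpotent Lie group $G$, a lattice $\Gamma<G$, a filtration $G_\bullet$ on $G$ (with a compatible Mal'cev basis), and a piecewise polynomial map $F\colon G/\Gamma\to\mathbb{R}$ such that for each polynomial $p\in\mathbb{R}[x]$ with $\deg p\le d$ there exists $g_p\in\mathrm{poly}(\mathbb{Z},G_\bullet)$ with $f(\lfloor p(n)\rfloor) = F(g_p(n)\Gamma)$ for all $n\in\mathbb{Z}$.
   Context: A generalised polynomial map $\mathbb{Z}\to\mathbb{R}$ is the restriction to $\mathbb{Z}$ of an element of the smallest family of maps $\mathbb{R}\to\mathbb{R}$ containing polynomials and closed under pointwise sum, product and integer part. A lattice is a discrete cocompact subgroup. A filtration of degree $s$ on $G$ is a sequence of subgroups $G=G_0=G_1\ge G_2\ge\dots$ with $G_{s+1}=\{e\}$ and $[G_i,G_j]\subset G_{i+j}$. A Mal'cev basis compatible with $\Gamma$ and $G_\bullet$ is a basis $X_1,\dots,X_D$ of the Lie algebra $\mathfrak g$ such that each $\mathrm{span}(X_{j+1},\dots,X_D)$ is an ideal, each $g\in G_i$ is uniquely $\exp(t_{D(i)+1}X_{D(i)+1})\cdots\exp(t_DX_D)$ with $D(i)=\operatorname{codim}G_i$, and $\Gamma$ is the set of products $\exp(t_1X_1)\cdots\exp(t_DX_D)$ with $t_j\in\mathbb{Z}$; it induces coordinates $\tau\colon G/\Gamma\to[0,1)^D$ via $x=\exp(\tau_1(x)X_1)\cdots\exp(\tau_D(x)X_D)\Gamma$.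 A subset of $G/\Gamma$ is semialgebraic if its image under $\tau$ is a finite union of sets of the form $\{x: P_1(x)>0,\dots,P_n(x)>0,Q_1(x)=0,\dots,Q_m(x)=0\}$ with real polynomials $P_i,Q_j$. $F$ is piecewise polynomial if there are a partition of $G/\Gamma$ into finitely many semialgebraic sets $S_i$ and polynomials $\Phi_i$ with $F(x)=\Phi_i(\tau(x))$ for $x\in S_i$. $\mathrm{poly}(\mathbb{Z},G_\bullet)$ is the set of maps $g(n)=g_0g_1^{n}g_2^{\binom n2}\cdots g_s^{\binom ns}$ with $g_i\in G_i$. *)

theory Defs
  imports "Jordan_Normal_Form.Matrix" "HOL-Computational_Algebra.Polynomial"
begin

inductive gen_poly_real :: "(real \<Rightarrow> real) \<Rightarrow> bool" where
  gp_poly: "gen_poly_real (\<lambda>x. poly p x)"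
| gp_add: "gen_poly_real f \<Longrightarrow> gen_poly_real g \<Longrightarrow> gen_poly_real (\<lambda>x. f x + g x)"
| gp_mult: "gen_poly_real f \<Longrightarrow> gen_poly_real g \<Longrightarrow> gen_poly_real (\<lambda>x. f x * g x)"
| gp_floor: "gen_poly_real f \<Longrightarrow> gen_poly_real (\<lambda>x. of_int \<lfloor>f x\<rfloor>)"

definition gen_poly_map :: "(int \<Rightarrow> real) \<Rightarrow> bool" where
  "gen_poly_map f \<longleftrightarrow> (\<exists>h. gen_poly_real h \<and> (\<forall>n. f n = h (of_int n)))"

text \<open>Points of R^D are represented as functions nat => real; only the
  coordinates 0..D-1 are relevant.\<close>
inductive poly_fun :: "nat \<Rightarrow> ((nat \<Rightarrow> real) \<Rightarrow> real) \<Rightarrow> bool" for D where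
  pf_const: "poly_fun D (\<lambda>x. c)"
| pf_var: "k < D \<Longrightarrow> poly_fun D (\<lambda>x. x k)"
| pf_add: "poly_fun D P \<Longrightarrow> poly_fun D Q \<Longrightarrow> poly_fun D (\<lambda>x. P x + Q x)"
| pf_mult: "poly_fun D P \<Longrightarrow> poly_fun D Q \<Longrightarrow> poly_fun D (\<lambda>x. P x * Q x)"

definition pts :: "nat \<Rightarrow> (nat \<Rightarrow> real) set" where
  "pts D = {x. \<forall>k\<ge>D. x k = 0}"

definition basic_semialg :: "nat \<Rightarrow> (nat \<Rightarrow> real) set \<Rightarrow> bool" where
  "basic_semialg D S \<longleftrightarrow> (\<exists>Ps Qs. (\<forall>P\<in>set Ps. poly_fun D P) \<and> (\<forall>Q\<in>set Qs. poly_fun D Q) \<and>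
      S = {x \<in> pts D. (\<forall>P\<in>set Ps. P x > 0) \<and> (\<forall>Q\<in>set Qs. Q x = 0)})"

definition semialg :: "nat \<Rightarrow> (nat \<Rightarrow> real) set \<Rightarrow> bool" where
  "semialg D S \<longleftrightarrow> (\<exists>Bs. (\<forall>B\<in>set Bs. basic_semialg D B) \<and> S = \<Union>(set Bs))"

text \<open>The half-open unit cube [0,1)^D, the range of the Mal'cev coordinates tau.\<close>
definition unit_cube :: "nat \<Rightarrow> (nat \<Rightarrow> real) set" where
  "unit_cube D = {x \<in> pts D. \<forall>k<D. 0 \<le> x k \<and> x k < 1}"

text \<open>A connected simply connected nilpotent Lie group is realised as the
  image under exp of a Lie algebra of strictly upper triangular N x N matrices.\<close>

definition strict_upper :: "nat \<Rightarrow> real mat \<Rightarrow> bool" where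
  "strict_upper N X \<longleftrightarrow> X \<in> carrier_mat N N \<and> (\<forall>i<N. \<forall>j<N. j \<le> i \<longrightarrow> X $$ (i,j) = 0)"

fun mpow :: "nat \<Rightarrow> real mat \<Rightarrow> nat \<Rightarrow> real mat" where
  "mpow N A 0 = 1\<^sub>m N"
| "mpow N A (Suc k) = mpow N A k * A"

fun msum :: "nat \<Rightarrow> (nat \<Rightarrow> real mat) \<Rightarrow> nat \<Rightarrow> real mat" where
  "msum N h 0 = 0\<^sub>m N N"
| "msum N h (Suc k) = msum N h k + h k"

fun mprod :: "nat \<Rightarrow> (nat \<Rightarrow> real mat) \<Rightarrow> nat \<Rightarrow> real mat" where
  "mprod N h 0 = 1\<^sub>m N"
| "mprod N h (Suc k) = mprod N h k * h k"

text \<open>Matrix exponential of a strictly upper triangular (hence nilpotent) matrix: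
  the series terminates.\<close>
definition mexp :: "nat \<Rightarrow> real mat \<Rightarrow> real mat" where
  "mexp N X = msum N (\<lambda>k. (1 / fact k) \<cdot>\<^sub>m mpow N X k) N"

text \<open>Inverse of a unipotent matrix A = I + X: sum of (I - A)^k.\<close>
definition minv :: "nat \<Rightarrow> real mat \<Rightarrow> real mat" where
  "minv N A = msum N (\<lambda>k. mpow N (1\<^sub>m N - A) k) N"

definition gpow :: "nat \<Rightarrow> real mat \<Rightarrow> int \<Rightarrow> real mat" where
  "gpow N A k = (if k \<ge> 0 then mpow N A (nat k) else mpow N (minv N A) (nat (- k)))"

definition bracket :: "real mat \<Rightarrow> real mat \<Rightarrow> real mat" where
  "bracket X Y = X * Y - Y * X"

definition lincomb :: "nat \<Rightarrow> (nat \<Rightarrow> real mat) \<Rightarrow> nat \<Rightarrow> nat \<Rightarrow> (nat \<Rightarrow> real) \<Rightarrow> real mat" where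
  "lincomb N X a b c = msum N (\<lambda>k. c (a + k) \<cdot>\<^sub>m X (a + k)) (b - a)"

definition mspan :: "nat \<Rightarrow> (nat \<Rightarrow> real mat) \<Rightarrow> nat \<Rightarrow> nat \<Rightarrow> real mat set" where
  "mspan N X a b = {lincomb N X a b c | c. True}"

definition lie_group :: "nat \<Rightarrow> (nat \<Rightarrow> real mat) \<Rightarrow> nat \<Rightarrow> real mat set" where
  "lie_group N X D = mexp N ` mspan N X 0 D"

definition malprod :: "nat \<Rightarrow> (nat \<Rightarrow> real mat) \<Rightarrow> nat \<Rightarrow> nat \<Rightarrow> (nat \<Rightarrow> real) \<Rightarrow> real mat" where
  "malprod N X a D t = mprod N (\<lambda>k. mexp N (t (a + k) \<cdot>\<^sub>m X (a + k))) (D - a)"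

definition mal_lattice :: "nat \<Rightarrow> (nat \<Rightarrow> real mat) \<Rightarrow> nat \<Rightarrow> real mat set" where
  "mal_lattice N X D = {malprod N X 0 D t | t. \<forall>k<D. t k \<in> \<int>}"

definition is_subgroup :: "nat \<Rightarrow> real mat set \<Rightarrow> real mat set \<Rightarrow> bool" where
  "is_subgroup N H G \<longleftrightarrow> H \<subseteq> G \<and> 1\<^sub>m N \<in> H \<and> (\<forall>a\<in>H. \<forall>b\<in>H. a * b \<in> H \<and> minv N a \<in> H)"

text \<open>Gamma is a lattice in G: a discrete cocompact subgroup. Since G is a closed
  subset of the matrix space, cocompactness amounts to G = K Gamma for a bounded K.\<close>
definition is_lattice :: "nat \<Rightarrow> real mat set \<Rightarrow> real mat set \<Rightarrow> bool" where
  "is_lattice N Gam G \<longleftrightarrow> is_subgroup N Gam G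
     \<and> (\<exists>\<epsilon>>0. \<forall>\<gamma>\<in>Gam. (\<forall>i<N. \<forall>j<N. \<bar>\<gamma> $$ (i,j) - 1\<^sub>m N $$ (i,j)\<bar> < \<epsilon>) \<longrightarrow> \<gamma> = 1\<^sub>m N)
     \<and> (\<exists>K B. K \<subseteq> G \<and> (\<forall>k\<in>K. \<forall>i<N. \<forall>j<N. \<bar>k $$ (i,j)\<bar> \<le> B) \<and> G = {k * \<gamma> | k \<gamma>. k \<in> K \<and> \<gamma> \<in> Gam})"

definition is_filtration :: "nat \<Rightarrow> real mat set \<Rightarrow> nat \<Rightarrow> (nat \<Rightarrow> real mat set) \<Rightarrow> bool" where
  "is_filtration N G s Gf \<longleftrightarrow> Gf 0 = G \<and> Gf 1 = G \<and> Gf (Suc s) = {1\<^sub>m N}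
     \<and> (\<forall>i. is_subgroup N (Gf i) G \<and> Gf (Suc i) \<subseteq> Gf i)
     \<and> (\<forall>i j. \<forall>a\<in>Gf i. \<forall>b\<in>Gf j. a * b * minv N a * minv N b \<in> Gf (i + j))"

definition malcev_basis :: "nat \<Rightarrow> (nat \<Rightarrow> real mat) \<Rightarrow> nat \<Rightarrow> (nat \<Rightarrow> real mat set) \<Rightarrow> bool" where
  "malcev_basis N X D Gf \<longleftrightarrow>
     (\<forall>k<D. strict_upper N (X k))
     \<and> (\<forall>c. lincomb N X 0 D c = 0\<^sub>m N N \<longrightarrow> (\<forall>k<D. c k = 0))
     \<and> (\<forall>j\<le>D. \<forall>Y\<in>mspan N X 0 D. \<forall>Z\<in>mspan N X j D. bracket Y Z \<in> mspan N X j D)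
     \<and> (\<forall>i. \<exists>m\<le>D. Gf i = {malprod N X m D t | t. True}
            \<and> (\<forall>t t'. malprod N X m D t = malprod N X m D t' \<longrightarrow> (\<forall>k. m \<le> k \<and> k < D \<longrightarrow> t k = t' k)))"

definition binom_int :: "int \<Rightarrow> nat \<Rightarrow> int" where
  "binom_int n i = (\<Prod>j<i. n - int j) div fact i"

definition poly_seq :: "nat \<Rightarrow> nat \<Rightarrow> (nat \<Rightarrow> real mat) \<Rightarrow> int \<Rightarrow> real mat" where
  "poly_seq N s gs n = mprod N (\<lambda>i. gpow N (gs i) (binom_int n i)) (Suc s)"

definition in_poly_seq :: "nat \<Rightarrow> nat \<Rightarrow> (nat \<Rightarrow> real mat set) \<Rightarrow> (int \<Rightarrow> real mat) \<Rightarrow> bool" where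
  "in_poly_seq N s Gf g \<longleftrightarrow> (\<exists>gs. (\<forall>i\<le>s. gs i \<in> Gf i) \<and> g = poly_seq N s gs)"

text \<open>F : G -> R right-Gamma-invariant represents a map on G/Gamma. Mal'cev
  coordinates tau identify G/Gamma with [0,1)^D via t |-> malprod t Gamma.\<close>
definition piecewise_poly :: "nat \<Rightarrow> (nat \<Rightarrow> real mat) \<Rightarrow> nat \<Rightarrow> (real mat \<Rightarrow> real) \<Rightarrow> bool" where
  "piecewise_poly N X D F \<longleftrightarrow>
     (\<forall>g\<in>lie_group N X D. \<forall>\<gamma>\<in>mal_lattice N X D. F (g * \<gamma>) = F g)
     \<and> (\<exists>Ps :: ((nat \<Rightarrow> real) set \<times> ((nat \<Rightarrow> real) \<Rightarrow> real)) list.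
          (\<forall>(S, \<Phi>)\<in>set Ps. semialg D S \<and> poly_fun D \<Phi>)
        \<and> (\<Union>(S, \<Phi>)\<in>set Ps. S) = unit_cube D
        \<and> (\<forall>i<length Ps. \<forall>j<length Ps. i \<noteq> j \<longrightarrow> fst (Ps ! i) \<inter> fst (Ps ! j) = {})
        \<and> (\<forall>(S, \<Phi>)\<in>set Ps. \<forall>t\<in>S. F (malprod N X 0 D t) = \<Phi> t))"

end

theory Submission
  imports Defs
begin

text \<open>A unipotent matrix \<open>A\<close> factors uniquely as \<open>B C\<close> with \<open>C\<close> integral and the entries of \<open>B\<close> above
  the diagonal in \<open>[0,1)\<close>, and these entries are the Mal'cev coordinates of \<open>A \<Gamma>\<close> in the full
  unitriangular group. Every generalised polynomial is a combination, with polynomial coefficients,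
  of the entries of an integer vector \<open>y\<close> such that \<open>A y\<close> is a bounded function on a nilmanifold for
  some unipotent \<open>A\<close> with polynomial entries; this class is closed under products, since tensoring
  two such systems gives another one. If \<open>a\<close> is a polynomial row vector, put it on top of \<open>A\<close> and
  reduce the enlarged matrix to \<open>B' C'\<close>: then \<open>c = C' y\<close> satisfies \<open>B' c = A' y\<close>, so \<open>c\<close> is determined
  by bounded data except for its integral first entry, and the fractional part of \<open>a y\<close> becomes a
  piecewise polynomial function of reduced coordinates. Hence the floor of \<open>a y\<close> can be adjoined to
  the vector. A bounded generalised polynomial is an affine image of a fractional part.\<close>

section \<open>Generalised polynomials and reduction of unipotent matrices\<close>

text \<open>A generalised polynomial is in general unbounded, so it is not itself a function on a
  nilmanifold; only fractional parts are. This is why the induction keeps an unbounded integer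
  vector together with the unipotent matrix that makes it bounded. The second demand is uniformity:
  one group has to serve every \<open>p\<close> of degree at most \<open>d\<close>. So each notion
  concerns a family indexed by \<open>p\<close>, in which the matrix size \<open>N\<close>, the
  degree bound \<open>K\<close> and the function \<open>\<Phi>\<close> are fixed and only the
  polynomial entries vary with \<open>p\<close>. No filtration is chosen during the induction: it is
  enough to remember unipotent matrices with entries of degree at most \<open>K\<close>. The
  filtration comes from weights \<open>W i = (K + 1) * 2 ^ (N - i)\<close> on the rows. The factor
  \<open>K + 1\<close> leaves room for degree \<open>K\<close> at every position above the diagonal,
  so that each such matrix is a polynomial sequence; the powers of two order the positions in such a
  way that Mal'cev coordinates are plain matrix entries.\<close>

inductive floor_poly :: "'v set \<Rightarrow> (('v \<Rightarrow> real) \<Rightarrow> real) \<Rightarrow> bool" for V where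
  fl_const: "floor_poly V (\<lambda>x. c)"
| fl_var: "v \<in> V \<Longrightarrow> floor_poly V (\<lambda>x. x v)"
| fl_add: "floor_poly V P \<Longrightarrow> floor_poly V Q \<Longrightarrow> floor_poly V (\<lambda>x. P x + Q x)"
| fl_mult: "floor_poly V P \<Longrightarrow> floor_poly V Q \<Longrightarrow> floor_poly V (\<lambda>x. P x * Q x)"
| fl_floor: "floor_poly V P \<Longrightarrow> floor_poly V (\<lambda>x. of_int \<lfloor>P x\<rfloor>)"

lemma floor_poly_subst:
  assumes "floor_poly V \<Phi>" "\<And>v. v \<in> V \<Longrightarrow> \<sigma> v \<in> W"
  shows "floor_poly W (\<lambda>x. \<Phi> (\<lambda>v. x (\<sigma> v)))"
  using assms by (induction rule: floor_poly.induct) (auto intro: floor_poly.intros)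

lemma floor_poly_cong:
  assumes "floor_poly V \<Phi>" "\<And>v. v \<in> V \<Longrightarrow> x v = y v"
  shows "\<Phi> x = \<Phi> y"
  using assms by (induction rule: floor_poly.induct) auto

text \<open>For \<open>i < j\<close> the fractional part and the floor of \<open>red_aux A i j\<close> are the entries of \<open>B\<close> and \<open>C\<close>
  in the factorisation \<open>A = B C\<close>; only the entries of \<open>A\<close> above the diagonal are read.\<close>

function red_aux :: "(nat \<Rightarrow> nat \<Rightarrow> real) \<Rightarrow> nat \<Rightarrow> nat \<Rightarrow> real" where
  "red_aux A i j = A i j - (\<Sum>k\<in>{i<..<j}. frac (red_aux A i k) * of_int \<lfloor>red_aux A k j\<rfloor>)"
  by pat_completeness auto
termination by (relation "measure (\<lambda>(A, i, j). j - i)") auto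

declare red_aux.simps [simp del]

text \<open>The recursion for \<open>(i, j)\<close> reads only entries above the diagonal with
  indices between \<open>i\<close> and \<open>j\<close>. This locality allows the rest of a matrix
  to be filled arbitrarily or cut off.\<close>

lemma red_aux_cong:
  assumes "\<And>k l. i \<le> k \<Longrightarrow> k < l \<Longrightarrow> l \<le> j \<Longrightarrow> A k l = A' k l" "i < j"
  shows "red_aux A i j = red_aux A' i j"
  using assms
proof (induction "j - i" arbitrary: i j rule: less_induct)
  case less
  have "(\<Sum>k\<in>{i<..<j}. frac (red_aux A i k) * of_int \<lfloor>red_aux A k j\<rfloor>)
      = (\<Sum>k\<in>{i<..<j}. frac (red_aux A' i k) * of_int \<lfloor>red_aux A' k j\<rfloor>)"
  proof (rule sum.cong, simp)
    fix k assume k: "k \<in> {i<..<j}"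
    then have "red_aux A i k = red_aux A' i k" "red_aux A k j = red_aux A' k j"
      using less.prems by (auto intro!: less.hyps)
    then show "frac (red_aux A i k) * of_int \<lfloor>red_aux A k j\<rfloor> = frac (red_aux A' i k) * of_int \<lfloor>red_aux A' k j\<rfloor>"
      by simp
  qed
  then show ?case using less.prems
    by (subst (1 2) red_aux.simps) simp
qed

lemma red_aux_shift: "red_aux A (i + m) (j + m) = red_aux (\<lambda>i j. A (i + m) (j + m)) i j"
proof (induction "j - i" arbitrary: i j rule: less_induct)
  case less
  have eq: "{i + m<..<j + m} = (\<lambda>k. k + m) ` {i<..<j}"
    using image_add_atLeastLessThan'[of m "Suc i" j] by (simp add: atLeastSucLessThan_greaterThanLessThan)
  have "(\<Sum>k\<in>{i + m<..<j + m}. frac (red_aux A (i + m) k) * of_int \<lfloor>red_aux A k (j + m)\<rfloor>)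
     = (\<Sum>k\<in>{i<..<j}. frac (red_aux A (i + m) (k + m)) * of_int \<lfloor>red_aux A (k + m) (j + m)\<rfloor>)"
    unfolding eq by (subst sum.reindex) (auto simp: inj_on_def)
  also have "\<dots> = (\<Sum>k\<in>{i<..<j}. frac (red_aux (\<lambda>i j. A (i + m) (j + m)) i k)
                   * of_int \<lfloor>red_aux (\<lambda>i j. A (i + m) (j + m)) k j\<rfloor>)"
    by (rule sum.cong, simp) (use less in auto)
  finally show ?case
    by (subst (1 2) red_aux.simps) simp
qed

text \<open>Induction on \<open>j - i\<close>: the sum in the recursion involves positions closer to
  the diagonal only, so \<open>red_aux A i j\<close> comes out as \<open>B i j + C i j\<close>, and
  the bounds on \<open>B\<close> force \<open>C i j\<close> to be its floor.\<close>

lemma red_aux_unique: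
  assumes "\<And>k l. i \<le> k \<Longrightarrow> k < l \<Longrightarrow> l \<le> j \<Longrightarrow> A k l = B k l + C k l + (\<Sum>m\<in>{k<..<l}. B k m * C m l)"
    and "\<And>k l. i \<le> k \<Longrightarrow> k < l \<Longrightarrow> l \<le> j \<Longrightarrow> C k l \<in> \<int> \<and> 0 \<le> B k l \<and> B k l < 1"
    and "i < j"
  shows "frac (red_aux A i j) = B i j \<and> of_int \<lfloor>red_aux A i j\<rfloor> = C i j"
  using assms
proof (induction "j - i" arbitrary: i j rule: less_induct)
  case less
  have "(\<Sum>k\<in>{i<..<j}. frac (red_aux A i k) * of_int \<lfloor>red_aux A k j\<rfloor>) = (\<Sum>k\<in>{i<..<j}. B i k * C k j)"
  proof (rule sum.cong, simp)
    fix k assume k: "k \<in> {i<..<j}"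
    have "frac (red_aux A i k) = B i k \<and> of_int \<lfloor>red_aux A i k\<rfloor> = C i k"
      using k by (intro less.hyps less.prems) auto
    moreover have "frac (red_aux A k j) = B k j \<and> of_int \<lfloor>red_aux A k j\<rfloor> = C k j"
      using k by (intro less.hyps less.prems) auto
    ultimately show "frac (red_aux A i k) * of_int \<lfloor>red_aux A k j\<rfloor> = B i k * C k j" by simp
  qed
  then have r: "red_aux A i j = B i j + C i j"
    using less.prems(1)[of i j] less.prems(3) by (subst red_aux.simps) simp
  obtain c where c: "C i j = of_int c" using less.prems(2)[of i j] less.prems(3) by (auto elim: Ints_cases)
  have "\<lfloor>red_aux A i j\<rfloor> = c"
    using less.prems(2)[of i j] less.prems(3) unfolding r c by (intro floor_unique) auto
  then show ?case unfolding frac_def r c by simp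
qed

section \<open>Functions of reduced coordinates, uniform in a parameter\<close>

text \<open>Allowing floors inside \<open>\<Phi>\<close> makes closure under floor immediate. That
  such a \<open>\<Phi>\<close> is still piecewise polynomial rests on the boundedness of the
  coordinates and is left to \<open>floor_poly_partition\<close>.\<close>

definition nil_rep :: "('i \<Rightarrow> int \<Rightarrow> real) \<Rightarrow> bool" where
  "nil_rep \<phi> \<longleftrightarrow> (\<exists>N K \<Phi>. floor_poly {(i, j). i < j \<and> j < N} \<Phi> \<and>
     (\<forall>p. \<exists>P. (\<forall>i j. degree (P i j) \<le> K) \<and>
        (\<forall>n. \<phi> p n = \<Phi> (\<lambda>(i, j). frac (red_aux (\<lambda>i j. poly (P i j) (of_int n)) i j)))))"

lemma nil_repI:
  assumes "floor_poly {(i, j). i < j \<and> j < N} \<Phi>"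
    and "\<And>p. \<exists>P. (\<forall>i j. degree (P i j) \<le> K) \<and>
        (\<forall>n. \<phi> p n = \<Phi> (\<lambda>(i, j). frac (red_aux (\<lambda>i j. poly (P i j) (of_int n)) i j)))"
  shows "nil_rep \<phi>"
  using assms unfolding nil_rep_def by blast

text \<open>The two underlying groups are merged into one block-diagonal group.\<close>

lemma nil_rep_merge:
  assumes "nil_rep \<phi>" "nil_rep \<psi>"
  shows "\<exists>N K \<Phi> \<Psi>. floor_poly {(i, j). i < j \<and> j < N} \<Phi> \<and> floor_poly {(i, j). i < j \<and> j < N} \<Psi> \<and>
     (\<forall>p. \<exists>P. (\<forall>i j. degree (P i j) \<le> K) \<and>
        (\<forall>n. \<phi> p n = \<Phi> (\<lambda>(i, j). frac (red_aux (\<lambda>i j. poly (P i j) (of_int n)) i j)) \<and>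
             \<psi> p n = \<Psi> (\<lambda>(i, j). frac (red_aux (\<lambda>i j. poly (P i j) (of_int n)) i j))))"
proof -
  obtain N1 K1 \<Phi> where 1: "floor_poly {(i, j). i < j \<and> j < N1} \<Phi>"
    "\<And>p. \<exists>P. (\<forall>i j. degree (P i j) \<le> K1) \<and>
        (\<forall>n. \<phi> p n = \<Phi> (\<lambda>(i, j). frac (red_aux (\<lambda>i j. poly (P i j) (of_int n)) i j)))"
    using assms(1) unfolding nil_rep_def by blast
  obtain N2 K2 \<Psi> where 2: "floor_poly {(i, j). i < j \<and> j < N2} \<Psi>"
    "\<And>p. \<exists>P. (\<forall>i j. degree (P i j) \<le> K2) \<and>
        (\<forall>n. \<psi> p n = \<Psi> (\<lambda>(i, j). frac (red_aux (\<lambda>i j. poly (P i j) (of_int n)) i j)))"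
    using assms(2) unfolding nil_rep_def by blast
  let ?\<sigma> = "\<lambda>(i, j). (i + N1, j + N1)"
  have f1: "floor_poly {(i, j). i < j \<and> j < N1 + N2} (\<lambda>x. \<Phi> (\<lambda>v. x v))"
    by (rule floor_poly_subst[OF 1(1)]) auto
  have f2: "floor_poly {(i, j). i < j \<and> j < N1 + N2} (\<lambda>x. \<Psi> (\<lambda>v. x (?\<sigma> v)))"
    by (rule floor_poly_subst[OF 2(1)]) auto
  have "\<exists>P. (\<forall>i j. degree (P i j) \<le> max K1 K2) \<and>
        (\<forall>n. \<phi> p n = \<Phi> (\<lambda>(i, j). frac (red_aux (\<lambda>i j. poly (P i j) (of_int n)) i j)) \<and>
             \<psi> p n = \<Psi> (\<lambda>v. (\<lambda>(i, j). frac (red_aux (\<lambda>i j. poly (P i j) (of_int n)) i j)) (?\<sigma> v)))" for p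
  proof -
    obtain P1 where P1: "\<And>i j. degree (P1 i j) \<le> K1"
      "\<And>n. \<phi> p n = \<Phi> (\<lambda>(i, j). frac (red_aux (\<lambda>i j. poly (P1 i j) (of_int n)) i j))"
      using 1(2)[of p] by blast
    obtain P2 where P2: "\<And>i j. degree (P2 i j) \<le> K2"
      "\<And>n. \<psi> p n = \<Psi> (\<lambda>(i, j). frac (red_aux (\<lambda>i j. poly (P2 i j) (of_int n)) i j))"
      using 2(2)[of p] by blast
    \<comment> \<open>Entries with \<open>i < N1 \<le> j\<close> hold arbitrary values. They are
      never read: \<open>\<Phi>\<close> and \<open>\<Psi>\<close> use only positions inside one
      diagonal block, and reduction there stays inside that block.\<close>
    define P where "P i j = (if j < N1 then P1 i j else P2 (i - N1) (j - N1))" for i j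
    have "degree (P i j) \<le> max K1 K2" for i j
      using P1(1)[of i j] P2(1)[of "i - N1" "j - N1"] unfolding P_def by (auto simp: max_def)
    moreover have "\<phi> p n = \<Phi> (\<lambda>(i, j). frac (red_aux (\<lambda>i j. poly (P i j) (of_int n)) i j))" for n
      unfolding P1(2) 
    proof (rule floor_poly_cong[OF 1(1)], safe)
      fix i j assume "i < j" "j < N1"
      then have "red_aux (\<lambda>i j. poly (P1 i j) (of_int n)) i j = red_aux (\<lambda>i j. poly (P i j) (of_int n)) i j"
        by (intro red_aux_cong) (auto simp: P_def)
      then show "frac (red_aux (\<lambda>i j. poly (P1 i j) (of_int n)) i j) = frac (red_aux (\<lambda>i j. poly (P i j) (of_int n)) i j)"
        by simp
    qed
    moreover have "\<psi> p n = \<Psi> (\<lambda>v. (\<lambda>(i, j). frac (red_aux (\<lambda>i j. poly (P i j) (of_int n)) i j)) (?\<sigma> v))" for n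
      unfolding P2(2)
      by (rule floor_poly_cong[OF 2(1)]) (auto simp: red_aux_shift P_def)
    ultimately show ?thesis by blast
  qed
  then show ?thesis using f1 f2 by blast
qed

lemma nil_rep_const: "nil_rep (\<lambda>p n. c)"
  by (rule nil_repI[where N = 0 and K = 0 and \<Phi> = "\<lambda>x. c"])
     (auto intro: fl_const exI[of _ "\<lambda>i j. 0"])

lemma nil_rep_add:
  assumes "nil_rep \<phi>" "nil_rep \<psi>"
  shows "nil_rep (\<lambda>p n. \<phi> p n + \<psi> p n)"
proof -
  obtain N K \<Phi> \<Psi> where *: "floor_poly {(i, j). i < j \<and> j < N} \<Phi>" "floor_poly {(i, j). i < j \<and> j < N} \<Psi>"
     "\<And>p. \<exists>P. (\<forall>i j. degree (P i j) \<le> K) \<and>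
        (\<forall>n. \<phi> p n = \<Phi> (\<lambda>(i, j). frac (red_aux (\<lambda>i j. poly (P i j) (of_int n)) i j)) \<and>
             \<psi> p n = \<Psi> (\<lambda>(i, j). frac (red_aux (\<lambda>i j. poly (P i j) (of_int n)) i j)))"
    using nil_rep_merge[OF assms] by blast
  show ?thesis
  proof (rule nil_repI[OF fl_add[OF *(1,2)], of K])
    fix p
    obtain P where "\<forall>i j. degree (P i j) \<le> K"
      "\<And>n. \<phi> p n = \<Phi> (\<lambda>(i, j). frac (red_aux (\<lambda>i j. poly (P i j) (of_int n)) i j)) \<and>
           \<psi> p n = \<Psi> (\<lambda>(i, j). frac (red_aux (\<lambda>i j. poly (P i j) (of_int n)) i j))"
      using *(3)[of p] by blast
    then show "\<exists>P. (\<forall>i j. degree (P i j) \<le> K) \<and> (\<forall>n. \<phi> p n + \<psi> p n = \<Phi> (\<lambda>(i, j). frac (red_aux (\<lambda>i j. poly (P i j) (of_int n)) i j)) + \<Psi> (\<lambda>(i, j). frac (red_aux (\<lambda>i j. poly (P i j) (of_int n)) i j)))" by (intro exI[of _ P]) simp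
  qed
qed

lemma nil_rep_mult:
  assumes "nil_rep \<phi>" "nil_rep \<psi>"
  shows "nil_rep (\<lambda>p n. \<phi> p n * \<psi> p n)"
proof -
  obtain N K \<Phi> \<Psi> where *: "floor_poly {(i, j). i < j \<and> j < N} \<Phi>" "floor_poly {(i, j). i < j \<and> j < N} \<Psi>"
     "\<And>p. \<exists>P. (\<forall>i j. degree (P i j) \<le> K) \<and>
        (\<forall>n. \<phi> p n = \<Phi> (\<lambda>(i, j). frac (red_aux (\<lambda>i j. poly (P i j) (of_int n)) i j)) \<and>
             \<psi> p n = \<Psi> (\<lambda>(i, j). frac (red_aux (\<lambda>i j. poly (P i j) (of_int n)) i j)))"
    using nil_rep_merge[OF assms] by blast
  show ?thesis
  proof (rule nil_repI[OF fl_mult[OF *(1,2)], of K])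
    fix p
    obtain P where "\<forall>i j. degree (P i j) \<le> K"
      "\<And>n. \<phi> p n = \<Phi> (\<lambda>(i, j). frac (red_aux (\<lambda>i j. poly (P i j) (of_int n)) i j)) \<and>
           \<psi> p n = \<Psi> (\<lambda>(i, j). frac (red_aux (\<lambda>i j. poly (P i j) (of_int n)) i j))"
      using *(3)[of p] by blast
    then show "\<exists>P. (\<forall>i j. degree (P i j) \<le> K) \<and> (\<forall>n. \<phi> p n * \<psi> p n = \<Phi> (\<lambda>(i, j). frac (red_aux (\<lambda>i j. poly (P i j) (of_int n)) i j)) * \<Psi> (\<lambda>(i, j). frac (red_aux (\<lambda>i j. poly (P i j) (of_int n)) i j)))" by (intro exI[of _ P]) simp
  qed
qed

lemma nil_rep_floor:
  assumes "nil_rep \<phi>"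
  shows "nil_rep (\<lambda>p n. of_int \<lfloor>\<phi> p n\<rfloor>)"
proof -
  obtain N K \<Phi> where *: "floor_poly {(i, j). i < j \<and> j < N} \<Phi>"
    "\<And>p. \<exists>P. (\<forall>i j. degree (P i j) \<le> K) \<and>
        (\<forall>n. \<phi> p n = \<Phi> (\<lambda>(i, j). frac (red_aux (\<lambda>i j. poly (P i j) (of_int n)) i j)))"
    using assms(1) unfolding nil_rep_def by blast
  show ?thesis
  proof (rule nil_repI[OF fl_floor[OF *(1)], of K])
    fix p
    obtain P where "\<forall>i j. degree (P i j) \<le> K"
      "\<And>n. \<phi> p n = \<Phi> (\<lambda>(i, j). frac (red_aux (\<lambda>i j. poly (P i j) (of_int n)) i j))"
      using *(2)[of p] by blast
    then show "\<exists>P. (\<forall>i j. degree (P i j) \<le> K) \<and> (\<forall>n. of_int \<lfloor>\<phi> p n\<rfloor> = of_int \<lfloor>\<Phi> (\<lambda>(i, j). frac (red_aux (\<lambda>i j. poly (P i j) (of_int n)) i j))\<rfloor>)" by (intro exI[of _ P]) simp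
  qed
qed

lemma nil_rep_diff:
  assumes "nil_rep \<phi>" "nil_rep \<psi>"
  shows "nil_rep (\<lambda>p n. \<phi> p n - \<psi> p n)"
  using nil_rep_add[OF assms(1) nil_rep_mult[OF nil_rep_const[of "-1"] assms(2)]] by simp

lemma nil_rep_frac:
  assumes "nil_rep \<phi>"
  shows "nil_rep (\<lambda>p n. frac (\<phi> p n))"
  unfolding frac_def by (intro nil_rep_diff nil_rep_floor assms)

lemma nil_rep_sum:
  assumes "finite I" "\<And>k. k \<in> I \<Longrightarrow> nil_rep (\<phi> k)"
  shows "nil_rep (\<lambda>p n. \<Sum>k\<in>I. \<phi> k p n)"
  using assms by (induction rule: finite_induct) (auto intro: nil_rep_const nil_rep_add)

section \<open>Uniform degree bounds, spans with polynomial coefficients, triangular systems\<close>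

definition bounded_degree :: "('i \<Rightarrow> real poly) \<Rightarrow> bool" where
  "bounded_degree q \<longleftrightarrow> (\<exists>K. \<forall>p. degree (q p) \<le> K)"

lemma bounded_degree_const: "bounded_degree (\<lambda>p. c)"
  unfolding bounded_degree_def by blast

lemma bounded_degree_mult:
  assumes "bounded_degree q" "bounded_degree r"
  shows "bounded_degree (\<lambda>p. q p * r p)"
proof -
  obtain K L where "\<And>p. degree (q p) \<le> K" "\<And>p. degree (r p) \<le> L"
    using assms unfolding bounded_degree_def by blast
  then have "degree (q p * r p) \<le> K + L" for p
    by (meson add_mono degree_mult_le order_trans)
  then show ?thesis unfolding bounded_degree_def by blast
qed

lemma bounded_degree_add:
  assumes "bounded_degree q" "bounded_degree r"
  shows "bounded_degree (\<lambda>p. q p + r p)"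
proof -
  obtain K L where "\<And>p. degree (q p) \<le> K" "\<And>p. degree (r p) \<le> L"
    using assms unfolding bounded_degree_def by blast
  then have "degree (q p + r p) \<le> max K L" for p
    by (meson degree_add_le max.coboundedI1 max.coboundedI2)
  then show ?thesis unfolding bounded_degree_def by blast
qed

text \<open>The degree bound may depend on the position. Position \<open>(i, j)\<close> reads only
  indices up to \<open>j\<close>, so the matrix is cut off there and finitely many bounds remain to
  be maximised.\<close>

lemma nil_rep_reduced_entry:
  fixes Q :: "nat \<Rightarrow> nat \<Rightarrow> 'i \<Rightarrow> real poly"
  assumes "\<And>i j. bounded_degree (Q i j)" "i < j"
  shows "nil_rep (\<lambda>p n. frac (red_aux (\<lambda>i j. poly (Q i j p) (of_int n)) i j))"
proof -
  obtain K where K: "\<And>i j p. degree (Q i j p) \<le> K i j"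
    using assms(1) unfolding bounded_degree_def by metis
  define L where "L = Max ((\<lambda>(i, j). K i j) ` ({..j} \<times> {..j}))"
  have L: "degree (Q k l p) \<le> L" if "k \<le> j" "l \<le> j" for k l p
  proof -
    have "K k l \<le> L" unfolding L_def using that by (intro Max_ge) (auto intro!: rev_image_eqI[of "(k, l)"])
    then show ?thesis using K[of k l p] by simp
  qed
  show ?thesis
  proof (rule nil_repI[where N = "Suc j" and K = L and \<Phi> = "\<lambda>x. x (i, j)"])
    show "floor_poly {(i, k). i < k \<and> k < Suc j} (\<lambda>x. x (i, j))"
      by (rule fl_var) (use assms(2) in auto)
    fix p
    show "\<exists>P. (\<forall>i j. degree (P i j) \<le> L) \<and>
        (\<forall>n. frac (red_aux (\<lambda>i j. poly (Q i j p) (of_int n)) i j) = (\<lambda>(i, j). frac (red_aux (\<lambda>i j. poly (P i j) (of_int n)) i j)) (i, j))"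
    proof (intro exI conjI allI)
      fix k l
      show "degree (if k \<le> j \<and> l \<le> j then Q k l p else 0) \<le> L" using L by auto
    next
      fix n
      have "red_aux (\<lambda>i j. poly (Q i j p) (of_int n)) i j = red_aux (\<lambda>k l. poly (if k \<le> j \<and> l \<le> j then Q k l p else 0) (of_int n)) i j"
        by (rule red_aux_cong) (use assms(2) in auto)
      then show "frac (red_aux (\<lambda>i j. poly (Q i j p) (of_int n)) i j) =
        (\<lambda>(i, k). frac (red_aux (\<lambda>k l. poly (if k \<le> j \<and> l \<le> j then Q k l p else 0) (of_int n)) i k)) (i, j)"
        by simp
    qed
  qed
qed

text \<open>The module generated by \<open>V\<close> over polynomials in \<open>n\<close> whose
  coefficients may depend on \<open>p\<close> under a uniform degree bound. The inductive form
  avoids index bookkeeping when \<open>V\<close> is enlarged or multiplied;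
  \<open>poly_span_coeffs\<close> recovers coefficients for a list.\<close>

inductive poly_span :: "('i \<Rightarrow> int \<Rightarrow> real) set \<Rightarrow> ('i \<Rightarrow> int \<Rightarrow> real) \<Rightarrow> bool" for V where
  ps_zero: "poly_span V (\<lambda>p n. 0)"
| ps_step: "poly_span V u \<Longrightarrow> bounded_degree q \<Longrightarrow> v \<in> V \<Longrightarrow> poly_span V (\<lambda>p n. poly (q p) (of_int n) * v p n + u p n)"

lemma poly_span_mono:
  assumes "poly_span V u" "V \<subseteq> W"
  shows "poly_span W u"
  using assms by (induction rule: poly_span.induct) (auto intro: poly_span.intros)

lemma poly_span_add:
  assumes "poly_span V u" "poly_span V w"
  shows "poly_span V (\<lambda>p n. u p n + w p n)"
  using assms(1)
proof (induction rule: poly_span.induct)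
  case (ps_step u q v)
  then show ?case using poly_span.ps_step[OF ps_step.IH, of q v] by (simp add: add.assoc)
qed (use assms in simp)

lemma poly_span_scale:
  assumes "poly_span V u" "bounded_degree r"
  shows "poly_span V (\<lambda>p n. poly (r p) (of_int n) * u p n)"
  using assms(1)
proof (induction rule: poly_span.induct)
  case (ps_step u q v)
  then show ?case using poly_span.ps_step[OF ps_step.IH bounded_degree_mult[OF assms(2) ps_step.hyps(2)], of v]
    by (simp add: algebra_simps)
qed (use poly_span.ps_zero in simp)

lemma poly_span_scale_const:
  assumes "poly_span V u"
  shows "poly_span V (\<lambda>p n. c * u p n)"
  using poly_span_scale[OF assms bounded_degree_const[of "[:c:]"]] by simp

lemma poly_span_base: "v \<in> V \<Longrightarrow> poly_span V v"
  using ps_step[OF ps_zero bounded_degree_const[of 1], of v V] by simp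

text \<open>Multiplication by \<open>w\<close> is linear over the polynomial coefficients, so it
  suffices to know where it sends the generators.\<close>

lemma poly_span_bind:
  assumes "poly_span V u" "\<And>v. v \<in> V \<Longrightarrow> poly_span W (\<lambda>p n. v p n * w p n)"
  shows "poly_span W (\<lambda>p n. u p n * w p n)"
  using assms(1)
proof (induction rule: poly_span.induct)
  case (ps_step u q v)
  show ?case using poly_span_add[OF poly_span_scale[OF assms(2)[OF ps_step.hyps(3)] ps_step.hyps(2)] ps_step.IH]
    by (simp add: algebra_simps)
qed (use poly_span.ps_zero in simp)

lemma poly_span_mult:
  assumes "poly_span V u" "poly_span W w" "\<And>x y. x \<in> V \<Longrightarrow> y \<in> W \<Longrightarrow> (\<lambda>p n. x p n * y p n) \<in> U"
  shows "poly_span U (\<lambda>p n. u p n * w p n)"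
proof (rule poly_span_bind[OF assms(1)])
  fix v assume v: "v \<in> V"
  have "poly_span U (\<lambda>p n. w p n * v p n)"
  proof (rule poly_span_bind[OF assms(2)])
    fix y assume "y \<in> W"
    moreover have "(\<lambda>p n. y p n * v p n) = (\<lambda>p n. v p n * y p n)" by (intro ext mult.commute)
    ultimately show "poly_span U (\<lambda>p n. y p n * v p n)" using poly_span_base[OF assms(3)[OF v]] by simp
  qed
  then show "poly_span U (\<lambda>p n. v p n * w p n)" by (simp add: mult.commute)
qed

lemma poly_span_coeffs:
  assumes "poly_span (set vs) u"
  shows "\<exists>a. (\<forall>k. bounded_degree (a k)) \<and> (\<forall>p n. u p n = (\<Sum>k<length vs. poly (a k p) (of_int n) * (vs ! k) p n))"
  using assms
proof (induction rule: poly_span.induct)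
  case ps_zero
  then show ?case by (intro exI[of _ "\<lambda>k p. 0"]) (auto intro: bounded_degree_const)
next
  case (ps_step u q v)
  obtain a where a: "\<And>k. bounded_degree (a k)" "\<And>p n. u p n = (\<Sum>k<length vs. poly (a k p) (of_int n) * (vs ! k) p n)"
    using ps_step.IH by blast
  obtain l where l: "l < length vs" "vs ! l = v" using ps_step.hyps by (auto simp: in_set_conv_nth)
  define b where "b = a(l := (\<lambda>p. a l p + q p))"
  have "bounded_degree (b k)" for k unfolding b_def using a(1) ps_step.hyps bounded_degree_add by auto
  moreover have "poly (q p) (of_int n) * v p n + u p n = (\<Sum>k<length vs. poly (b k p) (of_int n) * (vs ! k) p n)" for p n
  proof -
    have "(\<Sum>k<length vs. poly (b k p) (of_int n) * (vs ! k) p n)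
        = (\<Sum>k<length vs. (if k = l then poly (q p) (of_int n) * v p n else 0) + poly (a k p) (of_int n) * (vs ! k) p n)"
      by (rule sum.cong) (auto simp: b_def l algebra_simps)
    also have "\<dots> = poly (q p) (of_int n) * v p n + u p n"
      unfolding sum.distrib a(2) using l by simp
    finally show ?thesis by simp
  qed
  ultimately show ?case by blast
qed

text \<open>\<open>triangular vs\<close> says that the integer vector \<open>vs\<close> is carried to a bounded vector of
  nilsequence type by a unipotent matrix with polynomial entries.\<close>

inductive triangular :: "('i \<Rightarrow> int \<Rightarrow> real) list \<Rightarrow> bool" where
  tri_Nil: "triangular []"
| tri_Cons: "triangular vs \<Longrightarrow> (\<And>p n. v p n \<in> \<int>) \<Longrightarrow> poly_span (set vs) u \<Longrightarrow>
    nil_rep (\<lambda>p n. v p n + u p n) \<Longrightarrow> triangular (v # vs)"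

text \<open>Appending entries at the end only enlarges the span from which the corrections
  \<open>u\<close> are taken.\<close>

lemma triangular_append:
  assumes "triangular vs" "triangular ws"
  shows "triangular (vs @ ws)"
  using assms(1)
proof (induction rule: triangular.induct)
  case (tri_Cons vs v u)
  show ?case unfolding append_Cons
    by (rule triangular.tri_Cons[OF tri_Cons.IH tri_Cons.hyps(2) poly_span_mono[OF tri_Cons.hyps(3)] tri_Cons.hyps(4)]) auto
qed (use assms in simp)

definition prod_list_fun :: "('i \<Rightarrow> int \<Rightarrow> real) list \<Rightarrow> ('i \<Rightarrow> int \<Rightarrow> real) list \<Rightarrow> ('i \<Rightarrow> int \<Rightarrow> real) list" where
  "prod_list_fun vs ws = concat (map (\<lambda>v. map (\<lambda>w p n. v p n * w p n) ws) vs)"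

text \<open>The identity \<open>(v + u) * (w + u') = v * w + (v * u' + u * w + u * u')\<close> has a
  product of bounded functions on the left. In the lexicographic order of
  \<open>prod_list_fun\<close> the correction involves only later products: \<open>v * u'\<close>
  has the same \<open>v\<close> and later \<open>w\<close>, the other two terms have later
  \<open>v\<close> and any \<open>w\<close>.\<close>

lemma triangular_product:
  assumes "triangular vs" "triangular ws"
  shows "triangular (prod_list_fun vs ws)"
  using assms(1)
proof (induction rule: triangular.induct)
  case tri_Nil
  then show ?case by (simp add: prod_list_fun_def triangular.tri_Nil)
next
  case (tri_Cons vs v u)
  \<comment> \<open>The inner induction shortens only the block belonging to \<open>v\<close>; the
    blocks of the later entries of \<open>vs\<close> must keep all of \<open>ws\<close>, since
    \<open>u * w\<close> and \<open>u * u'\<close> land there.\<close>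
  have "set ws' \<subseteq> set ws \<Longrightarrow> triangular (map (\<lambda>w p n. v p n * w p n) ws' @ prod_list_fun vs ws)" if "triangular ws'" for ws'
    using that
  proof (induction rule: triangular.induct)
    case tri_Nil
    then show ?case using tri_Cons.IH by simp
  next
    case (tri_Cons ws' w u')
    let ?T = "map (\<lambda>w p n. v p n * w p n) ws' @ prod_list_fun vs ws"
    have mem: "(\<lambda>p n. x p n * y p n) \<in> set ?T" if "x \<in> set vs" "y \<in> set ws" for x y
      using that by (auto simp: prod_list_fun_def)
    have "poly_span (set ?T) (\<lambda>p n. v p n * u' p n)"
      by (rule poly_span_mult[OF poly_span_base tri_Cons.hyps(3), of v "{v}"]) auto
    moreover have "poly_span (set ?T) (\<lambda>p n. u p n * w p n)"
      by (rule poly_span_mult[OF \<open>poly_span (set vs) u\<close> poly_span_base, of w "set ws"]) (use mem tri_Cons.prems in auto)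
    moreover have "poly_span (set ?T) (\<lambda>p n. u p n * u' p n)"
      by (rule poly_span_mult[OF \<open>poly_span (set vs) u\<close> tri_Cons.hyps(3)]) (use mem tri_Cons.prems in auto)
    ultimately have "poly_span (set ?T) (\<lambda>p n. v p n * u' p n + (u p n * w p n + u p n * u' p n))"
      by (intro poly_span_add)
    moreover have "nil_rep (\<lambda>p n. v p n * w p n + (v p n * u' p n + (u p n * w p n + u p n * u' p n)))"
      using nil_rep_mult[OF \<open>nil_rep (\<lambda>p n. v p n + u p n)\<close> tri_Cons.hyps(4)] by (simp add: algebra_simps)
    moreover have "v p n * w p n \<in> \<int>" for p n
      using \<open>\<And>p n. v p n \<in> \<int>\<close> tri_Cons.hyps(2) by simp
    moreover have "triangular ?T" using tri_Cons by auto
    ultimately show ?case unfolding list.map append_Cons by (intro triangular.tri_Cons)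
  qed
  from this[OF assms(2)] show ?case by (simp add: prod_list_fun_def)
qed

lemma triangular_matrix:
  assumes "triangular vs"
  shows "\<exists>Q. (\<forall>i j. bounded_degree (Q i j)) \<and> (\<forall>i<length vs. nil_rep (\<lambda>p n. (vs ! i) p n +
      (\<Sum>k\<in>{i<..<length vs}. poly (Q i k p) (of_int n) * (vs ! k) p n)))"
  using assms
proof (induction rule: triangular.induct)
  case tri_Nil
  then show ?case by (intro exI[of _ "\<lambda>i j p. 0"]) (auto intro: bounded_degree_const)
next
  case (tri_Cons vs v u)
  obtain Q where Q: "\<And>i j. bounded_degree (Q i j)" "\<And>i. i<length vs \<Longrightarrow> nil_rep (\<lambda>p n. (vs ! i) p n +
      (\<Sum>k\<in>{i<..<length vs}. poly (Q i k p) (of_int n) * (vs ! k) p n))"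
    using tri_Cons.IH by blast
  obtain a where a: "\<And>k. bounded_degree (a k)" "\<And>p n. u p n = (\<Sum>k<length vs. poly (a k p) (of_int n) * (vs ! k) p n)"
    using poly_span_coeffs[OF tri_Cons.hyps(3)] by blast
  \<comment> \<open>The new coefficients become row 0 and the old matrix moves down and right by
    one. Column 0 is never read, because the sums run over \<open>k > i\<close>, so the truncated
    \<open>j - 1\<close> does no harm.\<close>
  define R where "R i j = (case i of 0 \<Rightarrow> a (j - 1) | Suc i' \<Rightarrow> Q i' (j - 1))" for i j
  have shift: "{i<..<Suc m} = Suc ` {k. i \<le> k \<and> k < m}" for i m :: nat
    using image_Suc_atLeastLessThan[of i m] by (auto simp: atLeastLessThan_def atLeast_def lessThan_def Int_def atLeastSucLessThan_greaterThanLessThan)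
  have "bounded_degree (R i j)" for i j unfolding R_def using a Q by (cases i) auto
  moreover have "nil_rep (\<lambda>p n. ((v # vs) ! i) p n +
      (\<Sum>k\<in>{i<..<length (v # vs)}. poly (R i k p) (of_int n) * ((v # vs) ! k) p n))" if i: "i < length (v # vs)" for i
  proof -
    have *: "(\<Sum>k\<in>{i<..<length (v # vs)}. poly (R i k p) (of_int n) * ((v # vs) ! k) p n)
        = (\<Sum>k | i \<le> k \<and> k < length vs. poly (R i (Suc k) p) (of_int n) * (vs ! k) p n)" for p n
      unfolding list.size add_Suc_right add_0_right shift by (subst sum.reindex) auto
    show ?thesis
    proof (cases i)
      case 0
      then show ?thesis unfolding * using tri_Cons.hyps(4) by (simp add: R_def a(2) lessThan_def)
    next
      case (Suc i')
      have "{k. i \<le> k \<and> k < length vs} = {i'<..<length vs}" using Suc by auto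
      then show ?thesis unfolding * using Q(2)[of i'] i Suc by (simp add: R_def)
    qed
  qed
  ultimately show ?case by blast
qed

lemma triangular_Ints: "triangular vs \<Longrightarrow> i < length vs \<Longrightarrow> (vs ! i) p n \<in> \<int>"
  by (induction arbitrary: i rule: triangular.induct) (auto simp: nth_Cons split: nat.splits)

text \<open>If \<open>A = B C\<close> is the reduction of a unipotent matrix, then \<open>A y = B (C y)\<close>.\<close>

lemma red_aux_action:
  fixes A :: "nat \<Rightarrow> nat \<Rightarrow> real" and y :: "nat \<Rightarrow> real" and N :: nat
  defines "c \<equiv> \<lambda>i. y i + (\<Sum>k\<in>{i<..<N}. of_int \<lfloor>red_aux A i k\<rfloor> * y k)"
  shows "y i + (\<Sum>k\<in>{i<..<N}. A i k * y k) = c i + (\<Sum>k\<in>{i<..<N}. frac (red_aux A i k) * c k)"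
proof -
  let ?B = "\<lambda>i k. frac (red_aux A i k)" and ?C = "\<lambda>i k. of_int \<lfloor>red_aux A i k\<rfloor> :: real"
  have A: "A i l = ?B i l + ?C i l + (\<Sum>k\<in>{i<..<l}. ?B i k * ?C k l)" for l
    using red_aux.simps[of A i l] by (simp add: frac_def)
  have "(\<Sum>k\<in>{i<..<N}. ?B i k * (\<Sum>l\<in>{k<..<N}. ?C k l * y l))
      = (\<Sum>k\<in>{i<..<N}. \<Sum>l | l \<in> {i<..<N} \<and> k < l. ?B i k * ?C k l * y l)"
    unfolding sum_distrib_left by (intro sum.cong) (auto simp: mult.assoc)
  also have "\<dots> = (\<Sum>l\<in>{i<..<N}. \<Sum>k | k \<in> {i<..<N} \<and> k < l. ?B i k * ?C k l * y l)"
    by (rule sum.swap_restrict) auto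
  also have "\<dots> = (\<Sum>l\<in>{i<..<N}. (\<Sum>k\<in>{i<..<l}. ?B i k * ?C k l) * y l)"
    unfolding sum_distrib_right by (intro sum.cong) auto
  finally have sw: "(\<Sum>k\<in>{i<..<N}. ?B i k * (\<Sum>l\<in>{k<..<N}. ?C k l * y l))
      = (\<Sum>l\<in>{i<..<N}. (\<Sum>k\<in>{i<..<l}. ?B i k * ?C k l) * y l)" .
  have "c i + (\<Sum>k\<in>{i<..<N}. ?B i k * c k) = y i + (\<Sum>k\<in>{i<..<N}. ?C i k * y k) + (\<Sum>k\<in>{i<..<N}. ?B i k * y k)
     + (\<Sum>k\<in>{i<..<N}. ?B i k * (\<Sum>l\<in>{k<..<N}. ?C k l * y l))"
    unfolding c_def distrib_left sum.distrib by simp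
  also have "\<dots> = y i + (\<Sum>k\<in>{i<..<N}. (?B i k + ?C i k + (\<Sum>l\<in>{i<..<k}. ?B i l * ?C l k)) * y k)"
    unfolding sw distrib_right sum.distrib by simp
  also have "\<dots> = y i + (\<Sum>k\<in>{i<..<N}. A i k * y k)"
    by (subst A) simp
  finally show ?thesis by simp
qed

lemma nil_rep_frac_top_row:
  fixes Q :: "nat \<Rightarrow> nat \<Rightarrow> 'i \<Rightarrow> real poly" and y :: "nat \<Rightarrow> 'i \<Rightarrow> int \<Rightarrow> real"
  assumes deg: "\<And>i j. bounded_degree (Q i j)"
    and int: "\<And>i p n. y i p n \<in> \<int>"
    and rep: "\<And>i. 0 < i \<Longrightarrow> i < N \<Longrightarrow> nil_rep (\<lambda>p n. y i p n + (\<Sum>k\<in>{i<..<N}. poly (Q i k p) (of_int n) * y k p n))"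
  shows "nil_rep (\<lambda>p n. frac (\<Sum>k\<in>{0<..<N}. poly (Q 0 k p) (of_int n) * y k p n))"
proof -
  let ?A = "\<lambda>p n i j. poly (Q i j p) (of_int n)"
  let ?B = "\<lambda>i k p n. frac (red_aux (?A p n) i k)"
  let ?C = "\<lambda>i k p n. of_int \<lfloor>red_aux (?A p n) i k\<rfloor> :: real"
  define c where "c i p n = y i p n + (\<Sum>k\<in>{i<..<N}. ?C i k p n * y k p n)" for i p n
  have B: "nil_rep (?B i k)" if "i < k" for i k
    using nil_rep_reduced_entry[OF deg that] by simp
  have act: "y i p n + (\<Sum>k\<in>{i<..<N}. ?A p n i k * y k p n) = c i p n + (\<Sum>k\<in>{i<..<N}. ?B i k p n * c k p n)" for i p n
    unfolding c_def by (rule red_aux_action)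
  \<comment> \<open>Back substitution from the last row upwards: the bounded left side of
    \<open>act\<close> and the reduced entries determine \<open>c i\<close> from the
    \<open>c k\<close> with \<open>k > i\<close>.\<close>
  have c: "nil_rep (c i)" if "0 < i" "i < N" for i
    using that
  proof (induction "N - i" arbitrary: i rule: less_induct)
    case less
    have "nil_rep (\<lambda>p n. (y i p n + (\<Sum>k\<in>{i<..<N}. ?A p n i k * y k p n)) - (\<Sum>k\<in>{i<..<N}. ?B i k p n * c k p n))"
      by (intro nil_rep_diff nil_rep_sum nil_rep_mult rep B less.hyps) (use less.prems in auto)
    then show ?case unfolding act by simp
  qed
  have "nil_rep (\<lambda>p n. frac (\<Sum>k\<in>{0<..<N}. ?B 0 k p n * c k p n))"
    by (intro nil_rep_frac nil_rep_sum nil_rep_mult B c) auto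
  moreover have "frac (\<Sum>k\<in>{0<..<N}. ?B 0 k p n * c k p n) = frac (\<Sum>k\<in>{0<..<N}. ?A p n 0 k * y k p n)" for p n
  proof -
    \<comment> \<open>Row 0 carries no boundedness assumption. Its equation determines the sum up to
      an integer, because the integral factor acts on integers, and \<open>frac\<close> does not see
      this integer.\<close>
    have "c 0 p n - y 0 p n \<in> \<int>" unfolding c_def using int by (auto intro!: Ints_sum)
    then obtain z where z: "c 0 p n - y 0 p n = of_int z" by (auto elim: Ints_cases)
    have "(\<Sum>k\<in>{0<..<N}. ?A p n 0 k * y k p n) = (\<Sum>k\<in>{0<..<N}. ?B 0 k p n * c k p n) + of_int z"
      using act[of 0 p n] unfolding z[symmetric] by simp
    then show ?thesis by (simp add: frac_def)
  qed
  ultimately show ?thesis by simp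
qed

theorem nil_rep_frac_poly_span:
  assumes "triangular vs" "poly_span (set vs) u"
  shows "nil_rep (\<lambda>p n. frac (u p n))"
proof -
  obtain a where a: "\<And>k. bounded_degree (a k)" "\<And>p n. u p n = (\<Sum>k<length vs. poly (a k p) (of_int n) * (vs ! k) p n)"
    using poly_span_coeffs[OF assms(2)] by blast
  obtain Q where Q: "\<And>i j. bounded_degree (Q i j)" "\<And>i. i<length vs \<Longrightarrow> nil_rep (\<lambda>p n. (vs ! i) p n +
      (\<Sum>k\<in>{i<..<length vs}. poly (Q i k p) (of_int n) * (vs ! k) p n))"
    using triangular_matrix[OF assms(1)] by blast
  define R where "R i j = (case i of 0 \<Rightarrow> a (j - 1) | Suc i' \<Rightarrow> Q i' (j - 1))" for i j
  \<comment> \<open>The entry above the old vector is 0, so row 0 applied to \<open>y\<close> is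
    \<open>u\<close> itself. The default 0 beyond the list keeps \<open>y\<close> integral at every
    index.\<close>
  define y where "y i p n = (case i of 0 \<Rightarrow> 0 | Suc i' \<Rightarrow> if i' < length vs then (vs ! i') p n else 0)" for i p n
  have shift: "{i<..<Suc m} = Suc ` {k. i \<le> k \<and> k < m}" for i m :: nat
    using image_Suc_atLeastLessThan[of i m] by (auto simp: atLeastLessThan_def atLeast_def lessThan_def Int_def atLeastSucLessThan_greaterThanLessThan)
  have *: "(\<Sum>k\<in>{i<..<Suc (length vs)}. poly (R i k p) (of_int n) * y k p n)
        = (\<Sum>k | i \<le> k \<and> k < length vs. poly (R i (Suc k) p) (of_int n) * (vs ! k) p n)" for i p n
    unfolding shift by (subst sum.reindex) (auto simp: y_def)
  have "nil_rep (\<lambda>p n. frac (\<Sum>k\<in>{0<..<Suc (length vs)}. poly (R 0 k p) (of_int n) * y k p n))"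
  proof (rule nil_rep_frac_top_row)
    show "bounded_degree (R i j)" for i j unfolding R_def using a Q by (cases i) auto
    show "y i p n \<in> \<int>" for i p n unfolding y_def using triangular_Ints[OF assms(1)] by (auto split: nat.splits)
    fix i assume "0 < i" "i < Suc (length vs)"
    then obtain i' where i': "i = Suc i'" "i' < length vs" by (cases i) auto
    then have "{k. i \<le> k \<and> k < length vs} = {i'<..<length vs}" by auto
    then show "nil_rep (\<lambda>p n. y i p n + (\<Sum>k\<in>{i<..<Suc (length vs)}. poly (R i k p) (of_int n) * y k p n))"
      unfolding * using Q(2)[OF i'(2)] i' by (simp add: R_def y_def)
  qed
  then show ?thesis unfolding * by (simp add: R_def a(2) lessThan_def)
qed

section \<open>Generalised polynomials as spans of triangular systems\<close>

definition gen_poly_family :: "('i \<Rightarrow> int \<Rightarrow> real) \<Rightarrow> bool" where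
  "gen_poly_family u \<longleftrightarrow> (\<exists>vs. triangular vs \<and> poly_span (set vs) u)"

lemma gen_poly_family_poly:
  assumes "bounded_degree q"
  shows "gen_poly_family (\<lambda>p n. poly (q p) (of_int n))"
proof -
  have "triangular [\<lambda>p n. 1]"
    by (rule tri_Cons[OF tri_Nil _ ps_zero]) (auto intro: nil_rep_const)
  moreover have "poly_span (set [\<lambda>p n. 1]) (\<lambda>p n. poly (q p) (of_int n) * 1)"
    by (rule poly_span_scale[OF poly_span_base assms]) simp
  ultimately show ?thesis unfolding gen_poly_family_def by auto
qed

lemma gen_poly_family_add:
  assumes "gen_poly_family u" "gen_poly_family w"
  shows "gen_poly_family (\<lambda>p n. u p n + w p n)"
proof -
  obtain vs ws where *: "triangular vs" "poly_span (set vs) u" "triangular ws" "poly_span (set ws) w"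
    using assms unfolding gen_poly_family_def by blast
  have "poly_span (set (vs @ ws)) (\<lambda>p n. u p n + w p n)"
    by (intro poly_span_add poly_span_mono[OF *(2)] poly_span_mono[OF *(4)]) auto
  then show ?thesis unfolding gen_poly_family_def using triangular_append[OF *(1,3)] by blast
qed

lemma gen_poly_family_mult:
  assumes "gen_poly_family u" "gen_poly_family w"
  shows "gen_poly_family (\<lambda>p n. u p n * w p n)"
proof -
  obtain vs ws where *: "triangular vs" "poly_span (set vs) u" "triangular ws" "poly_span (set ws) w"
    using assms unfolding gen_poly_family_def by blast
  have "poly_span (set (prod_list_fun vs ws)) (\<lambda>p n. u p n * w p n)"
    by (rule poly_span_mult[OF *(2,4)]) (auto simp: prod_list_fun_def)
  then show ?thesis unfolding gen_poly_family_def using triangular_product[OF *(1,3)] by blast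
qed

text \<open>For \<open>v = - floor u\<close> the sum \<open>v + u\<close> is the fractional part of
  \<open>u\<close>, so \<open>v\<close> may be put on top of the triangular list with
  \<open>u\<close> itself as correction. The coefficient -1 then restores the sign.\<close>

lemma gen_poly_family_floor:
  assumes "gen_poly_family u"
  shows "gen_poly_family (\<lambda>p n. of_int \<lfloor>u p n\<rfloor>)"
proof -
  obtain vs where *: "triangular vs" "poly_span (set vs) u"
    using assms unfolding gen_poly_family_def by blast
  let ?v = "\<lambda>p n. - of_int \<lfloor>u p n\<rfloor>"
  have "triangular (?v # vs)"
    by (rule tri_Cons[OF *(1) _ *(2)]) (use nil_rep_frac_poly_span[OF *] in \<open>auto simp: frac_def\<close>)
  moreover have "poly_span (set (?v # vs)) (\<lambda>p n. -1 * ?v p n)"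
    by (intro poly_span_scale_const poly_span_base) simp
  ultimately show ?thesis unfolding gen_poly_family_def by (intro exI[of _ "?v # vs"]) simp
qed

lemma gen_poly_family_compose:
  assumes "gen_poly_real h" "gen_poly_family u"
  shows "gen_poly_family (\<lambda>p n. h (u p n))"
  using assms(1)
proof (induction rule: gen_poly_real.induct)
  case (gp_poly q)
  show ?case
  \<comment> \<open>Horner's scheme reduces polynomials to closure under sums and products.\<close>
  proof (induction q)
    case 0
    then show ?case using gen_poly_family_poly[OF bounded_degree_const[of 0]] by simp
  next
    case (pCons c q)
    show ?case
      using gen_poly_family_add[OF gen_poly_family_poly[OF bounded_degree_const[of "[:c:]"]] gen_poly_family_mult[OF assms(2) pCons.IH]]
      by simp
  qed
qed (auto intro: gen_poly_family_add gen_poly_family_mult gen_poly_family_floor)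

text \<open>A function bounded by \<open>C\<close> is an affine image of its own fractional part after rescaling, so
  no growth analysis of generalised polynomials is needed.\<close>

theorem nil_rep_bounded:
  assumes "gen_poly_family u" "\<And>p n. \<bar>u p n\<bar> \<le> C"
  shows "nil_rep u"
proof -
  \<comment> \<open>This makes \<open>D\<close> positive and
    \<open>\<bar>u p n\<bar> < D / 2\<close> for every real \<open>C\<close>, so that
    \<open>u p n / D + 1 / 2\<close> lies strictly between 0 and 1.\<close>
  define D where "D = 2 * (\<bar>C\<bar> + 1)"
  have D: "D > 0" unfolding D_def by simp
  have "gen_poly_family (\<lambda>p n. poly [:1 / D:] (of_int n) * u p n + poly [:1 / 2:] (of_int n))"
    by (intro gen_poly_family_add gen_poly_family_mult gen_poly_family_poly bounded_degree_const assms(1))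
  then have "nil_rep (\<lambda>p n. frac (poly [:1 / D:] (of_int n) * u p n + poly [:1 / 2:] (of_int n)))"
    unfolding gen_poly_family_def using nil_rep_frac_poly_span by blast
  then have "nil_rep (\<lambda>p n. D * (frac (u p n / D + 1 / 2) - 1 / 2))"
    by (intro nil_rep_mult nil_rep_diff nil_rep_const) simp
  moreover have "D * (frac (u p n / D + 1 / 2) - 1 / 2) = u p n" for p n
  proof -
    have "\<bar>u p n\<bar> < D / 2" using assms(2)[of p n] unfolding D_def by simp
    then have "0 \<le> u p n / D + 1 / 2" "u p n / D + 1 / 2 < 1"
      using D by (auto simp: field_simps abs_less_iff)
    then have "frac (u p n / D + 1 / 2) = u p n / D + 1 / 2" by (simp add: frac_eq)
    then show ?thesis using D by simp
  qed
  ultimately show ?thesis by simp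
qed

section \<open>Piecewise polynomial functions on the unit cube\<close>

lemma basic_semialg_pts: "basic_semialg D (pts D)"
  unfolding basic_semialg_def by (intro exI[of _ "[]"]) auto

lemma basic_semialg_pos: "poly_fun D P \<Longrightarrow> basic_semialg D {x \<in> pts D. 0 < P x}"
  unfolding basic_semialg_def by (intro exI[of _ "[P]"] exI[of _ "[]"]) auto

lemma basic_semialg_zero: "poly_fun D P \<Longrightarrow> basic_semialg D {x \<in> pts D. P x = 0}"
  unfolding basic_semialg_def by (intro exI[of _ "[P]"] exI[of _ "[]"]) auto

lemma basic_semialg_Int:
  assumes "basic_semialg D S" "basic_semialg D T"
  shows "basic_semialg D (S \<inter> T)"
proof -
  obtain Ps Qs where 1: "\<forall>P\<in>set Ps. poly_fun D P" "\<forall>Q\<in>set Qs. poly_fun D Q"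
    "S = {x \<in> pts D. (\<forall>P\<in>set Ps. P x > 0) \<and> (\<forall>Q\<in>set Qs. Q x = 0)}"
    using assms(1) unfolding basic_semialg_def by blast
  obtain Ps' Qs' where 2: "\<forall>P\<in>set Ps'. poly_fun D P" "\<forall>Q\<in>set Qs'. poly_fun D Q"
    "T = {x \<in> pts D. (\<forall>P\<in>set Ps'. P x > 0) \<and> (\<forall>Q\<in>set Qs'. Q x = 0)}"
    using assms(2) unfolding basic_semialg_def by blast
  show ?thesis unfolding basic_semialg_def
    by (intro exI[of _ "Ps @ Ps'"] exI[of _ "Qs @ Qs'"]) (use 1 2 in auto)
qed

lemma semialg_basic: "basic_semialg D S \<Longrightarrow> semialg D S"
  unfolding semialg_def by (intro exI[of _ "[S]"]) auto

lemma semialg_Un: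
  assumes "semialg D S" "semialg D T"
  shows "semialg D (S \<union> T)"
proof -
  obtain Bs Cs where "\<forall>B\<in>set Bs. basic_semialg D B" "S = \<Union>(set Bs)" "\<forall>B\<in>set Cs. basic_semialg D B" "T = \<Union>(set Cs)"
    using assms unfolding semialg_def by blast
  then show ?thesis unfolding semialg_def by (intro exI[of _ "Bs @ Cs"]) auto
qed

lemma semialg_Int:
  assumes "semialg D S" "semialg D T"
  shows "semialg D (S \<inter> T)"
proof -
  obtain Bs Cs where "\<forall>B\<in>set Bs. basic_semialg D B" "S = \<Union>(set Bs)" "\<forall>B\<in>set Cs. basic_semialg D B" "T = \<Union>(set Cs)"
    using assms unfolding semialg_def by blast
  then show ?thesis unfolding semialg_def
    by (intro exI[of _ "[B \<inter> C. B \<leftarrow> Bs, C \<leftarrow> Cs]"]) (auto intro: basic_semialg_Int)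
qed

lemma poly_fun_diff_const: "poly_fun D P \<Longrightarrow> poly_fun D (\<lambda>x. P x - c)"
  using pf_add[OF _ pf_const[of D "- c"]] by simp

lemma poly_fun_const_diff: "poly_fun D P \<Longrightarrow> poly_fun D (\<lambda>x. c - P x)"
  using pf_add[OF pf_const[of D c] pf_mult[OF pf_const[of D "-1"]]] by simp

text \<open>Basic sets admit strict inequalities and equations only, so the weak bound is split into
  the pieces \<open>a < P x\<close> and \<open>P x = a\<close>.\<close>

lemma semialg_half_open:
  assumes "poly_fun D P"
  shows "semialg D {x \<in> pts D. a \<le> P x \<and> P x < b}"
proof -
  have 1: "semialg D ({x \<in> pts D. 0 < P x - a} \<union> {x \<in> pts D. P x - a = 0})"
    by (intro semialg_Un semialg_basic basic_semialg_pos basic_semialg_zero poly_fun_diff_const assms)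
  have 2: "semialg D {x \<in> pts D. 0 < b - P x}"
    by (intro semialg_basic basic_semialg_pos poly_fun_const_diff assms)
  have "({x \<in> pts D. 0 < P x - a} \<union> {x \<in> pts D. P x - a = 0}) \<inter> {x \<in> pts D. 0 < b - P x}
      = {x \<in> pts D. a \<le> P x \<and> P x < b}"
    by auto
  then show ?thesis using semialg_Int[OF 1 2] by simp
qed

lemma semialg_unit_cube: "semialg D (unit_cube D)"
proof -
  have "semialg D {x \<in> pts D. \<forall>k<m. 0 \<le> x k \<and> x k < 1}" if "m \<le> D" for m
    using that
  proof (induction m)
    case 0
    then show ?case using semialg_basic[OF basic_semialg_pts] by simp
  next
    case (Suc m)
    have "{x \<in> pts D. \<forall>k<Suc m. 0 \<le> x k \<and> x k < 1}
      = {x \<in> pts D. \<forall>k<m. 0 \<le> x k \<and> x k < 1} \<inter> {x \<in> pts D. 0 \<le> x m \<and> x m < 1}"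
      by (auto simp: less_Suc_eq)
    then show ?case using semialg_Int[OF Suc.IH semialg_half_open[OF pf_var[of m D], of 0 1]] Suc.prems by simp
  qed
  then show ?thesis unfolding unit_cube_def by blast
qed

text \<open>Disjointness is expressed through a common point. Intersecting pieces produces many
  empty ones, which may then occur with different polynomials without violating the
  condition.\<close>

definition poly_partition :: "nat \<Rightarrow> ((nat \<Rightarrow> real) set \<times> ((nat \<Rightarrow> real) \<Rightarrow> real)) set \<Rightarrow> ((nat \<Rightarrow> real) \<Rightarrow> real) \<Rightarrow> bool" where
  "poly_partition D \<P> F \<longleftrightarrow> finite \<P>
     \<and> (\<forall>S \<Phi>. (S, \<Phi>) \<in> \<P> \<longrightarrow> semialg D S \<and> poly_fun D \<Phi> \<and> S \<subseteq> unit_cube D \<and> (\<forall>t\<in>S. F t = \<Phi> t))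
     \<and> (\<forall>x\<in>unit_cube D. \<exists>S \<Phi>. (S, \<Phi>) \<in> \<P> \<and> x \<in> S)
     \<and> (\<forall>S \<Phi> T \<Psi> x. (S, \<Phi>) \<in> \<P> \<longrightarrow> (T, \<Psi>) \<in> \<P> \<longrightarrow> x \<in> S \<longrightarrow> x \<in> T \<longrightarrow> S = T \<and> \<Phi> = \<Psi>)"

lemma poly_partitionD:
  assumes "poly_partition D \<P> F"
  shows "finite \<P>" "(S, \<Phi>) \<in> \<P> \<Longrightarrow> semialg D S" "(S, \<Phi>) \<in> \<P> \<Longrightarrow> poly_fun D \<Phi>"
    "(S, \<Phi>) \<in> \<P> \<Longrightarrow> x \<in> S \<Longrightarrow> x \<in> unit_cube D"
    "(S, \<Phi>) \<in> \<P> \<Longrightarrow> x \<in> S \<Longrightarrow> F x = \<Phi> x"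
    "x \<in> unit_cube D \<Longrightarrow> \<exists>S \<Phi>. (S, \<Phi>) \<in> \<P> \<and> x \<in> S"
    "(S, \<Phi>) \<in> \<P> \<Longrightarrow> (T, \<Psi>) \<in> \<P> \<Longrightarrow> x \<in> S \<Longrightarrow> x \<in> T \<Longrightarrow> S = T \<and> \<Phi> = \<Psi>"
proof -
  have *: "finite \<P>" "\<And>S \<Phi>. (S, \<Phi>) \<in> \<P> \<Longrightarrow> semialg D S \<and> poly_fun D \<Phi> \<and> S \<subseteq> unit_cube D \<and> (\<forall>t\<in>S. F t = \<Phi> t)"
    "\<And>x. x \<in> unit_cube D \<Longrightarrow> \<exists>S \<Phi>. (S, \<Phi>) \<in> \<P> \<and> x \<in> S"
    "\<And>S \<Phi> T \<Psi> x. (S, \<Phi>) \<in> \<P> \<Longrightarrow> (T, \<Psi>) \<in> \<P> \<Longrightarrow> x \<in> S \<Longrightarrow> x \<in> T \<Longrightarrow> S = T \<and> \<Phi> = \<Psi>"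
    using assms unfolding poly_partition_def by simp_all
  show "finite \<P>" by (rule *)
  show "semialg D S" "poly_fun D \<Phi>" if "(S, \<Phi>) \<in> \<P>" using *(2)[OF that] by simp_all
  show "x \<in> unit_cube D" "F x = \<Phi> x" if "(S, \<Phi>) \<in> \<P>" "x \<in> S"
    using *(2)[OF that(1)] that(2) by auto
  show "\<exists>S \<Phi>. (S, \<Phi>) \<in> \<P> \<and> x \<in> S" if "x \<in> unit_cube D" by (rule *(3)[OF that])
  show "S = T \<and> \<Phi> = \<Psi>" if "(S, \<Phi>) \<in> \<P>" "(T, \<Psi>) \<in> \<P>" "x \<in> S" "x \<in> T" by (rule *(4)[OF that])
qed

lemma poly_partition_poly: "poly_fun D \<Phi> \<Longrightarrow> poly_partition D {(unit_cube D, \<Phi>)} \<Phi>"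
  unfolding poly_partition_def using semialg_unit_cube by simp

text \<open>Common refinement, with \<open>f\<close> standing for addition or
  multiplication.\<close>

lemma poly_partition_combine:
  assumes P: "poly_partition D \<P> F" and Q: "poly_partition D \<Q> G"
    and f: "\<And>P Q. poly_fun D P \<Longrightarrow> poly_fun D Q \<Longrightarrow> poly_fun D (\<lambda>x. f (P x) (Q x))"
  shows "\<exists>\<R>. poly_partition D \<R> (\<lambda>x. f (F x) (G x))"
proof -
  define \<R> where "\<R> = {(S \<inter> T, \<lambda>x. f (\<Phi> x) (\<Psi> x)) | S \<Phi> T \<Psi>. (S, \<Phi>) \<in> \<P> \<and> (T, \<Psi>) \<in> \<Q>}"
  have R: "\<exists>S \<Phi> T \<Psi>. U = S \<inter> T \<and> X = (\<lambda>x. f (\<Phi> x) (\<Psi> x)) \<and> (S, \<Phi>) \<in> \<P> \<and> (T, \<Psi>) \<in> \<Q>" if "(U, X) \<in> \<R>" for U X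
    using that unfolding \<R>_def by simp
  have "poly_partition D \<R> (\<lambda>x. f (F x) (G x))"
    unfolding poly_partition_def
  proof (intro conjI allI impI ballI)
    show "finite \<R>"
    proof (rule finite_surj[of "\<P> \<times> \<Q>" _ "\<lambda>((S, \<Phi>), (T, \<Psi>)). (S \<inter> T, \<lambda>x. f (\<Phi> x) (\<Psi> x))"])
      show "finite (\<P> \<times> \<Q>)" using poly_partitionD(1)[OF P] poly_partitionD(1)[OF Q] by simp
      show "\<R> \<subseteq> (\<lambda>((S, \<Phi>), (T, \<Psi>)). (S \<inter> T, \<lambda>x. f (\<Phi> x) (\<Psi> x))) ` (\<P> \<times> \<Q>)"
      proof
        fix r assume "r \<in> \<R>"
        then obtain S \<Phi> T \<Psi> where "r = (S \<inter> T, \<lambda>x. f (\<Phi> x) (\<Psi> x))" "(S, \<Phi>) \<in> \<P>" "(T, \<Psi>) \<in> \<Q>"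
          unfolding \<R>_def by blast
        then show "r \<in> (\<lambda>((S, \<Phi>), (T, \<Psi>)). (S \<inter> T, \<lambda>x. f (\<Phi> x) (\<Psi> x))) ` (\<P> \<times> \<Q>)"
          by (intro image_eqI[of _ _ "((S, \<Phi>), (T, \<Psi>))"]) auto
      qed
    qed
  next
    fix U X assume "(U, X) \<in> \<R>"
    from R[OF this] obtain S \<Phi> T \<Psi> where *: "U = S \<inter> T" "X = (\<lambda>x. f (\<Phi> x) (\<Psi> x))" "(S, \<Phi>) \<in> \<P>" "(T, \<Psi>) \<in> \<Q>"
      by (elim exE conjE)
    show "semialg D U" using * semialg_Int poly_partitionD(2)[OF P *(3)] poly_partitionD(2)[OF Q *(4)] by simp
    show "poly_fun D X" unfolding *(2) by (rule f[OF poly_partitionD(3)[OF P *(3)] poly_partitionD(3)[OF Q *(4)]])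
    show "U \<subseteq> unit_cube D" using *(1) poly_partitionD(4)[OF P *(3)] by blast
    fix t assume "t \<in> U"
    then show "f (F t) (G t) = X t" using * poly_partitionD(5)[OF P *(3)] poly_partitionD(5)[OF Q *(4)] by simp
  next
    fix x assume x: "x \<in> unit_cube D"
    obtain S \<Phi> T \<Psi> where "(S, \<Phi>) \<in> \<P>" "x \<in> S" "(T, \<Psi>) \<in> \<Q>" "x \<in> T"
      using poly_partitionD(6)[OF P x] poly_partitionD(6)[OF Q x] by blast
    then show "\<exists>U X. (U, X) \<in> \<R> \<and> x \<in> U"
      by (intro exI[of _ "S \<inter> T"] exI[of _ "\<lambda>x. f (\<Phi> x) (\<Psi> x)"]) (auto simp: \<R>_def)
  next
    fix U X V Y x assume "(U, X) \<in> \<R>" "(V, Y) \<in> \<R>" and x: "x \<in> U" "x \<in> V"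
    from R[OF this(1)] R[OF this(2)] obtain S \<Phi> T \<Psi> S' \<Phi>' T' \<Psi>' where
      1: "U = S \<inter> T" "X = (\<lambda>x. f (\<Phi> x) (\<Psi> x))" "(S, \<Phi>) \<in> \<P>" "(T, \<Psi>) \<in> \<Q>" and
      2: "V = S' \<inter> T'" "Y = (\<lambda>x. f (\<Phi>' x) (\<Psi>' x))" "(S', \<Phi>') \<in> \<P>" "(T', \<Psi>') \<in> \<Q>"
      by (elim exE conjE)
    have "S = S' \<and> \<Phi> = \<Phi>'" "T = T' \<and> \<Psi> = \<Psi>'"
      using poly_partitionD(7)[OF P 1(3) 2(3), of x] poly_partitionD(7)[OF Q 1(4) 2(4), of x] x 1(1) 2(1) by simp_all
    then show "U = V" "X = Y" using 1 2 by simp_all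
  qed
  then show ?thesis by blast
qed

text \<open>Each piece is sliced along \<open>k \<le> \<Phi> x < k + 1\<close>; the bound on
  \<open>F\<close> leaves finitely many values of \<open>k\<close>.\<close>

lemma poly_partition_floor:
  assumes P: "poly_partition D \<P> F" and C: "\<And>x. x \<in> unit_cube D \<Longrightarrow> \<bar>F x\<bar> \<le> of_int C"
  shows "\<exists>\<R>. poly_partition D \<R> (\<lambda>x. of_int \<lfloor>F x\<rfloor>)"
proof -
  let ?S = "\<lambda>S \<Phi> k. S \<inter> {x \<in> pts D. of_int k \<le> \<Phi> x \<and> \<Phi> x < of_int k + 1} :: (nat \<Rightarrow> real) set"
  let ?c = "(\<lambda>k x. of_int k) :: int \<Rightarrow> (nat \<Rightarrow> real) \<Rightarrow> real"
  define \<R> where "\<R> = {(?S S \<Phi> k, ?c k) | S \<Phi> k. (S, \<Phi>) \<in> \<P> \<and> k \<in> {- C..C}}"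
  have R: "\<exists>S \<Phi> k. U = ?S S \<Phi> k \<and> X = ?c k \<and> (S, \<Phi>) \<in> \<P>" if "(U, X) \<in> \<R>" for U X
    using that unfolding \<R>_def by blast
  have "poly_partition D \<R> (\<lambda>x. of_int \<lfloor>F x\<rfloor>)"
    unfolding poly_partition_def
  proof (intro conjI allI impI ballI)
    show "finite \<R>"
    proof (rule finite_surj[of "\<P> \<times> {- C..C}" _ "\<lambda>((S, \<Phi>), k). (?S S \<Phi> k, ?c k)"])
      show "finite (\<P> \<times> {- C..C})" using poly_partitionD(1)[OF P] by simp
      show "\<R> \<subseteq> (\<lambda>((S, \<Phi>), k). (?S S \<Phi> k, ?c k)) ` (\<P> \<times> {- C..C})"
      proof
        fix r assume "r \<in> \<R>"
        then obtain S \<Phi> k where "r = (?S S \<Phi> k, ?c k)" "(S, \<Phi>) \<in> \<P>" "k \<in> {- C..C}"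
          unfolding \<R>_def by blast
        then show "r \<in> (\<lambda>((S, \<Phi>), k). (?S S \<Phi> k, ?c k)) ` (\<P> \<times> {- C..C})"
          by (intro image_eqI[of _ _ "((S, \<Phi>), k)"]) auto
      qed
    qed
  next
    fix U X assume "(U, X) \<in> \<R>"
    from R[OF this] obtain S \<Phi> k where *: "U = ?S S \<Phi> k" "X = ?c k" "(S, \<Phi>) \<in> \<P>"
      by (elim exE conjE)
    show "semialg D U" unfolding *(1)
      by (intro semialg_Int semialg_half_open poly_partitionD(2)[OF P *(3)] poly_partitionD(3)[OF P *(3)])
    show "poly_fun D X" unfolding *(2) by (rule pf_const)
    show "U \<subseteq> unit_cube D" using *(1) poly_partitionD(4)[OF P *(3)] by blast
    fix t assume t: "t \<in> U"
    then have "F t = \<Phi> t" "of_int k \<le> \<Phi> t" "\<Phi> t < of_int k + 1" using * poly_partitionD(5)[OF P *(3)] by auto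
    then show "of_int \<lfloor>F t\<rfloor> = X t" using floor_unique[of k "F t"] *(2) by simp
  next
    fix x assume x: "x \<in> unit_cube D"
    obtain S \<Phi> where S: "(S, \<Phi>) \<in> \<P>" "x \<in> S"
      using poly_partitionD(6)[OF P x] by blast
    have "\<bar>\<Phi> x\<bar> \<le> of_int C" using C[OF x] poly_partitionD(5)[OF P S] by simp
    then have "- C \<le> \<lfloor>\<Phi> x\<rfloor> \<and> \<lfloor>\<Phi> x\<rfloor> \<le> C" by linarith
    moreover have "x \<in> ?S S \<Phi> \<lfloor>\<Phi> x\<rfloor>" using S x by (simp add: unit_cube_def)
    ultimately show "\<exists>U X. (U, X) \<in> \<R> \<and> x \<in> U" using S(1)
      by (intro exI[of _ "?S S \<Phi> \<lfloor>\<Phi> x\<rfloor>"] exI[of _ "?c \<lfloor>\<Phi> x\<rfloor>"]) (auto simp: \<R>_def)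
  next
    fix U X V Y x assume "(U, X) \<in> \<R>" "(V, Y) \<in> \<R>" and x: "x \<in> U" "x \<in> V"
    from R[OF this(1)] R[OF this(2)] obtain S \<Phi> k S' \<Phi>' k' where
      1: "U = ?S S \<Phi> k" "X = ?c k" "(S, \<Phi>) \<in> \<P>" and 2: "V = ?S S' \<Phi>' k'" "Y = ?c k'" "(S', \<Phi>') \<in> \<P>"
      by (elim exE conjE)
    have eq: "S = S' \<and> \<Phi> = \<Phi>'" using poly_partitionD(7)[OF P 1(3) 2(3), of x] x 1(1) 2(1) by simp
    have "\<lfloor>\<Phi> x\<rfloor> = k" "\<lfloor>\<Phi> x\<rfloor> = k'" using x 1(1) 2(1) eq by (auto intro: floor_unique)
    then show "U = V" "X = Y" using 1 2 eq by simp_all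
  qed
  then show ?thesis by blast
qed

lemma floor_poly_bounded:
  assumes "floor_poly {..<D} F"
  shows "\<exists>C. \<forall>x\<in>unit_cube D. \<bar>F x\<bar> \<le> C"
  using assms
proof (induction rule: floor_poly.induct)
  case (fl_var v)
  then show ?case by (intro exI[of _ 1]) (auto simp: unit_cube_def abs_if)
next
  case (fl_add P Q)
  then obtain C C' where "\<forall>x\<in>unit_cube D. \<bar>P x\<bar> \<le> C" "\<forall>x\<in>unit_cube D. \<bar>Q x\<bar> \<le> C'" by blast
  then have "\<forall>x\<in>unit_cube D. \<bar>P x + Q x\<bar> \<le> C + C'" by (meson abs_triangle_ineq add_mono order_trans)
  then show ?case by blast
next
  case (fl_mult P Q)
  then obtain C C' where "\<forall>x\<in>unit_cube D. \<bar>P x\<bar> \<le> C" "\<forall>x\<in>unit_cube D. \<bar>Q x\<bar> \<le> C'" by blast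
  then have "\<forall>x\<in>unit_cube D. \<bar>P x * Q x\<bar> \<le> C * C'" unfolding abs_mult by (meson abs_ge_zero mult_mono order_trans)
  then show ?case by blast
next
  case (fl_floor P)
  then obtain C where "\<forall>x\<in>unit_cube D. \<bar>P x\<bar> \<le> C" by blast
  then have "\<bar>of_int \<lfloor>P x\<rfloor>\<bar> \<le> C + 1" if "x \<in> unit_cube D" for x
  proof -
    have "\<bar>P x\<bar> \<le> C" using that \<open>\<forall>x\<in>unit_cube D. \<bar>P x\<bar> \<le> C\<close> by blast
    then show ?thesis by linarith
  qed
  then show ?case by blast
qed auto

theorem floor_poly_partition:
  assumes "floor_poly {..<D} F"
  shows "\<exists>\<P>. poly_partition D \<P> F"
  using assms
proof (induction rule: floor_poly.induct)
  case (fl_floor P)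
  obtain C where C: "\<forall>x\<in>unit_cube D. \<bar>P x\<bar> \<le> C" using floor_poly_bounded[OF fl_floor.hyps] by blast
  then have "\<forall>x\<in>unit_cube D. \<bar>P x\<bar> \<le> of_int \<lceil>C\<rceil>" by (meson le_of_int_ceiling order_trans)
  then show ?case using fl_floor.IH poly_partition_floor by blast
next
  case (fl_const c)
  show ?case using poly_partition_poly[OF pf_const] by blast
next
  case (fl_var v)
  then show ?case using poly_partition_poly[OF pf_var[of v D]] by blast
next
  case (fl_add P Q)
  then obtain \<P> \<Q> where "poly_partition D \<P> P" "poly_partition D \<Q> Q" by blast
  from poly_partition_combine[where f = "(+)", OF this pf_add] show ?case by blast
next
  case (fl_mult P Q)
  then obtain \<P> \<Q> where "poly_partition D \<P> P" "poly_partition D \<Q> Q" by blast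
  from poly_partition_combine[where f = "(*)", OF this pf_mult] show ?case by blast
qed

section \<open>Unipotent matrices\<close>

lemma mult_entry:
  assumes "A \<in> carrier_mat N N" "B \<in> carrier_mat N N" "i < N" "j < N"
  shows "(A * B) $$ (i, j) = (\<Sum>l<N. A $$ (i, l) * B $$ (l, j))"
  using assms by (simp add: scalar_prod_def atLeast0LessThan)

lemma
  fixes A B C :: "real mat"
  assumes "A \<in> carrier_mat N N" "B \<in> carrier_mat N N" "C \<in> carrier_mat N N"
  shows sq_assoc: "A * B * C = A * (B * C)"
    and sq_minus_mult: "(A - B) * C = A * C - B * C"
    and sq_mult_minus: "A * (B - C) = A * B - A * C"
    and sq_add_mult: "(A + B) * C = A * C + B * C"
    and sq_mult_add: "A * (B + C) = A * B + A * C"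
  using assms by (simp_all add: assoc_mult_mat[of _ N N _ N _ N] minus_mult_distrib_mat[of _ N N _ _ N]
    mult_minus_distrib_mat[of _ N N _ N] add_mult_distrib_mat[of _ N N _ _ N] mult_add_distrib_mat[of _ N N _ N])

lemma
  fixes A B :: "real mat"
  assumes "A \<in> carrier_mat N N" "B \<in> carrier_mat N N" "i < N" "j < N"
  shows add_entry: "(A + B) $$ (i, j) = A $$ (i, j) + B $$ (i, j)"
    and minus_entry: "(A - B) $$ (i, j) = A $$ (i, j) - B $$ (i, j)"
  using assms by auto

lemma smult_entry:
  fixes A :: "real mat"
  assumes "A \<in> carrier_mat N N" "i < N" "j < N"
  shows "(c \<cdot>\<^sub>m A) $$ (i, j) = c * A $$ (i, j)"
  using assms by auto

lemma sq_mult_carrier [simp]: "A \<in> carrier_mat N N \<Longrightarrow> B \<in> carrier_mat N N \<Longrightarrow> A * B \<in> carrier_mat N N"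
  by (rule mult_carrier_mat)

declare minus_carrier_mat [simp]

lemma mpow_carrier [simp]: "A \<in> carrier_mat N N \<Longrightarrow> mpow N A k \<in> carrier_mat N N"
  by (induction k) auto

lemma msum_carrier [simp]: "(\<And>k. k < n \<Longrightarrow> h k \<in> carrier_mat N N) \<Longrightarrow> msum N h n \<in> carrier_mat N N"
  by (induction n) auto

lemma msum_entry:
  assumes "\<And>k. k < n \<Longrightarrow> h k \<in> carrier_mat N N" "i < N" "j < N"
  shows "msum N h n $$ (i, j) = (\<Sum>k<n. h k $$ (i, j))"
  using assms
proof (induction n)
  case (Suc n)
  then show ?case using Suc by (simp add: add_entry[of _ N])
qed simp

lemma mprod_cong: "(\<And>k. k < n \<Longrightarrow> h k = h' k) \<Longrightarrow> mprod N h n = mprod N h' n"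
  by (induction n) auto

lemma mprod_carrier [simp]: "(\<And>k. k < n \<Longrightarrow> h k \<in> carrier_mat N N) \<Longrightarrow> mprod N h n \<in> carrier_mat N N"
  by (induction n) auto

lemma mpow_commute:
  assumes "A \<in> carrier_mat N N"
  shows "mpow N A k * A = A * mpow N A k"
proof (induction k)
  case (Suc k)
  have "mpow N A (Suc k) * A = A * mpow N A k * A" using Suc by simp
  also have "\<dots> = A * mpow N A (Suc k)" using assms by (simp add: sq_assoc[of _ N])
  finally show ?case .
qed (use assms in simp)

section \<open>Weight gradings and unipotent matrices\<close>

text \<open>Position \<open>(i, j)\<close> is thought of as having weight \<open>W i - W j\<close>,
  and entries of weight below \<open>m\<close> must vanish. The additive form of the inequality
  avoids truncated subtraction.\<close>

definition graded :: "nat \<Rightarrow> (nat \<Rightarrow> nat) \<Rightarrow> nat \<Rightarrow> real mat set" where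
  "graded N W m = {Z \<in> carrier_mat N N. \<forall>i<N. \<forall>j<N. W i < W j + m \<longrightarrow> Z $$ (i, j) = 0}"

lemma gradedI:
  "Z \<in> carrier_mat N N \<Longrightarrow> (\<And>i j. i < N \<Longrightarrow> j < N \<Longrightarrow> W i < W j + m \<Longrightarrow> Z $$ (i, j) = 0) \<Longrightarrow> Z \<in> graded N W m"
  unfolding graded_def by blast

lemma graded_carrier: "Z \<in> graded N W m \<Longrightarrow> Z \<in> carrier_mat N N"
  unfolding graded_def by blast

lemma gradedD: "Z \<in> graded N W m \<Longrightarrow> i < N \<Longrightarrow> j < N \<Longrightarrow> W i < W j + m \<Longrightarrow> Z $$ (i, j) = 0"
  unfolding graded_def by blast

lemma graded_mono: "Z \<in> graded N W m \<Longrightarrow> m' \<le> m \<Longrightarrow> Z \<in> graded N W m'"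
  unfolding graded_def by auto

lemma graded_zero: "0\<^sub>m N N \<in> graded N W m"
  unfolding graded_def by auto

lemma graded_one: "1\<^sub>m N \<in> graded N W 0"
  unfolding graded_def by auto

lemma graded_add: "Y \<in> graded N W m \<Longrightarrow> Z \<in> graded N W m \<Longrightarrow> Y + Z \<in> graded N W m"
  unfolding graded_def by auto

lemma graded_minus: "Y \<in> graded N W m \<Longrightarrow> Z \<in> graded N W m \<Longrightarrow> Y - Z \<in> graded N W m"
  unfolding graded_def by auto

lemma graded_smult: "Z \<in> graded N W m \<Longrightarrow> c \<cdot>\<^sub>m Z \<in> graded N W m"
  unfolding graded_def by auto

text \<open>If \<open>W i < W j + (m + m')\<close>, then for every intermediate \<open>l\<close>
  either \<open>W i < W l + m\<close> or \<open>W l < W j + m'\<close>, so each term of the entry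
  has a zero factor.\<close>

lemma graded_mult:
  assumes "Y \<in> graded N W m" "Z \<in> graded N W m'"
  shows "Y * Z \<in> graded N W (m + m')"
proof (rule gradedI)
  show "Y * Z \<in> carrier_mat N N" using assms[THEN graded_carrier] by simp
  fix i j assume ij: "i < N" "j < N" "W i < W j + (m + m')"
  have "Y $$ (i, l) * Z $$ (l, j) = 0" if "l < N" for l
    using gradedD[OF assms(1) ij(1) that] gradedD[OF assms(2) that ij(2)] ij(3)
    by (cases "W i < W l + m") auto
  then show "(Y * Z) $$ (i, j) = 0"
    unfolding mult_entry[OF assms[THEN graded_carrier] ij(1,2)] by (intro sum.neutral) blast
qed

lemma graded_mpow: "Z \<in> graded N W m \<Longrightarrow> mpow N Z k \<in> graded N W (m * k)"
proof (induction k)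
  case (Suc k)
  then show ?case using graded_mult[of "mpow N Z k" N W "m * k" Z m] by (simp add: add.commute)
qed (simp add: graded_one)

lemma graded_msum: "(\<And>k. k < n \<Longrightarrow> h k \<in> graded N W m) \<Longrightarrow> msum N h n \<in> graded N W m"
  by (induction n) (auto intro: graded_zero graded_add)

definition upper :: "nat \<Rightarrow> real mat set" where
  "upper N = {X. strict_upper N X}"

text \<open>Strict triangularity is a special case of the grading. With \<open>W i = N - i\<close>
  the weight is the distance from the diagonal, which yields nilpotency from
  \<open>graded_mpow\<close>.\<close>

lemma upper_eq_graded:
  assumes "\<And>i j. i < j \<Longrightarrow> j < N \<Longrightarrow> W j < W i"
  shows "upper N = graded N W 1"
proof -
  have "j \<le> i \<longleftrightarrow> W i < W j + 1" if "i < N" "j < N" for i j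
    using assms[of i j] assms[of j i] that by (cases i j rule: linorder_cases) auto
  then show ?thesis unfolding upper_def strict_upper_def graded_def by auto
qed

lemma upper_graded: "upper N = graded N (\<lambda>i. N - i) 1"
  by (rule upper_eq_graded) auto

lemma upper_carrier: "X \<in> upper N \<Longrightarrow> X \<in> carrier_mat N N"
  unfolding upper_def strict_upper_def by blast

lemma upperD: "X \<in> upper N \<Longrightarrow> j \<le> i \<Longrightarrow> i < N \<Longrightarrow> j < N \<Longrightarrow> X $$ (i, j) = 0"
  unfolding upper_def strict_upper_def by blast

lemma upper_mpow_entry:
  assumes "X \<in> upper N" "i < N" "j < N" "j < i + k"
  shows "mpow N X k $$ (i, j) = 0"
  using gradedD[OF graded_mpow[of X N "\<lambda>i. N - i" 1 k]] assms unfolding upper_graded by auto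

lemma upper_nilpotent:
  assumes "X \<in> upper N"
  shows "mpow N X N = 0\<^sub>m N N"
  by (rule eq_matI) (use assms mpow_carrier[OF upper_carrier[OF assms], of N] upper_mpow_entry[OF assms] in auto)

text \<open>Here \<open>W\<close> is arbitrary, so both conditions are kept: \<open>upper\<close>
  makes the finite series \<open>minv\<close> a true inverse, while \<open>graded\<close> records
  the depth in the filtration.\<close>

definition unip :: "nat \<Rightarrow> (nat \<Rightarrow> nat) \<Rightarrow> nat \<Rightarrow> real mat set" where
  "unip N W m = {A \<in> carrier_mat N N. A - 1\<^sub>m N \<in> upper N \<inter> graded N W m}"

lemma unip_carrier: "A \<in> unip N W m \<Longrightarrow> A \<in> carrier_mat N N"
  unfolding unip_def by blast

lemma unip_upper: "A \<in> unip N W m \<Longrightarrow> A - 1\<^sub>m N \<in> upper N"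
  unfolding unip_def by blast

lemma unip_graded: "A \<in> unip N W m \<Longrightarrow> A - 1\<^sub>m N \<in> graded N W m"
  unfolding unip_def by blast

lemma unip_mono: "A \<in> unip N W m \<Longrightarrow> m' \<le> m \<Longrightarrow> A \<in> unip N W m'"
  unfolding unip_def using graded_mono by auto

lemma mat_one_plus_minus: "A \<in> carrier_mat N N \<Longrightarrow> 1\<^sub>m N + (A - 1\<^sub>m N) = (A :: real mat)"
  by (rule eq_matI) auto

lemma unip_graded0: 
  assumes "A \<in> unip N W m" 
  shows "A \<in> graded N W 0"
proof -
  have "1\<^sub>m N + (A - 1\<^sub>m N) \<in> graded N W 0"
    by (intro graded_add graded_one graded_mono[OF unip_graded[OF assms]]) simp
  then show ?thesis using mat_one_plus_minus[OF unip_carrier[OF assms]] by simp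
qed

lemma unip_one: "1\<^sub>m N \<in> unip N W m"
  unfolding unip_def upper_graded graded_def by auto

lemma upper_mult_unip:
  assumes "X \<in> upper N \<inter> graded N W m" "A \<in> unip N W' m'" "A \<in> graded N W 0"
  shows "X * A \<in> upper N \<inter> graded N W m"
proof -
  have "A \<in> unip N (\<lambda>i. N - i) 1" using assms(2) unfolding unip_def upper_graded by blast
  then have "A \<in> graded N (\<lambda>i. N - i) 0" by (rule unip_graded0)
  then show ?thesis using assms graded_mult[of X N W m A 0] graded_mult[of X N "\<lambda>i. N - i" 1 A 0]
    unfolding upper_graded by simp
qed

lemma unip_mult:
  assumes "A \<in> unip N W m" "B \<in> unip N W m"
  shows "A * B \<in> unip N W m"
proof -
  have c: "A \<in> carrier_mat N N" "B \<in> carrier_mat N N" using assms[THEN unip_carrier] by auto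
  have 1: "(A - 1\<^sub>m N) * B \<in> upper N \<inter> graded N W m"
    using upper_mult_unip[OF _ assms(2) unip_graded0[OF assms(2)]] assms(1) unfolding unip_def by blast
  have "(A - 1\<^sub>m N) * B = A * B - B" using c by (simp add: sq_minus_mult[of _ N])
  then have eq: "A * B - 1\<^sub>m N = (A - 1\<^sub>m N) * B + (B - 1\<^sub>m N)"
    by (intro eq_matI) (use c in auto)
  have "A * B - 1\<^sub>m N \<in> upper N \<inter> graded N W m"
    unfolding eq using 1 assms(2) graded_add unfolding unip_def upper_graded by auto
  then show ?thesis using c unfolding unip_def by simp
qed

lemma geometric_msum:
  assumes "Y \<in> carrier_mat N N"
  shows "(1\<^sub>m N - Y) * msum N (mpow N Y) n = 1\<^sub>m N - mpow N Y n"
    "msum N (mpow N Y) n * (1\<^sub>m N - Y) = 1\<^sub>m N - mpow N Y n"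
proof -
  have c: "msum N (mpow N Y) n \<in> carrier_mat N N" "mpow N Y n \<in> carrier_mat N N" for n using assms by auto
  have "Y * mpow N Y n = mpow N Y n * Y" for n using mpow_commute[OF assms] by simp
  then have "(1\<^sub>m N - Y) * mpow N Y n = mpow N Y n - mpow N Y n * Y" "mpow N Y n * (1\<^sub>m N - Y) = mpow N Y n - mpow N Y n * Y" for n
    using assms by (simp_all add: sq_minus_mult[of _ N] sq_mult_minus[of _ N] left_mult_one_mat[of _ N N] right_mult_one_mat[of _ N N])
  note s = this
  have telescope: "(1\<^sub>m N - P) + (P - Q) = 1\<^sub>m N - Q" if "P \<in> carrier_mat N N" "Q \<in> carrier_mat N N" for P Q :: "real mat"
    using that by (intro eq_matI) auto
  show "(1\<^sub>m N - Y) * msum N (mpow N Y) n = 1\<^sub>m N - mpow N Y n"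
  proof (induction n)
    case (Suc n)
    have "(1\<^sub>m N - Y) * msum N (mpow N Y) (Suc n) = (1\<^sub>m N - mpow N Y n) + (mpow N Y n - mpow N Y n * Y)"
      using assms c Suc s by (simp add: sq_mult_add[of _ N])
    also have "\<dots> = 1\<^sub>m N - mpow N Y (Suc n)" using telescope[of "mpow N Y n" "mpow N Y n * Y"] assms by simp
    finally show ?case .
  qed (use assms in auto)
  show "msum N (mpow N Y) n * (1\<^sub>m N - Y) = 1\<^sub>m N - mpow N Y n"
  proof (induction n)
    case (Suc n)
    have "msum N (mpow N Y) (Suc n) * (1\<^sub>m N - Y) = (1\<^sub>m N - mpow N Y n) + (mpow N Y n - mpow N Y n * Y)"
      using assms c Suc s by (simp add: sq_add_mult[of _ N])
    also have "\<dots> = 1\<^sub>m N - mpow N Y (Suc n)" using telescope[of "mpow N Y n" "mpow N Y n * Y"] assms by simp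
    finally show ?case .
  qed (use assms in auto)
qed

lemma minv_carrier: "A \<in> carrier_mat N N \<Longrightarrow> minv N A \<in> carrier_mat N N"
  unfolding minv_def by simp

lemma minv_inverse:
  assumes "A \<in> unip N W m"
  shows "A * minv N A = 1\<^sub>m N" "minv N A * A = 1\<^sub>m N"
proof -
  have c: "A \<in> carrier_mat N N" using unip_carrier[OF assms] .
  have "1\<^sub>m N - A = (-1) \<cdot>\<^sub>m (A - 1\<^sub>m N)" by (rule eq_matI) (use c in auto)
  then have "1\<^sub>m N - A \<in> upper N"
    using unip_upper[OF assms] graded_smult unfolding upper_graded by simp
  then have n: "mpow N (1\<^sub>m N - A) N = 0\<^sub>m N N" by (rule upper_nilpotent)
  have A: "1\<^sub>m N - (1\<^sub>m N - A) = A" by (rule eq_matI) (use c in auto)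
  have cc: "1\<^sub>m N - A \<in> carrier_mat N N" using c by simp
  show "A * minv N A = 1\<^sub>m N" "minv N A * A = 1\<^sub>m N"
    using geometric_msum[OF cc, of N] unfolding A n minv_def by auto
qed

text \<open>From \<open>A * minv N A = 1\<close> follows
  \<open>minv N A - 1 = (1 - A) * minv N A\<close>, where the left factor has weight
  \<open>m\<close> and the right one weight 0.\<close>

lemma minv_unip:
  assumes "A \<in> unip N W m"
  shows "minv N A \<in> unip N W m"
proof -
  have c: "A \<in> carrier_mat N N" "minv N A \<in> carrier_mat N N" using unip_carrier[OF assms] minv_carrier by auto
  have eqY: "1\<^sub>m N - A = (-1) \<cdot>\<^sub>m (A - 1\<^sub>m N)" by (rule eq_matI) (use c in auto)
  have Y: "1\<^sub>m N - A \<in> upper N" "1\<^sub>m N - A \<in> graded N W m"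
    unfolding eqY using unip_upper[OF assms] unip_graded[OF assms] graded_smult unfolding upper_graded by simp_all
  have m0: "minv N A \<in> graded N W 0" "minv N A \<in> graded N (\<lambda>i. N - i) 0"
    unfolding minv_def using Y graded_mono[OF graded_mpow] unfolding upper_graded by (blast intro: graded_msum)+
  have "(1\<^sub>m N - A) * minv N A = minv N A - A * minv N A"
    using c by (simp add: sq_minus_mult[of _ N])
  then have eq: "minv N A - 1\<^sub>m N = (1\<^sub>m N - A) * minv N A" using minv_inverse[OF assms] by simp
  have "minv N A - 1\<^sub>m N \<in> upper N \<inter> graded N W m"
    unfolding eq using graded_mult[OF Y(2) m0(1)] Y(1) graded_mult[OF _ m0(2), of _ 1] unfolding upper_graded by simp
  then show ?thesis using c unfolding unip_def by simp
qed

text \<open>The commutator minus 1 equals \<open>(a * b - b * a) * minv N a * minv N b\<close>, and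
  \<open>a * b - b * a\<close> is also the bracket of \<open>a - 1\<close> and \<open>b - 1\<close>,
  in which the weights add up.\<close>

lemma unip_commutator:
  assumes "a \<in> unip N W m" "b \<in> unip N W m'"
  shows "a * b * minv N a * minv N b \<in> unip N W (m + m')"
proof -
  have c: "a \<in> carrier_mat N N" "b \<in> carrier_mat N N" "minv N a \<in> carrier_mat N N" "minv N b \<in> carrier_mat N N"
    using unip_carrier assms minv_carrier by auto
  let ?U = "minv N a * minv N b"
  have a0: "a \<in> unip N W 0" "b \<in> unip N W 0" using unip_mono assms by auto
  have U: "?U \<in> unip N W 0" by (intro unip_mult minv_unip a0)
  have "b * a * ?U = b * ((a * minv N a) * minv N b)"
    using c by (simp add: sq_assoc[of _ N])
  then have one: "b * a * ?U = 1\<^sub>m N" using minv_inverse[OF assms(1)] minv_inverse[OF assms(2)] c by simp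
  have "(a - 1\<^sub>m N) * (b - 1\<^sub>m N) = (a * b - b) - (a - 1\<^sub>m N)" "(b - 1\<^sub>m N) * (a - 1\<^sub>m N) = (b * a - a) - (b - 1\<^sub>m N)"
    using c by (simp_all add: sq_minus_mult[of _ N] sq_mult_minus[of _ N])
  then have eq: "a * b - b * a = (a - 1\<^sub>m N) * (b - 1\<^sub>m N) - (b - 1\<^sub>m N) * (a - 1\<^sub>m N)"
    by (intro eq_matI) (use c in auto)
  have ab: "a * b - b * a \<in> upper N \<inter> graded N W (m + m')"
  proof
    show "a * b - b * a \<in> graded N W (m + m')" unfolding eq
      using graded_mult[OF unip_graded[OF assms(1)] unip_graded[OF assms(2)]]
        graded_mult[OF unip_graded[OF assms(2)] unip_graded[OF assms(1)]]
      by (intro graded_minus) (auto simp: add.commute)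
    have u: "a - 1\<^sub>m N \<in> graded N (\<lambda>i. N - i) 1" "b - 1\<^sub>m N \<in> graded N (\<lambda>i. N - i) 1"
      using assms[THEN unip_upper] unfolding upper_graded by auto
    show "a * b - b * a \<in> upper N" unfolding eq upper_graded
      by (rule graded_mono[OF graded_minus[OF graded_mult[OF u] graded_mult[OF u(2) u(1)]]]) simp
  qed
  have "a * b * minv N a * minv N b = a * b * ?U" using c by (simp add: sq_assoc[of _ N])
  moreover have "(a * b - b * a) * ?U = a * b * ?U - 1\<^sub>m N"
    unfolding one[symmetric] using c by (intro sq_minus_mult[of _ N]) auto
  ultimately have "a * b * minv N a * minv N b - 1\<^sub>m N \<in> upper N \<inter> graded N W (m + m')"
    using upper_mult_unip[OF ab U unip_graded0[OF U]] by simp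
  then show ?thesis using c unfolding unip_def by simp
qed

lemma unip_entry:
  assumes "A \<in> unip N W m" "i < N" "j \<le> i"
  shows "A $$ (i, j) = (if i = j then 1 else 0)"
  using upperD[OF unip_upper[OF assms(1)] assms(3,2)] assms(2,3) unip_carrier[OF assms(1)] by auto

text \<open>The unit diagonals isolate the two end terms of the sum, which gives the product rule
  the shape of the recursion for \<open>red_aux\<close>.\<close>

lemma unip_mult_entry:
  assumes "A \<in> unip N W m" "B \<in> unip N W m" "i < j" "j < N"
  shows "(A * B) $$ (i, j) = A $$ (i, j) + B $$ (i, j) + (\<Sum>l\<in>{i<..<j}. A $$ (i, l) * B $$ (l, j))"
proof -
  have "(A * B) $$ (i, j) = (\<Sum>l<N. A $$ (i, l) * B $$ (l, j))"
    using assms by (intro mult_entry unip_carrier) auto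
  also have "\<dots> = (\<Sum>l\<in>{i..j}. A $$ (i, l) * B $$ (l, j))"
  proof (rule sum.mono_neutral_right)
    show "\<forall>l\<in>{..<N} - {i..j}. A $$ (i, l) * B $$ (l, j) = 0"
      using unip_entry[OF assms(1), of i] unip_entry[OF assms(2), of _ j] assms(3,4) by auto
  qed (use assms in auto)
  also have "{i..j} = insert i (insert j {i<..<j})" using assms by auto
  also have "(\<Sum>l\<in>\<dots>. A $$ (i, l) * B $$ (l, j)) = A $$ (i, j) + B $$ (i, j) + (\<Sum>l\<in>{i<..<j}. A $$ (i, l) * B $$ (l, j))"
    using assms unip_entry[OF assms(1), of i i] unip_entry[OF assms(2), of j j] by simp
  finally show ?thesis .
qed

definition int_mat :: "nat \<Rightarrow> real mat set" where
  "int_mat N = {A \<in> carrier_mat N N. \<forall>i<N. \<forall>j<N. A $$ (i, j) \<in> \<int>}"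

lemma int_mat_mult: "A \<in> int_mat N \<Longrightarrow> B \<in> int_mat N \<Longrightarrow> A * B \<in> int_mat N"
  unfolding int_mat_def by (auto simp: scalar_prod_def intro!: Ints_sum)

lemma int_mat_minus: "A \<in> int_mat N \<Longrightarrow> B \<in> int_mat N \<Longrightarrow> A - B \<in> int_mat N"
  unfolding int_mat_def by auto

lemma int_mat_add: "A \<in> int_mat N \<Longrightarrow> B \<in> int_mat N \<Longrightarrow> A + B \<in> int_mat N"
  unfolding int_mat_def by auto

lemma int_mat_one: "1\<^sub>m N \<in> int_mat N"
  unfolding int_mat_def by auto

text \<open>\<open>minv\<close> is a finite sum of powers of \<open>1 - A\<close>, so integrality
  passes through it.\<close>

lemma int_mat_minv: "A \<in> int_mat N \<Longrightarrow> minv N A \<in> int_mat N"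
proof -
  assume A: "A \<in> int_mat N"
  have p: "mpow N (1\<^sub>m N - A) k \<in> int_mat N" for k
    by (induction k) (auto intro: int_mat_one int_mat_mult int_mat_minus A)
  have "msum N (mpow N (1\<^sub>m N - A)) n \<in> int_mat N" for n
  proof (induction n)
    case 0
    then show ?case by (simp add: int_mat_def)
  next
    case (Suc n)
    then show ?case by (simp add: int_mat_add p)
  qed
  then show ?thesis unfolding minv_def .
qed

section \<open>The exponential map onto the unitriangular group\<close>

lemma mexp_carrier: "X \<in> carrier_mat N N \<Longrightarrow> mexp N X \<in> carrier_mat N N"
  unfolding mexp_def by simp

lemma mexp_entry:
  assumes "X \<in> carrier_mat N N" "i < N" "j < N"
  shows "mexp N X $$ (i, j) = (\<Sum>k<N. mpow N X k $$ (i, j) / fact k)"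
proof -
  have "mexp N X $$ (i, j) = (\<Sum>k<N. ((1 / fact k) \<cdot>\<^sub>m mpow N X k) $$ (i, j))"
    unfolding mexp_def using assms by (intro msum_entry) auto
  also have "\<dots> = (\<Sum>k<N. mpow N X k $$ (i, j) / fact k)"
    using assms by (intro sum.cong) (simp_all add: smult_entry[of _ N])
  finally show ?thesis .
qed

text \<open>\<open>mexp\<close> sums the powers with exponent below \<open>N\<close>;
  \<open>2 \<le> N\<close> puts the linear term among them.\<close>

lemma mexp_square_zero:
  assumes "X \<in> carrier_mat N N" "X * X = 0\<^sub>m N N" "2 \<le> N"
  shows "mexp N X = 1\<^sub>m N + X"
proof (rule eq_matI)
  obtain M where N: "N = Suc (Suc M)" using assms(3) by (metis Suc_le_D numeral_2_eq_2 Suc_le_mono)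
  have c: "mexp N X \<in> carrier_mat N N" using mexp_carrier assms by simp
  have z: "mpow N X (Suc (Suc k)) = 0\<^sub>m N N" for k
    using assms by (simp add: sq_assoc[of _ N] right_mult_zero_mat[of _ N N])
  fix i j assume "i < dim_row (1\<^sub>m N + X)" "j < dim_col (1\<^sub>m N + X)"
  then have ij: "i < N" "j < N" using assms by auto
  have "mexp N X $$ (i, j) = (\<Sum>k<Suc (Suc M). mpow N X k $$ (i, j) / fact k)"
    using mexp_entry[OF assms(1) ij] unfolding N .
  also have "\<dots> = mpow N X 0 $$ (i, j) + (mpow N X (Suc 0) $$ (i, j) + (\<Sum>k<M. mpow N X (Suc (Suc k)) $$ (i, j) / fact (Suc (Suc k))))"
    unfolding sum.lessThan_Suc_shift by simp
  also have "\<dots> = (1\<^sub>m N + X) $$ (i, j)" unfolding z using ij assms(1) by simp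
  finally show "mexp N X $$ (i, j) = (1\<^sub>m N + X) $$ (i, j)" .
qed (use assms mexp_carrier[OF assms(1)] in auto)

lemma mexp_unip:
  assumes "X \<in> upper N"
  shows "mexp N X \<in> unip N (\<lambda>i. N - i) 1"
proof -
  have c: "X \<in> carrier_mat N N" "mexp N X \<in> carrier_mat N N" using upper_carrier[OF assms] mexp_carrier by auto
  have "mexp N X - 1\<^sub>m N \<in> upper N"
    unfolding upper_def strict_upper_def
  proof (intro CollectI conjI allI impI)
    fix i j assume ij: "i < N" "j < N" "j \<le> i"
    then obtain M where N: "N = Suc M" by (cases N) auto
    have "mpow N X (Suc k) $$ (i, j) = 0" for k
      using upper_mpow_entry[OF assms ij(1,2), of "Suc k"] ij(3) by simp
    moreover have "mexp N X $$ (i, j) = (\<Sum>k<Suc M. mpow N X k $$ (i, j) / fact k)"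
      using mexp_entry[OF c(1) ij(1,2)] unfolding N .
    ultimately have "mexp N X $$ (i, j) = mpow N X 0 $$ (i, j)"
      unfolding sum.lessThan_Suc_shift by (simp del: mpow.simps(2))
    then show "(mexp N X - 1\<^sub>m N) $$ (i, j) = 0" using ij c by simp
  qed (use c in auto)
  then show ?thesis using c unfolding unip_def upper_graded by simp
qed

text \<open>In a power with exponent at least 2, the entry \<open>(i, j)\<close> is a sum over
  \<open>l\<close> with \<open>i < l < j\<close>, so both factors lie strictly closer to the
  diagonal. This is why the second part gains one superdiagonal.\<close>

lemma mpow_agree:
  assumes X: "X \<in> upper N" and Y: "Y \<in> upper N"
    and agree: "\<And>i j. i < N \<Longrightarrow> j < N \<Longrightarrow> j \<le> i + m \<Longrightarrow> X $$ (i, j) = Y $$ (i, j)"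
  shows "i < N \<Longrightarrow> j < N \<Longrightarrow> j \<le> i + m \<Longrightarrow> mpow N X k $$ (i, j) = mpow N Y k $$ (i, j)"
    and "i < N \<Longrightarrow> j < N \<Longrightarrow> j \<le> i + Suc m \<Longrightarrow> mpow N X (Suc (Suc k)) $$ (i, j) = mpow N Y (Suc (Suc k)) $$ (i, j)"
proof -
  have c: "X \<in> carrier_mat N N" "Y \<in> carrier_mat N N" using X Y upper_carrier by auto
  show 1: "mpow N X k $$ (i, j) = mpow N Y k $$ (i, j)" if "i < N" "j < N" "j \<le> i + m" for i j k
    using that
  proof (induction k arbitrary: j)
    case (Suc k)
    have "mpow N X k $$ (i, l) * X $$ (l, j) = mpow N Y k $$ (i, l) * Y $$ (l, j)" if l: "l < N" for l
    proof (cases "l < j \<and> i \<le> l")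
      case True
      then show ?thesis using Suc.IH[of l] Suc.prems l agree[of l j] by simp
    next
      case False
      then consider "j \<le> l" | "l < i" by linarith
      then show ?thesis using upperD[OF X, of j l] upperD[OF Y, of j l] Suc.prems l
          upper_mpow_entry[OF X Suc.prems(1) l, of k] upper_mpow_entry[OF Y Suc.prems(1) l, of k]
        by cases auto
    qed
    then show ?case using Suc.prems c by (simp only: mpow.simps mult_entry[OF mpow_carrier]) simp
  qed simp
  assume ij: "i < N" "j < N" "j \<le> i + Suc m"
  have "mpow N X (Suc k) $$ (i, l) * X $$ (l, j) = mpow N Y (Suc k) $$ (i, l) * Y $$ (l, j)" if l: "l < N" for l
  proof (cases "l < j \<and> i < l")
    case True
    then show ?thesis using 1[of i l "Suc k"] ij l agree[of l j] by simp
  next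
    case False
    then consider "j \<le> l" | "l \<le> i" by linarith
    then show ?thesis
    proof cases
      case 1
      then show ?thesis using upperD[OF X, of j l] upperD[OF Y, of j l] ij l by simp
    next
      case 2
      then show ?thesis using upper_mpow_entry[OF X ij(1) l, of "Suc k"] upper_mpow_entry[OF Y ij(1) l, of "Suc k"] by simp
    qed
  qed
  then show "mpow N X (Suc (Suc k)) $$ (i, j) = mpow N Y (Suc (Suc k)) $$ (i, j)"
    using ij c by (subst (1 2) mpow.simps(2)) (simp only: mult_entry[OF mpow_carrier], simp)
qed

text \<open>The logarithm is built one superdiagonal at a time: changing \<open>X\<close> on the next superdiagonal
  changes \<open>exp X\<close> there by the same amount and affects nothing closer to the diagonal.\<close>

lemma mexp_surj:
  assumes A: "A \<in> unip N (\<lambda>i. N - i) 1"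
  shows "\<exists>X\<in>upper N. mexp N X = A"
proof -
  have cA: "A \<in> carrier_mat N N" using unip_carrier[OF A] .
  have "\<exists>X\<in>upper N. \<forall>i<N. \<forall>j<N. j \<le> i + m \<longrightarrow> mexp N X $$ (i, j) = A $$ (i, j)" for m
  proof (induction m)
    case 0
    have z: "0\<^sub>m N N \<in> upper N" unfolding upper_graded by (rule graded_zero)
    show ?case
      by (rule bexI[OF _ z]) (use unip_entry[OF mexp_unip[OF z]] unip_entry[OF A] in auto)
  next
    case (Suc m)
    then obtain X where X: "X \<in> upper N" "\<And>i j. i < N \<Longrightarrow> j < N \<Longrightarrow> j \<le> i + m \<Longrightarrow> mexp N X $$ (i, j) = A $$ (i, j)"
      by blast
    define E where "E = mat N N (\<lambda>(i, j). if j = i + Suc m then A $$ (i, j) - mexp N X $$ (i, j) else 0)"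
    have E: "E \<in> upper N" unfolding E_def upper_def strict_upper_def by auto
    have c: "X \<in> carrier_mat N N" "E \<in> carrier_mat N N" using X(1) E upper_carrier by auto
    have XE: "X + E \<in> upper N" using X(1) E graded_add unfolding upper_graded by blast
    have ag: "(X + E) $$ (i, j) = X $$ (i, j)" if "i < N" "j < N" "j \<le> i + m" for i j
      using that c by (simp add: E_def)
    have "mexp N (X + E) $$ (i, j) = A $$ (i, j)" if ij: "i < N" "j < N" "j \<le> i + Suc m" for i j
    proof (cases "j = i + Suc m")
      case False
      then have j: "j \<le> i + m" using ij by simp
      have "mpow N (X + E) k $$ (i, j) = mpow N X k $$ (i, j)" for k
        using mpow_agree(1)[OF XE X(1) ag ij(1,2) j] by simp
      then have "mexp N (X + E) $$ (i, j) = mexp N X $$ (i, j)"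
        using ij c by (subst (1 2) mexp_entry) auto
      then show ?thesis using X(2) ij j by simp
    next
      case True
      then have "2 \<le> N" using ij by simp
      then obtain M where N: "N = Suc (Suc M)" by (metis Suc_le_D numeral_2_eq_2 Suc_le_mono)
      have sp: "mexp N Z $$ (i, j) = mpow N Z 0 $$ (i, j) + (Z $$ (i, j) + (\<Sum>k<M. mpow N Z (Suc (Suc k)) $$ (i, j) / fact (Suc (Suc k))))"
        if "Z \<in> carrier_mat N N" for Z
      proof -
        have "mexp N Z $$ (i, j) = (\<Sum>k<Suc (Suc M). mpow N Z k $$ (i, j) / fact k)"
          using mexp_entry[OF that ij(1,2)] unfolding N .
        then show ?thesis using that unfolding sum.lessThan_Suc_shift by simp
      qed
      have "mpow N (X + E) (Suc (Suc k)) $$ (i, j) = mpow N X (Suc (Suc k)) $$ (i, j)" for k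
        using mpow_agree(2)[OF XE X(1) ag ij] by simp
      then have "mexp N (X + E) $$ (i, j) = mexp N X $$ (i, j) + E $$ (i, j)"
        using sp[of "X + E"] sp[OF c(1)] c ij by simp
      then show ?thesis using ij True by (simp add: E_def)
    qed
    then show ?case using XE by blast
  qed
  from this[of N] obtain X where X: "X \<in> upper N" "\<And>i j. i < N \<Longrightarrow> j < N \<Longrightarrow> mexp N X $$ (i, j) = A $$ (i, j)"
    by (metis less_imp_le_nat trans_le_add2)
  have "mexp N X = A"
    by (rule eq_matI) (use X cA mexp_carrier[OF upper_carrier[OF X(1)]] in auto)
  then show ?thesis using X(1) by blast
qed

text \<open>The hypothesis makes the weight condition automatic for matrices in
  \<open>upper\<close>, so \<open>unip N W m\<close> is the full unitriangular group, for which
  surjectivity is known.\<close>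

lemma mexp_image_upper: "mexp N ` upper N = unip N W m" if "upper N \<subseteq> graded N W m"
proof -
  have "unip N W m = unip N (\<lambda>i. N - i) 1" using that unfolding unip_def upper_graded by blast
  then show ?thesis using mexp_unip mexp_surj by blast
qed

section \<open>Powers with polynomial dependence on the exponent\<close>

text \<open>The binomial series of \<open>(1 + X)\<close> to the power \<open>x\<close>, finite
  because \<open>X\<close> is nilpotent. Unlike the recursion of \<open>gpow\<close> it shows that
  the entries are polynomials in the exponent.\<close>

definition bin_pow :: "nat \<Rightarrow> real mat \<Rightarrow> real \<Rightarrow> real mat" where
  "bin_pow N X x = msum N (\<lambda>r. (x gchoose r) \<cdot>\<^sub>m mpow N X r) N"

lemma bin_pow_carrier: "X \<in> carrier_mat N N \<Longrightarrow> bin_pow N X x \<in> carrier_mat N N"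
  unfolding bin_pow_def by simp

lemma bin_pow_zero:
  assumes "X \<in> carrier_mat N N"
  shows "bin_pow N X 0 = 1\<^sub>m N"
proof (rule eq_matI)
  fix i j assume "i < dim_row (1\<^sub>m N :: real mat)" "j < dim_col (1\<^sub>m N :: real mat)"
  then have ij: "i < N" "j < N" by auto
  then obtain M where N: "N = Suc M" by (cases N) auto
  have "bin_pow N X 0 $$ (i, j) = (\<Sum>r<N. ((0 gchoose r) \<cdot>\<^sub>m mpow N X r) $$ (i, j))"
    unfolding bin_pow_def using assms ij by (intro msum_entry) auto
  also have "\<dots> = (\<Sum>r<N. (0 gchoose r) * mpow N X r $$ (i, j))"
    using assms ij by (intro sum.cong) (simp_all add: smult_entry[of _ N])
  also have "\<dots> = 1\<^sub>m N $$ (i, j)"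
    unfolding N sum.lessThan_Suc_shift by simp
  finally show "bin_pow N X 0 $$ (i, j) = 1\<^sub>m N $$ (i, j)" .
qed (use bin_pow_carrier[OF assms] in auto)

text \<open>Pascal's rule applied termwise. The partial sums on the two sides have lengths differing
  by one, and the extra term is a multiple of the \<open>N\<close>-th power of \<open>X\<close>,
  which vanishes.\<close>

lemma bin_pow_add_one:
  assumes "X \<in> upper N"
  shows "bin_pow N X (x + 1) = bin_pow N X x * (1\<^sub>m N + X)"
proof -
  have c: "X \<in> carrier_mat N N" using upper_carrier[OF assms] .
  let ?s = "\<lambda>x n. msum N (\<lambda>r. (x gchoose r) \<cdot>\<^sub>m mpow N X r) n"
  have cs: "?s x n \<in> carrier_mat N N" "mpow N X n \<in> carrier_mat N N" for x :: real and n using c by auto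
  have step: "?s (x + 1) (Suc n) = ?s x (Suc n) + ?s x n * X" for n
  proof (induction n)
    case 0
    then show ?case using c by (intro eq_matI) auto
  next
    case (Suc n)
    have "?s (x + 1) (Suc (Suc n)) = ?s (x + 1) (Suc n) + ((x + 1) gchoose Suc n) \<cdot>\<^sub>m mpow N X (Suc n)"
      by simp
    also have "\<dots> = (?s x (Suc n) + ?s x n * X) + ((x gchoose n) + (x gchoose Suc n)) \<cdot>\<^sub>m mpow N X (Suc n)"
      unfolding Suc gbinomial_Suc_Suc by simp
    also have "\<dots> = ?s x (Suc (Suc n)) + (?s x n * X + (x gchoose n) \<cdot>\<^sub>m mpow N X (Suc n))"
    proof -
      have "S + Q + (a + b) \<cdot>\<^sub>m P = (S + b \<cdot>\<^sub>m P) + (Q + a \<cdot>\<^sub>m P)"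
        if "S \<in> carrier_mat N N" "Q \<in> carrier_mat N N" "P \<in> carrier_mat N N" for S Q P :: "real mat" and a b
        using that by (intro eq_matI) (auto simp: algebra_simps)
      note gen = this[OF cs(1) mult_carrier_mat[OF cs(1) c] cs(2)]
      show ?thesis by (subst msum.simps(2)[of N _ "Suc n"]) (rule gen)
    qed
    also have "(x gchoose n) \<cdot>\<^sub>m mpow N X (Suc n) = ((x gchoose n) \<cdot>\<^sub>m mpow N X n) * X"
      using c by (simp add: mult_smult_assoc_mat[of _ N N _ N])
    also have "?s x n * X + ((x gchoose n) \<cdot>\<^sub>m mpow N X n) * X = ?s x (Suc n) * X"
      using c cs(1)[of x n] cs(2)[of n] by (simp add: sq_add_mult[of _ N])
    finally show ?case .
  qed
  have last: "?s y (Suc N) = ?s y N" for y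
    using upper_nilpotent[OF assms] cs(1)[of y N] by simp
  have "?s (x + 1) N = ?s x N + ?s x N * X"
    using step[of N] unfolding last .
  also have "\<dots> = ?s x N * (1\<^sub>m N + X)" using c cs(1)[of x N] by (simp add: sq_mult_add[of _ N] right_mult_one_mat[of _ N N])
  finally show ?thesis unfolding bin_pow_def .
qed

text \<open>Shifting the exponent by 1 multiplies by \<open>A\<close>, shifting it by -1 multiplies
  by \<open>minv N A\<close>; induction in both directions reaches all integer exponents.\<close>

lemma bin_pow_gpow:
  assumes A: "A \<in> unip N W m"
  defines "X \<equiv> A - 1\<^sub>m N"
  shows "bin_pow N X (x + real k) = bin_pow N X x * mpow N A k"
    "bin_pow N X (of_int z) = gpow N A z"
    "bin_pow N X (of_int z) * bin_pow N X (- of_int z) = 1\<^sub>m N"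
    "bin_pow N X (- 1) = minv N A"
proof -
  have X: "X \<in> upper N" and c: "X \<in> carrier_mat N N" "A \<in> carrier_mat N N" "minv N A \<in> carrier_mat N N"
    unfolding X_def using unip_upper[OF A] unip_carrier[OF A] minv_carrier by auto
  have A1: "1\<^sub>m N + X = A" unfolding X_def using c by (intro mat_one_plus_minus)
  note cb = bin_pow_carrier[OF c(1)]
  have p: "bin_pow N X (x + real k) = bin_pow N X x * mpow N A k" for x k
  proof (induction k)
    case 0
    show ?case using cb[of x] by simp
  next
    case (Suc k)
    have "bin_pow N X (x + real (Suc k)) = bin_pow N X (x + real k + 1)" by (simp add: algebra_simps)
    also have "\<dots> = bin_pow N X x * mpow N A k * A" unfolding bin_pow_add_one[OF X] A1 Suc ..
    also have "\<dots> = bin_pow N X x * mpow N A (Suc k)"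
      using cb[of x] c by (simp add: sq_assoc[of _ N])
    finally show ?case .
  qed
  show "bin_pow N X (x + real k) = bin_pow N X x * mpow N A k" by (rule p)
  have i: "bin_pow N X (x - 1) = bin_pow N X x * minv N A" for x
  proof -
    have "bin_pow N X x = bin_pow N X (x - 1) * A" using bin_pow_add_one[OF X, of "x - 1"] A1 by simp
    then have "bin_pow N X x * minv N A = bin_pow N X (x - 1) * (A * minv N A)"
      using cb[of "x - 1"] c by (simp add: sq_assoc[of _ N])
    then show ?thesis using minv_inverse[OF A] cb[of "x - 1"] by simp
  qed
  show "bin_pow N X (- 1) = minv N A" using i[of 0] bin_pow_zero[OF c(1)] c by simp
  have q: "bin_pow N X (- real k) = mpow N (minv N A) k" for k
  proof (induction k)
    case 0
    show ?case using bin_pow_zero[OF c(1)] by simp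
  next
    case (Suc k)
    have "- real (Suc k) = - real k - 1" by simp
    then show ?case using i[of "- real k"] Suc by (simp only: mpow.simps)
  qed
  have p0: "bin_pow N X (real k) = mpow N A k" for k
    using p[of 0 k] bin_pow_zero[OF c(1)] mpow_carrier[OF c(2), of k] by simp
  show "bin_pow N X (of_int z) = gpow N A z"
  proof (cases "z \<ge> 0")
    case True
    then show ?thesis using p0[of "nat z"] by (simp add: gpow_def)
  next
    case False
    then show ?thesis using q[of "nat (- z)"] by (simp add: gpow_def)
  qed
  have r: "bin_pow N X (- real k) * bin_pow N X (real k) = 1\<^sub>m N" for k
    using p[of "- real k" k] p0 bin_pow_zero[OF c(1)] by simp
  have i': "bin_pow N X (x - real k) = bin_pow N X x * mpow N (minv N A) k" for x k
  proof (induction k)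
    case 0
    show ?case using cb[of x] by simp
  next
    case (Suc k)
    have eq: "x - real (Suc k) = x - real k - 1" by simp
    have "bin_pow N X (x - real (Suc k)) = bin_pow N X x * mpow N (minv N A) k * minv N A"
      unfolding eq i Suc ..
    then show ?case using cb[of x] c by (simp add: sq_assoc[of _ N])
  qed
  have r': "bin_pow N X (real k) * bin_pow N X (- real k) = 1\<^sub>m N" for k
    using i'[of "real k" k] q bin_pow_zero[OF c(1)] by simp
  show "bin_pow N X (of_int z) * bin_pow N X (- of_int z) = 1\<^sub>m N"
  proof (cases "z \<ge> 0")
    case True
    then show ?thesis using r'[of "nat z"] by simp
  next
    case False
    then show ?thesis using r[of "nat (- z)"] by simp
  qed
qed

lemma bin_pow_unip:
  assumes "A \<in> unip N W m"
  shows "bin_pow N (A - 1\<^sub>m N) (of_int z) \<in> unip N W m"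
proof -
  have "mpow N B k \<in> unip N W m" if "B \<in> unip N W m" for B k
    by (induction k) (auto intro: unip_one unip_mult that)
  then show ?thesis unfolding bin_pow_gpow(2)[OF assms] gpow_def using assms minv_unip by simp
qed

section \<open>The unitriangular nilmanifold\<close>

definition elem_mat :: "nat \<Rightarrow> nat \<times> nat \<Rightarrow> real mat" where
  "elem_mat N v = mat N N (\<lambda>w. if w = v then 1 else 0)"

lemma elem_mat_carrier [simp]: "elem_mat N v \<in> carrier_mat N N"
  unfolding elem_mat_def by simp

lemma elem_mat_entry: "i < N \<Longrightarrow> j < N \<Longrightarrow> elem_mat N v $$ (i, j) = (if (i, j) = v then 1 else 0)"
  unfolding elem_mat_def by simp

text \<open>The positions above the diagonal are listed by increasing weight \<open>W i - W j\<close>. The convexity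
  condition makes \<open>(i, k)\<close> come after \<open>(k, j)\<close>, so that a product of elementary exponentials taken
  in this order has no cross terms.\<close>

locale unitriangular =
  fixes N :: nat and W :: "nat \<Rightarrow> nat" and L :: "(nat \<times> nat) list"
  assumes dec: "\<And>i j. i < j \<Longrightarrow> j < N \<Longrightarrow> W j < W i"
    and convex: "\<And>i k j. i < k \<Longrightarrow> k < j \<Longrightarrow> j < N \<Longrightarrow> W k - W j < W i - W k"
    and distinct_L: "distinct L"
    and set_L: "set L = {(i, j). i < j \<and> j < N}"
    and sorted_L: "sorted (map (\<lambda>(i, j). W i - W j) L)"
begin

definition "basis k = elem_mat N (L ! k)"

abbreviation "D \<equiv> length L"

abbreviation "G \<equiv> unip N W 1"

text \<open>\<open>max 1\<close> gives the terms 0 and 1 the same group, as a filtration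
  demands.\<close>

definition "filt m = unip N W (max 1 m)"

lemma upper_graded_W: "upper N = graded N W 1"
  by (rule upper_eq_graded[OF dec])

lemma L_position:
  assumes "i < j" "j < N"
  obtains p where "p < D" "L ! p = (i, j)"
  using assms set_L by (metis (mono_tags, lifting) case_prodI in_set_conv_nth mem_Collect_eq)

lemma L_nth: "p < D \<Longrightarrow> L ! p = (i, j) \<Longrightarrow> i < j \<and> j < N"
  using set_L nth_mem[of p L] by auto

lemma L_inj: "p < D \<Longrightarrow> q < D \<Longrightarrow> L ! p = L ! q \<Longrightarrow> p = q"
  using distinct_L nth_eq_iff_index_eq by blast

lemma L_mono:
  assumes "p < D" "q < D" "L ! p = (i, j)" "L ! q = (k, l)" "W i - W j < W k - W l"
  shows "p < q"
proof (rule ccontr)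
  assume "\<not> p < q"
  then have "map (\<lambda>(i, j). W i - W j) L ! q \<le> map (\<lambda>(i, j). W i - W j) L ! p"
    using assms(1,2) by (intro sorted_nth_mono[OF sorted_L]) auto
  then show False using assms by simp
qed

lemma basis_carrier [simp]: "basis k \<in> carrier_mat N N"
  unfolding basis_def by simp

lemma basis_entry:
  assumes "i < N" "j < N"
  shows "(c \<cdot>\<^sub>m basis k) $$ (i, j) = (if L ! k = (i, j) then c else 0)"
  unfolding smult_entry[OF basis_carrier assms] unfolding basis_def elem_mat_entry[OF assms] by auto

lemma lincomb_carrier [simp]: "lincomb N basis m r c \<in> carrier_mat N N"
  unfolding lincomb_def by simp

lemma lincomb_entry_sum:
  assumes "i < N" "j < N"
  shows "lincomb N basis m r c $$ (i, j) = (\<Sum>k<r - m. c (m + k) * (if L ! (m + k) = (i, j) then 1 else 0))"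
proof -
  have "lincomb N basis m r c $$ (i, j) = (\<Sum>k<r - m. (c (m + k) \<cdot>\<^sub>m basis (m + k)) $$ (i, j))"
    unfolding lincomb_def using assms by (intro msum_entry) auto
  also have "\<dots> = (\<Sum>k<r - m. c (m + k) * (if L ! (m + k) = (i, j) then 1 else 0))"
    unfolding basis_entry[OF assms] by (intro sum.cong) auto
  finally show ?thesis .
qed

lemma lincomb_entry:
  assumes "r \<le> D" "p < D" "L ! p = (i, j)"
  shows "lincomb N basis m r c $$ (i, j) = (if m \<le> p \<and> p < r then c p else 0)"
proof -
  have ij: "i < N" "j < N" using L_nth[OF assms(2,3)] by auto
  have "(\<Sum>k<r - m. c (m + k) * (if L ! (m + k) = (i, j) then 1 else 0))
      = (\<Sum>k<r - m. if k = p - m then (if m \<le> p then c p else 0) else 0)"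
  proof (rule sum.cong)
    fix k assume "k \<in> {..<r - m}"
    then have k: "m + k < D" using assms(1) by auto
    have "L ! (m + k) = (i, j) \<longleftrightarrow> m + k = p" using L_inj[OF k assms(2)] assms(3) by auto
    also have "\<dots> \<longleftrightarrow> m \<le> p \<and> k = p - m" by auto
    finally show "c (m + k) * (if L ! (m + k) = (i, j) then 1 else 0) = (if k = p - m then (if m \<le> p then c p else 0) else 0)"
      by auto
  qed simp
  also have "\<dots> = (if m \<le> p \<and> p < r then c p else 0)" by auto
  finally show ?thesis unfolding lincomb_entry_sum[OF ij] .
qed

lemma lincomb_upper:
  assumes "r \<le> D"
  shows "lincomb N basis m r c \<in> upper N"
  unfolding upper_def strict_upper_def
proof (intro CollectI conjI allI impI)
  fix i j assume ij: "i < N" "j < N" "j \<le> i"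
  show "lincomb N basis m r c $$ (i, j) = 0"
    unfolding lincomb_entry_sum[OF ij(1,2)]
  proof (intro sum.neutral ballI)
    fix k assume "k \<in> {..<r - m}"
    then have "m + k < D" using assms by auto
    then have "L ! (m + k) \<noteq> (i, j)" using L_nth[of "m + k" i j] ij by auto
    then show "c (m + k) * (if L ! (m + k) = (i, j) then 1 else 0) = 0" by simp
  qed
qed simp

lemma upper_eqI:
  assumes "X \<in> upper N" "Y \<in> upper N" "\<And>p i j. p < D \<Longrightarrow> L ! p = (i, j) \<Longrightarrow> X $$ (i, j) = Y $$ (i, j)"
  shows "X = Y"
proof (rule eq_matI)
  fix i j assume "i < dim_row Y" "j < dim_col Y"
  then have ij: "i < N" "j < N" using upper_carrier[OF assms(2)] by auto
  show "X $$ (i, j) = Y $$ (i, j)"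
  proof (cases "i < j")
    case True
    then show ?thesis using assms(3) L_position[OF True ij(2)] by metis
  next
    case False
    then show ?thesis using upperD[OF assms(1)] upperD[OF assms(2)] ij by simp
  qed
qed (use upper_carrier[OF assms(1)] upper_carrier[OF assms(2)] in auto)

section \<open>Final segments of the basis and Mal'cev coordinates\<close>

lemma mspan_iff:
  "Z \<in> mspan N basis m D \<longleftrightarrow> Z \<in> upper N \<and> (\<forall>p<D. p < m \<longrightarrow> Z $$ (L ! p) = 0)"
proof
  assume "Z \<in> mspan N basis m D"
  then obtain c where "Z = lincomb N basis m D c" unfolding mspan_def by blast
  then show "Z \<in> upper N \<and> (\<forall>p<D. p < m \<longrightarrow> Z $$ (L ! p) = 0)"
    using lincomb_upper[of D] lincomb_entry[of D] by (auto, metis surj_pair not_le)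
next
  assume Z: "Z \<in> upper N \<and> (\<forall>p<D. p < m \<longrightarrow> Z $$ (L ! p) = 0)"
  have "Z = lincomb N basis m D (\<lambda>p. Z $$ (L ! p))"
  proof (rule upper_eqI)
    fix p i j assume p: "p < D" "L ! p = (i, j)"
    then have "p < m \<Longrightarrow> Z $$ (i, j) = 0" using Z by metis
    then show "Z $$ (i, j) = lincomb N basis m D (\<lambda>p. Z $$ (L ! p)) $$ (i, j)"
      using p lincomb_entry[OF order_refl p, of m "\<lambda>p. Z $$ (L ! p)"] by auto
  qed (use Z lincomb_upper in auto)
  then show "Z \<in> mspan N basis m D" unfolding mspan_def by blast
qed

lemma mspan_zero: "mspan N basis 0 D = upper N"
  using mspan_iff[of _ 0] by auto

text \<open>\<open>L\<close> is sorted by weight, so the positions of weight at least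
  \<open>n\<close> form a final segment, and \<open>m\<close> counts those before it. This is what
  makes the basis compatible with the filtration.\<close>

lemma mspan_graded:
  assumes "1 \<le> n"
  shows "\<exists>m\<le>D. mspan N basis m D = graded N W n"
proof -
  let ?w = "\<lambda>(i, j). W i - W j"
  define m where "m = length (takeWhile (\<lambda>v. ?w v < n) L)"
  have mD: "m \<le> D" unfolding m_def by (rule length_takeWhile_le)
  have lt: "?w (L ! p) < n" if "p < m" for p
    using that set_takeWhileD[of "L ! p" "\<lambda>v. ?w v < n" L] unfolding m_def
    by (metis (no_types, lifting) nth_mem takeWhile_nth)
  have ge: "n \<le> ?w (L ! p)" if "m \<le> p" "p < D" for p
  proof -
    have "\<not> ?w (L ! m) < n" using that nth_length_takeWhile[of "\<lambda>v. ?w v < n" L] unfolding m_def by simp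
    moreover have "map ?w L ! m \<le> map ?w L ! p" using that by (intro sorted_nth_mono[OF sorted_L]) auto
    ultimately show ?thesis using that by simp
  qed
  have "Z \<in> mspan N basis m D \<longleftrightarrow> Z \<in> graded N W n" for Z
  proof
    assume "Z \<in> mspan N basis m D"
    then have Z: "Z \<in> upper N" "\<And>p. p < D \<Longrightarrow> p < m \<Longrightarrow> Z $$ (L ! p) = 0" unfolding mspan_iff by auto
    show "Z \<in> graded N W n"
    proof (rule gradedI)
      fix i j assume ij: "i < N" "j < N" "W i < W j + n"
      show "Z $$ (i, j) = 0"
      proof (cases "i < j")
        case True
        then obtain p where p: "p < D" "L ! p = (i, j)" using L_position ij by metis
        have "\<not> n \<le> W i - W j" using ij(3) dec[OF True ij(2)] by simp
        then have "p < m" using ge[of p] p by fastforce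
        then show ?thesis using Z(2)[OF p(1)] p(2) by simp
      qed (use upperD[OF Z(1)] ij in simp)
    qed (use upper_carrier[OF Z(1)] in simp)
  next
    assume Z: "Z \<in> graded N W n"
    then have "Z \<in> upper N" unfolding upper_graded_W using graded_mono assms by blast
    moreover have "Z $$ (L ! p) = 0" if "p < D" "p < m" for p
    proof -
      obtain i j where p: "L ! p = (i, j)" by (cases "L ! p")
      then have "W i < W j + n" "i < N" "j < N" using lt[OF that(2)] L_nth[OF that(1) p] by auto
      then show ?thesis using gradedD[OF Z] p by simp
    qed
    ultimately show "Z \<in> mspan N basis m D" unfolding mspan_iff by blast
  qed
  then show ?thesis using mD by blast
qed

text \<open>Both factors are strictly upper triangular, so an entry \<open>(i, j)\<close> of
  \<open>Y * Z\<close> or \<open>Z * Y\<close> involves only entries of \<open>Z\<close> of strictly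
  smaller weight. These positions precede \<open>(i, j)\<close> in \<open>L\<close>, hence
  \<open>Z\<close> vanishes there whenever \<open>(i, j)\<close> is among the first \<open>m\<close>
  positions.\<close>

lemma mspan_bracket:
  assumes Y: "Y \<in> mspan N basis 0 D" and Z: "Z \<in> mspan N basis m D"
  shows "bracket Y Z \<in> mspan N basis m D"
proof -
  have u: "Y \<in> upper N" "Z \<in> upper N" using Y Z unfolding mspan_iff by auto
  have c: "Y \<in> carrier_mat N N" "Z \<in> carrier_mat N N" using u upper_carrier by auto
  have "Y * Z \<in> upper N" "Z * Y \<in> upper N"
    using graded_mult[of Y N W 1 Z 1] graded_mult[of Z N W 1 Y 1] u graded_mono[of _ N W 2 1]
    unfolding upper_graded_W by (auto simp: numeral_2_eq_2)
  then have b: "bracket Y Z \<in> upper N" unfolding bracket_def upper_graded_W using graded_minus by blast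
  have later: "Z $$ (k, l) = 0" if "i < N" "j < N" "k < N" "l < N" "p < D" "L ! p = (i, j)" "p < m" "W k - W l < W i - W j" for p i j k l
  proof (cases "k < l")
    case True
    then obtain q where q: "q < D" "L ! q = (k, l)" using L_position \<open>l < N\<close> by metis
    then have "q < p" using L_mono[OF q(1) \<open>p < D\<close> q(2) \<open>L ! p = (i, j)\<close>] that by simp
    then show ?thesis using Z q \<open>p < m\<close> unfolding mspan_iff by (metis order.strict_trans)
  qed (use upperD[OF u(2)] that in simp)
  have "bracket Y Z $$ (L ! p) = 0" if p: "p < D" "p < m" for p
  proof -
    obtain i j where ij: "L ! p = (i, j)" by (cases "L ! p")
    have n: "i < N" "j < N" "i < j" using L_nth[OF p(1) ij] by auto
    have "Y $$ (i, l) * Z $$ (l, j) = 0" if "l < N" for l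
    proof (cases "i < l \<and> l < j")
      case True
      then have "W l - W j < W i - W j" using dec[of i l] dec[of l j] n that by simp
      then show ?thesis using later[OF n(1,2) that n(2) p(1) ij p(2)] by simp
    next
      case False
      then show ?thesis using upperD[OF u(1), of l i] upperD[OF u(2), of j l] n that by auto
    qed
    then have 1: "(Y * Z) $$ (i, j) = 0" unfolding mult_entry[OF c n(1,2)] by (intro sum.neutral) blast
    have "Z $$ (i, l) * Y $$ (l, j) = 0" if "l < N" for l
    proof (cases "i < l \<and> l < j")
      case True
      then have "W i - W l < W i - W j" using dec[of i l] dec[of l j] n that by simp
      then show ?thesis using later[OF n(1,2) n(1) that p(1) ij p(2)] by simp
    next
      case False
      then show ?thesis using upperD[OF u(2), of l i] upperD[OF u(1), of j l] n that by auto
    qed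
    then have 2: "(Z * Y) $$ (i, j) = 0" unfolding mult_entry[OF c(2,1) n(1,2)] by (intro sum.neutral) blast
    show ?thesis unfolding bracket_def ij using 1 2 c n by (simp add: minus_entry[of _ N])
  qed
  then show ?thesis using b unfolding mspan_iff by blast
qed

lemma mexp_basis:
  assumes "p < D"
  shows "mexp N (t \<cdot>\<^sub>m basis p) = 1\<^sub>m N + t \<cdot>\<^sub>m basis p"
proof (rule mexp_square_zero)
  obtain i j where ij: "L ! p = (i, j)" by (cases "L ! p")
  have n: "i < j" "j < N" using L_nth[OF assms ij] by auto
  then show "2 \<le> N" by simp
  have c: "t \<cdot>\<^sub>m basis p \<in> carrier_mat N N" by simp
  then show "t \<cdot>\<^sub>m basis p \<in> carrier_mat N N" .
  show "t \<cdot>\<^sub>m basis p * (t \<cdot>\<^sub>m basis p) = 0\<^sub>m N N"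
  proof (rule eq_matI)
    fix k l assume "k < dim_row (0\<^sub>m N N :: real mat)" "l < dim_col (0\<^sub>m N N :: real mat)"
    then have kl: "k < N" "l < N" by auto
    have "(t \<cdot>\<^sub>m basis p * (t \<cdot>\<^sub>m basis p)) $$ (k, l) = 0"
      unfolding mult_entry[OF c c kl]
      using n ij kl by (intro sum.neutral) (auto simp: basis_entry simp del: index_smult_mat)
    then show "(t \<cdot>\<^sub>m basis p * (t \<cdot>\<^sub>m basis p)) $$ (k, l) = 0\<^sub>m N N $$ (k, l)" using kl by simp
  qed (simp_all add: basis_def elem_mat_def)
qed

text \<open>Mal'cev coordinates thus become plain matrix entries. This identifies the lattice with
  the integral matrices and the coordinates on the quotient with the entries of the reduced
  factor.\<close>

lemma malprod_eq: "malprod N basis m D t = 1\<^sub>m N + lincomb N basis m D t"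
proof -
  have "mprod N (\<lambda>k. mexp N (t (m + k) \<cdot>\<^sub>m basis (m + k))) r = 1\<^sub>m N + lincomb N basis m (m + r) t" if "m + r \<le> D" for r
    using that
  proof (induction r)
    case 0
    then show ?case by (simp add: lincomb_def)
  next
    case (Suc r)
    let ?S = "lincomb N basis m (m + r) t" and ?X = "t (m + r) \<cdot>\<^sub>m basis (m + r)"
    have c: "?S \<in> carrier_mat N N" "?X \<in> carrier_mat N N" by auto
    have rD: "m + r < D" using Suc.prems by simp
    have "?S * ?X = 0\<^sub>m N N"
    proof (rule eq_matI)
      fix k l assume "k < dim_row (0\<^sub>m N N :: real mat)" "l < dim_col (0\<^sub>m N N :: real mat)"
      then have kl: "k < N" "l < N" by auto
      have "?S $$ (k, u) * ?X $$ (u, l) = 0" if u: "u < N" for u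
      proof (cases "L ! (m + r) = (u, l)")
        case True
        have ul: "u < l" using L_nth[OF rD True] by simp
        have "?S $$ (k, u) = 0"
        proof (cases "k < u")
          case ku: True
          then obtain q where q: "q < D" "L ! q = (k, u)" using L_position u by metis
          have "m + r < q" by (rule L_mono[OF rD q(1) True q(2)]) (rule convex[OF ku ul kl(2)])
          then show ?thesis using lincomb_entry[of "m + r" q k u m t] q rD by simp
        next
          case False
          then show ?thesis using upperD[OF lincomb_upper[of "m + r" m t]] rD kl u by simp
        qed
        then show ?thesis by simp
      next
        case False
        then show ?thesis using basis_entry[OF u kl(2)] by simp
      qed
      then show "(?S * ?X) $$ (k, l) = 0\<^sub>m N N $$ (k, l)"
        unfolding mult_entry[OF c kl] index_zero_mat(1)[OF kl] by (intro sum.neutral) blast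
    qed (simp_all add: carrier_matD[OF lincomb_carrier] carrier_matD[OF basis_carrier])
    then have "(1\<^sub>m N + ?S) * (1\<^sub>m N + ?X) = (1\<^sub>m N + ?S) + ?X"
      using c by (simp add: sq_mult_add[of _ N] sq_add_mult[of _ N] left_mult_one_mat[of _ N N] right_mult_one_mat[of _ N N] right_add_zero_mat[of _ N N])
    also have "\<dots> = 1\<^sub>m N + (?S + ?X)" using c by (intro assoc_add_mat[of _ N N]) auto
    also have "?S + ?X = lincomb N basis m (m + Suc r) t" unfolding lincomb_def by simp
    finally show ?case using Suc mexp_basis[OF rD, of "t (m + r)"] by simp
  qed
  from this[of "D - m"] show ?thesis
    unfolding malprod_def by (cases "m \<le> D") (simp_all add: lincomb_def)
qed

lemma malprod_image:
  "{malprod N basis m D t | t. True} = {A \<in> carrier_mat N N. A - 1\<^sub>m N \<in> mspan N basis m D}" (is "?L = ?R")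
proof (intro equalityI subsetI)
  fix A assume "A \<in> ?L"
  then obtain t where A: "A = 1\<^sub>m N + lincomb N basis m D t" unfolding malprod_eq by blast
  have "(1\<^sub>m N + X) - 1\<^sub>m N = X" if "X \<in> carrier_mat N N" for X :: "real mat"
    using that by (intro eq_matI) auto
  then have "A - 1\<^sub>m N = lincomb N basis m D t" unfolding A by simp
  then show "A \<in> ?R" unfolding mspan_def A by auto
next
  fix A assume "A \<in> ?R"
  then obtain t where A: "A \<in> carrier_mat N N" "A - 1\<^sub>m N = lincomb N basis m D t" unfolding mspan_def by blast
  then have "A = malprod N basis m D t" unfolding malprod_eq using mat_one_plus_minus[OF A(1)] by simp
  then show "A \<in> ?L" by blast
qed

lemma malprod_entry:
  assumes "p < D" "L ! p = (i, j)"
  shows "malprod N basis m D t $$ (i, j) = (if m \<le> p then t p else 0)"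
proof -
  have "i < N" "j < N" "i \<noteq> j" using L_nth[OF assms] by auto
  then show ?thesis unfolding malprod_eq
    using lincomb_entry[OF order_refl assms, of m t] by (subst add_entry[of _ N]) (simp_all add: assms(1))
qed

lemma filt_malprod: "\<exists>m\<le>D. filt i = {malprod N basis m D t | t. True}"
proof -
  obtain m where m: "m \<le> D" "mspan N basis m D = graded N W (max 1 i)" using mspan_graded[of "max 1 i"] by auto
  have "graded N W (max 1 i) \<subseteq> upper N" unfolding upper_graded_W using graded_mono by auto
  then have "filt i = {malprod N basis m D t | t. True}"
    unfolding malprod_image m(2) filt_def unip_def by blast
  then show ?thesis using m(1) by blast
qed

lemma malprod_G: "malprod N basis 0 D t \<in> G"
proof -
  have "malprod N basis 0 D t \<in> {malprod N basis 0 D t | t. True}" by blast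
  then show ?thesis unfolding malprod_image unip_def mspan_zero upper_graded_W by simp
qed

lemma G_eqI:
  assumes "A \<in> G" "B \<in> G" "\<And>i j. i < j \<Longrightarrow> j < N \<Longrightarrow> A $$ (i, j) = B $$ (i, j)"
  shows "A = B"
proof (rule eq_matI)
  fix i j assume "i < dim_row B" "j < dim_col B"
  then have "i < N" "j < N" using unip_carrier[OF assms(2)] by auto
  then show "A $$ (i, j) = B $$ (i, j)"
    using assms(3)[of i j] unip_entry[OF assms(1), of i j] unip_entry[OF assms(2), of i j] by (cases "i < j") auto
qed (use unip_carrier[OF assms(1)] unip_carrier[OF assms(2)] in auto)

lemma malprod_coords: "A \<in> G \<Longrightarrow> A = malprod N basis 0 D (\<lambda>p. A $$ (L ! p))"
proof (rule G_eqI[OF _ malprod_G])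
  fix i j assume "i < j" "j < N"
  then obtain p where "p < D" "L ! p = (i, j)" using L_position by metis
  then show "A $$ (i, j) = malprod N basis 0 D (\<lambda>p. A $$ (L ! p)) $$ (i, j)" using malprod_entry by simp
qed

lemma malcev: "malcev_basis N basis D filt"
  unfolding malcev_basis_def
proof (intro conjI allI impI ballI)
  fix k assume "k < D"
  obtain i j where ij: "L ! k = (i, j)" by (cases "L ! k")
  then have "i < j" "j < N" using L_nth \<open>k < D\<close> by auto
  then show "strict_upper N (basis k)" unfolding strict_upper_def basis_def ij by (auto simp: elem_mat_entry)
next
  fix c k assume z: "lincomb N basis 0 D c = 0\<^sub>m N N" and k: "k < D"
  obtain i j where ij: "L ! k = (i, j)" by (cases "L ! k")
  have "i < N" "j < N" using L_nth[OF k ij] by auto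
  then show "c k = 0" using lincomb_entry[OF order_refl k ij, of 0 c] k unfolding z by simp
next
  fix j Y Z assume "Y \<in> mspan N basis 0 D" "Z \<in> mspan N basis j D"
  then show "bracket Y Z \<in> mspan N basis j D" by (rule mspan_bracket)
next
  fix i
  obtain m where m: "m \<le> D" "filt i = {malprod N basis m D t | t. True}" using filt_malprod by blast
  have "t k = t' k" if "malprod N basis m D t = malprod N basis m D t'" "m \<le> k" "k < D" for t t' k
  proof -
    obtain i j where ij: "L ! k = (i, j)" by (cases "L ! k")
    show ?thesis using malprod_entry[OF that(3) ij, of m t] malprod_entry[OF that(3) ij, of m t'] that by simp
  qed
  then show "\<exists>m\<le>D. filt i = {malprod N basis m D t |t. True} \<and> (\<forall>t t'. malprod N basis m D t = malprod N basis m D t' \<longrightarrow>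
           (\<forall>k. m \<le> k \<and> k < D \<longrightarrow> t k = t' k))"
    using m by blast
qed

lemma lie_group_eq: "lie_group N basis D = G"
  unfolding lie_group_def mspan_zero by (rule mexp_image_upper) (simp add: upper_graded_W)

lemma subgroup_filt: "is_subgroup N (filt m) G"
  unfolding is_subgroup_def filt_def using unip_mono[of _ N W "max 1 m" 1] unip_one unip_mult minv_unip by auto

text \<open>No position has weight above \<open>s\<close>, so the term \<open>s + 1\<close> is
  trivial; the commutator condition is additivity of weights.\<close>

lemma filtration:
  assumes "\<And>i. i < N \<Longrightarrow> W i \<le> s"
  shows "is_filtration N G s filt"
  unfolding is_filtration_def
proof (intro conjI allI ballI)
  show "filt 0 = G" "filt 1 = G" unfolding filt_def by simp_all
  show "filt (Suc s) = {1\<^sub>m N}"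
  proof (intro equalityI subsetI)
    fix A assume "A \<in> filt (Suc s)"
    then have A: "A \<in> carrier_mat N N" "A - 1\<^sub>m N \<in> graded N W (Suc s)"
      unfolding filt_def unip_def by auto
    have "A - 1\<^sub>m N = 0\<^sub>m N N"
    proof (rule eq_matI)
      fix i j assume "i < dim_row (0\<^sub>m N N :: real mat)" "j < dim_col (0\<^sub>m N N :: real mat)"
      then have "i < N" "j < N" by auto
      then show "(A - 1\<^sub>m N) $$ (i, j) = 0\<^sub>m N N $$ (i, j)" using gradedD[OF A(2), of i j] assms[of i] by simp
    qed (use A in auto)
    then show "A \<in> {1\<^sub>m N}" using mat_one_plus_minus[OF A(1)] by simp
  qed (simp add: filt_def unip_one)
  fix i
  show "is_subgroup N (filt i) G" by (rule subgroup_filt)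
  show "filt (Suc i) \<subseteq> filt i" unfolding filt_def using unip_mono[of _ N W "max 1 (Suc i)" "max 1 i"] by auto
  fix j a b assume "a \<in> filt i" "b \<in> filt j"
  then have "a * b * minv N a * minv N b \<in> unip N W (max 1 i + max 1 j)"
    unfolding filt_def by (rule unip_commutator)
  \<comment> \<open>The indices match because
    \<open>max 1 (i + j) \<le> max 1 i + max 1 j\<close>.\<close>
  then show "a * b * minv N a * minv N b \<in> filt (i + j)" unfolding filt_def by (rule unip_mono) (auto simp: max_def)
qed

lemma mal_lattice_eq: "mal_lattice N basis D = G \<inter> int_mat N"
proof (intro equalityI subsetI)
  fix A assume "A \<in> mal_lattice N basis D"
  then obtain t where t: "A = malprod N basis 0 D t" "\<And>k. k < D \<Longrightarrow> t k \<in> \<int>" unfolding mal_lattice_def by blast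
  have A: "A \<in> G" unfolding t(1) by (rule malprod_G)
  have "A $$ (i, j) \<in> \<int>" if "i < N" "j < N" for i j
  proof (cases "i < j")
    case True
    obtain p where p: "p < D" "L ! p = (i, j)" using L_position[OF True \<open>j < N\<close>] by metis
    show ?thesis unfolding t(1) malprod_entry[OF p] using t(2)[OF p(1)] by simp
  next
    case False
    then show ?thesis using unip_entry[OF A that(1), of j] by simp
  qed
  then show "A \<in> G \<inter> int_mat N" using A unip_carrier[OF A] unfolding int_mat_def by blast
next
  fix A assume A: "A \<in> G \<inter> int_mat N"
  have "A $$ (L ! p) \<in> \<int>" if "p < D" for p
    using L_nth[OF that] A unfolding int_mat_def by (cases "L ! p") auto
  then show "A \<in> mal_lattice N basis D" using malprod_coords[of A] A unfolding mal_lattice_def by blast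
qed

section \<open>Reduction modulo the integral lattice\<close>

definition "reduced A = mat N N (\<lambda>(i, j). if i < j then frac (red_aux (\<lambda>i j. A $$ (i, j)) i j) else if i = j then 1 else 0)"

definition "cofactor A = mat N N (\<lambda>(i, j). if i < j then of_int \<lfloor>red_aux (\<lambda>i j. A $$ (i, j)) i j\<rfloor> else if i = j then 1 else (0::real))"

lemma reduced_G: "reduced A \<in> G" "cofactor A \<in> G \<inter> int_mat N"
  unfolding unip_def upper_graded_W[symmetric] upper_def strict_upper_def reduced_def cofactor_def int_mat_def by auto

lemma reduced_factor:
  assumes "A \<in> G"
  shows "A = reduced A * cofactor A"
proof (rule G_eqI[OF assms unip_mult])
  show "reduced A \<in> G" "cofactor A \<in> G" using reduced_G by auto
  fix i j assume ij: "i < j" "j < N"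
  have *: "(reduced A * cofactor A) $$ (i, j) = reduced A $$ (i, j) + cofactor A $$ (i, j)
      + (\<Sum>l\<in>{i<..<j}. reduced A $$ (i, l) * cofactor A $$ (l, j))"
    using reduced_G ij by (intro unip_mult_entry) auto
  also have "(\<Sum>l\<in>{i<..<j}. reduced A $$ (i, l) * cofactor A $$ (l, j))
      = (\<Sum>l\<in>{i<..<j}. frac (red_aux (\<lambda>i j. A $$ (i, j)) i l) * of_int \<lfloor>red_aux (\<lambda>i j. A $$ (i, j)) l j\<rfloor>)"
    using ij by (intro sum.cong) (auto simp: reduced_def cofactor_def)
  also have "reduced A $$ (i, j) + cofactor A $$ (i, j) = red_aux (\<lambda>i j. A $$ (i, j)) i j"
    using ij by (simp add: reduced_def cofactor_def frac_def)
  finally show "A $$ (i, j) = (reduced A * cofactor A) $$ (i, j)"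
    by (subst (asm) red_aux.simps) simp
qed

text \<open>Uniqueness of the factorisation. It yields invariance under the lattice and shows that a
  matrix with entries in \<open>[0,1)\<close> above the diagonal is its own reduction.\<close>

lemma red_aux_factor:
  assumes "A = B * C" "B \<in> G" "C \<in> G \<inter> int_mat N" "\<And>i j. i < j \<Longrightarrow> j < N \<Longrightarrow> 0 \<le> B $$ (i, j) \<and> B $$ (i, j) < 1"
    and "i < j" "j < N"
  shows "frac (red_aux (\<lambda>i j. A $$ (i, j)) i j) = B $$ (i, j)"
proof -
  have "frac (red_aux (\<lambda>i j. A $$ (i, j)) i j) = B $$ (i, j) \<and> of_int \<lfloor>red_aux (\<lambda>i j. A $$ (i, j)) i j\<rfloor> = C $$ (i, j)"
  proof (rule red_aux_unique)
    fix k l assume "i \<le> k" "k < l" "l \<le> j"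
    then have kl: "k < l" "l < N" using \<open>j < N\<close> by auto
    show "A $$ (k, l) = B $$ (k, l) + C $$ (k, l) + (\<Sum>m\<in>{k<..<l}. B $$ (k, m) * C $$ (m, l))"
      unfolding assms(1) using assms(2,3) kl by (intro unip_mult_entry) auto
    show "C $$ (k, l) \<in> \<int> \<and> 0 \<le> B $$ (k, l) \<and> B $$ (k, l) < 1"
      using assms(3) assms(4)[OF kl] kl unfolding int_mat_def by auto
  qed (rule \<open>i < j\<close>)
  then show ?thesis by blast
qed

lemma reduced_bounds: "i < j \<Longrightarrow> j < N \<Longrightarrow> 0 \<le> reduced A $$ (i, j) \<and> reduced A $$ (i, j) < 1"
  by (simp add: reduced_def frac_lt_1)

lemma lattice: "is_lattice N (mal_lattice N basis D) (lie_group N basis D)"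
  unfolding is_lattice_def mal_lattice_eq lie_group_eq
proof (intro conjI)
  show "is_subgroup N (G \<inter> int_mat N) G"
    unfolding is_subgroup_def using unip_one int_mat_one unip_mult int_mat_mult minv_unip int_mat_minv by auto
  show "\<exists>\<epsilon>>0. \<forall>\<gamma>\<in>G \<inter> int_mat N. (\<forall>i<N. \<forall>j<N. \<bar>\<gamma> $$ (i, j) - 1\<^sub>m N $$ (i, j)\<bar> < \<epsilon>) \<longrightarrow> \<gamma> = 1\<^sub>m N"
  proof (intro exI[of _ 1] conjI ballI impI)
    fix \<gamma> assume g: "\<gamma> \<in> G \<inter> int_mat N" "\<forall>i<N. \<forall>j<N. \<bar>\<gamma> $$ (i, j) - 1\<^sub>m N $$ (i, j)\<bar> < 1"
    show "\<gamma> = 1\<^sub>m N"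
    proof (rule G_eqI)
      fix i j assume ij: "i < j" "j < N"
      then have "\<gamma> $$ (i, j) \<in> \<int>" using g(1) unfolding int_mat_def by auto
      moreover have "\<bar>\<gamma> $$ (i, j)\<bar> < 1" using g(2)[rule_format, of i j] ij by simp
      ultimately have "\<gamma> $$ (i, j) = 0" by (auto elim!: Ints_cases)
      then show "\<gamma> $$ (i, j) = 1\<^sub>m N $$ (i, j)" using ij by simp
    qed (use g(1) unip_one in auto)
  qed simp
  show "\<exists>K B. K \<subseteq> G \<and> (\<forall>k\<in>K. \<forall>i<N. \<forall>j<N. \<bar>k $$ (i, j)\<bar> \<le> B) \<and> G = {k * \<gamma> |k \<gamma>. k \<in> K \<and> \<gamma> \<in> G \<inter> int_mat N}"
  \<comment> \<open>The reduced matrices form a bounded fundamental domain, which gives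
    cocompactness.\<close>
  proof (intro exI[of _ "reduced ` G"] exI[of _ 1] conjI)
    show "reduced ` G \<subseteq> G" using reduced_G by blast
    show "\<forall>k\<in>reduced ` G. \<forall>i<N. \<forall>j<N. \<bar>k $$ (i, j)\<bar> \<le> 1"
      by (auto simp: reduced_def abs_of_nonneg[OF frac_ge_0] less_imp_le[OF frac_lt_1])
    show "G = {k * \<gamma> |k \<gamma>. k \<in> reduced ` G \<and> \<gamma> \<in> G \<inter> int_mat N}"
      using reduced_G reduced_factor unip_mult by blast
  qed
qed

lemma piecewise:
  assumes \<Phi>: "floor_poly {(i, j). i < j \<and> j < N} \<Phi>"
  shows "piecewise_poly N basis D (\<lambda>g. \<Phi> (\<lambda>(i, j). frac (red_aux (\<lambda>i j. g $$ (i, j)) i j)))" (is "piecewise_poly N basis D ?F")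
  unfolding piecewise_poly_def lie_group_eq mal_lattice_eq
proof (intro conjI ballI)
  fix g \<gamma> assume g: "g \<in> G" and \<gamma>: "\<gamma> \<in> G \<inter> int_mat N"
  \<comment> \<open>The lattice element is absorbed into the integral factor, so by uniqueness the
    reduced factor stays the same.\<close>
  have C: "cofactor g * \<gamma> \<in> G \<inter> int_mat N" using reduced_G(2)[of g] \<gamma> unip_mult int_mat_mult by blast
  have "g * \<gamma> = reduced g * cofactor g * \<gamma>" using reduced_factor[OF g] by simp
  also have "\<dots> = reduced g * (cofactor g * \<gamma>)"
    using reduced_G[of g] \<gamma> by (intro sq_assoc[of _ N] unip_carrier) auto
  finally have f: "g * \<gamma> = reduced g * (cofactor g * \<gamma>)" .
  show "?F (g * \<gamma>) = ?F g"
  proof (rule floor_poly_cong[OF \<Phi>], clarify)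
    fix i j assume ij: "i < j" "j < N"
    show "frac (red_aux (\<lambda>i j. (g * \<gamma>) $$ (i, j)) i j) = frac (red_aux (\<lambda>i j. g $$ (i, j)) i j)"
      using red_aux_factor[OF f reduced_G(1) C reduced_bounds ij] ij by (simp add: reduced_def)
  qed
next
  \<comment> \<open>\<open>\<Phi>\<close> takes matrix positions as variables while the coordinates
    of the cube are numbered; \<open>pos\<close> translates between the two.\<close>
  define pos where "pos v = (SOME p. p < D \<and> L ! p = v)" for v
  have pos: "pos v < D \<and> L ! pos v = v" if "v \<in> {(i, j). i < j \<and> j < N}" for v
  proof -
    obtain i j where v: "v = (i, j)" "i < j" "j < N" using \<open>v \<in> _\<close> by blast
    obtain p where "p < D \<and> L ! p = v" using L_position[OF v(2,3)] v(1) by metis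
    then show ?thesis unfolding pos_def by (rule someI)
  qed
  have fp: "floor_poly {..<D} (\<lambda>t. \<Phi> (\<lambda>v. t (pos v)))"
    by (rule floor_poly_subst[OF \<Phi>]) (use pos in auto)
  obtain \<P> where P: "poly_partition D \<P> (\<lambda>t. \<Phi> (\<lambda>v. t (pos v)))" using floor_poly_partition[OF fp] by blast
  \<comment> \<open>A point of the cube is already reduced, with the identity as integral
    factor.\<close>
  have F: "?F (malprod N basis 0 D t) = \<Phi> (\<lambda>v. t (pos v))" if t: "t \<in> unit_cube D" for t
  proof (rule floor_poly_cong[OF \<Phi>], clarify)
    fix i j assume ij: "i < j" "j < N"
    have e: "malprod N basis 0 D t $$ (i, j) = t (pos (i, j))" if "i < j" "j < N" for i j
      using malprod_entry[of "pos (i, j)" i j 0 t] pos[of "(i, j)"] that by simp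
    have "frac (red_aux (\<lambda>i j. malprod N basis 0 D t $$ (i, j)) i j) = malprod N basis 0 D t $$ (i, j)"
    proof (rule red_aux_factor[OF _ malprod_G _ _ ij])
      show "malprod N basis 0 D t = malprod N basis 0 D t * 1\<^sub>m N"
        using unip_carrier[OF malprod_G[of t]] by simp
      show "1\<^sub>m N \<in> G \<inter> int_mat N" using unip_one int_mat_one by blast
      fix k l assume "k < l" "l < N"
      then show "0 \<le> malprod N basis 0 D t $$ (k, l) \<and> malprod N basis 0 D t $$ (k, l) < 1"
        using e[of k l] t pos[of "(k, l)"] unfolding unit_cube_def by auto
    qed
    then show "frac (red_aux (\<lambda>i j. malprod N basis 0 D t $$ (i, j)) i j) = t (pos (i, j))"
      using e[OF ij] by simp
  qed
  obtain Ps where Ps: "set Ps = \<P>" "distinct Ps" using finite_distinct_list[OF poly_partitionD(1)[OF P]] by blast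
  have "\<forall>(S, \<Psi>)\<in>set Ps. semialg D S \<and> poly_fun D \<Psi>"
    unfolding Ps(1) using poly_partitionD(2,3)[OF P] by auto
  moreover have "(\<Union>(S, \<Psi>)\<in>set Ps. S) = unit_cube D"
  proof (intro equalityI subsetI)
    fix x assume "x \<in> unit_cube D"
    from poly_partitionD(6)[OF P this] show "x \<in> (\<Union>(S, \<Psi>)\<in>set Ps. S)" unfolding Ps(1) by auto
  next
    fix x assume "x \<in> (\<Union>(S, \<Psi>)\<in>set Ps. S)"
    then show "x \<in> unit_cube D" unfolding Ps(1) using poly_partitionD(4)[OF P] by auto
  qed
  moreover have "fst (Ps ! i) \<inter> fst (Ps ! j) = {}" if "i < length Ps" "j < length Ps" "i \<noteq> j" for i j
  proof -
    obtain S \<Psi> T \<Xi> where e: "Ps ! i = (S, \<Psi>)" "Ps ! j = (T, \<Xi>)" by (meson surj_pair)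
    then have "(S, \<Psi>) \<in> \<P>" "(T, \<Xi>) \<in> \<P>" using that Ps(1) nth_mem by metis+
    note d = poly_partitionD(7)[OF P this]
    \<comment> \<open>Different list entries might share the set and differ only in the polynomial,
      but a common point would force both components to agree.\<close>
    have "(S, \<Psi>) \<noteq> (T, \<Xi>)" using e that Ps(2) nth_eq_iff_index_eq by metis
    then show ?thesis using d e by auto
  qed
  moreover have "\<forall>(S, \<Psi>)\<in>set Ps. \<forall>t\<in>S. ?F (malprod N basis 0 D t) = \<Psi> t"
  proof (intro ballI, clarify)
    fix S \<Psi> t assume S: "(S, \<Psi>) \<in> set Ps" "t \<in> S"
    have "?F (malprod N basis 0 D t) = \<Phi> (\<lambda>v. t (pos v))"
      using F poly_partitionD(4)[OF P] S unfolding Ps(1) by blast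
    also have "\<dots> = \<Psi> t" using poly_partitionD(5)[OF P] S unfolding Ps(1) by blast
    finally show "?F (malprod N basis 0 D t) = \<Psi> t" .
  qed
  ultimately show "\<exists>Ps. (\<forall>(S, \<Psi>)\<in>set Ps. semialg D S \<and> poly_fun D \<Psi>) \<and> (\<Union>(S, \<Psi>)\<in>set Ps. S) = unit_cube D
      \<and> (\<forall>i<length Ps. \<forall>j<length Ps. i \<noteq> j \<longrightarrow> fst (Ps ! i) \<inter> fst (Ps ! j) = {})
      \<and> (\<forall>(S, \<Psi>)\<in>set Ps. \<forall>t\<in>S. ?F (malprod N basis 0 D t) = \<Psi> t)"
    by blast
qed

end

section \<open>Polynomial sequences\<close>

text \<open>Degree at most \<open>a - b\<close>, written without subtraction. For
  \<open>a < b\<close> only the zero polynomial qualifies, which is the requirement below the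
  diagonal, where \<open>W i < W j\<close>.\<close>

definition poly_deg :: "nat \<Rightarrow> nat \<Rightarrow> (int \<Rightarrow> real) \<Rightarrow> bool" where
  "poly_deg a b f \<longleftrightarrow> (\<exists>P. (\<forall>n. f n = poly P (of_int n)) \<and> (P = 0 \<or> degree P + b \<le> a))"

lemma poly_deg_zero: "poly_deg a b (\<lambda>n. 0)"
  unfolding poly_deg_def by (intro exI[of _ 0]) simp

lemma poly_deg_add:
  assumes "poly_deg a b f" "poly_deg a b g"
  shows "poly_deg a b (\<lambda>n. f n + g n)"
proof -
  obtain P Q where P: "\<And>n. f n = poly P (of_int n)" "P = 0 \<or> degree P + b \<le> a"
    and Q: "\<And>n. g n = poly Q (of_int n)" "Q = 0 \<or> degree Q + b \<le> a"
    using assms unfolding poly_deg_def by blast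
  have "P + Q = 0 \<or> degree (P + Q) + b \<le> a" using P(2) Q(2) degree_add_le_max[of P Q] by auto
  then show ?thesis unfolding poly_deg_def using P(1) Q(1) by (intro exI[of _ "P + Q"]) simp
qed

lemma poly_deg_sum: "finite I \<Longrightarrow> (\<And>k. k \<in> I \<Longrightarrow> poly_deg a b (f k)) \<Longrightarrow> poly_deg a b (\<lambda>n. \<Sum>k\<in>I. f k n)"
  by (induction rule: finite_induct) (auto intro: poly_deg_zero poly_deg_add)

lemma poly_deg_mult:
  assumes "poly_deg a b f" "poly_deg b c g"
  shows "poly_deg a c (\<lambda>n. f n * g n)"
proof -
  obtain P Q where P: "\<And>n. f n = poly P (of_int n)" "P = 0 \<or> degree P + b \<le> a"
    and Q: "\<And>n. g n = poly Q (of_int n)" "Q = 0 \<or> degree Q + c \<le> b"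
    using assms unfolding poly_deg_def by blast
  have "P * Q = 0 \<or> degree (P * Q) + c \<le> a" using P(2) Q(2) degree_mult_le[of P Q] by auto
  then show ?thesis unfolding poly_deg_def using P(1) Q(1) by (intro exI[of _ "P * Q"]) simp
qed

text \<open>A nonzero \<open>P\<close> would have degree at most \<open>a - b\<close>, hence below
  \<open>m\<close>, but it has \<open>m\<close> zeros.\<close>

lemma poly_deg_vanish:
  assumes "poly_deg a b f" "\<And>k. k < m \<Longrightarrow> f (int k) = 0" "a < b + m"
  shows "f n = 0"
proof -
  obtain P where P: "\<And>n. f n = poly P (of_int n)" "P = 0 \<or> degree P + b \<le> a"
    using assms unfolding poly_deg_def by blast
  have "P = 0"
  proof (rule ccontr)
    assume "P \<noteq> 0"
    then have "degree P < m" using P(2) assms(3) by simp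
    moreover have "card (real ` {..<m}) = m" by (simp add: card_image inj_on_def)
    moreover have "poly P x = poly 0 x" if "x \<in> real ` {..<m}" for x
    proof -
      from that obtain k where k: "x = real k" "k < m" by blast
      then show ?thesis using assms(2)[OF k(2)] P(1)[of "int k"] by simp
    qed
    ultimately have "P = 0" by (intro poly_eqI_degree[of "real ` {..<m}"]) auto
    then show False using \<open>P \<noteq> 0\<close> by simp
  qed
  then show ?thesis using P(1) by simp
qed

definition binom_poly :: "nat \<Rightarrow> real poly" where
  "binom_poly m = smult (1 / fact m) (\<Prod>i<m. [:- of_nat i, 1:])"

lemma binom_poly: "poly (binom_poly m) x = x gchoose m" "degree (binom_poly m) \<le> m"
proof -
  show "poly (binom_poly m) x = x gchoose m"
    by (simp add: binom_poly_def poly_prod gbinomial_prod_rev atLeast0LessThan)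
  have "degree (\<Prod>i<m. [:- of_nat i, 1::real:]) \<le> (\<Sum>i<m. degree [:- of_nat i, 1::real:])"
    using degree_prod_sum_le[of "{..<m}" "\<lambda>i. [:- of_nat i, 1::real:]"] by (simp add: o_def)
  then show "degree (binom_poly m) \<le> m" by (simp add: binom_poly_def)
qed

text \<open>The division in \<open>binom_int\<close> is exact, since \<open>fact m\<close> divides a
  product of \<open>m\<close> consecutive integers.\<close>

lemma binom_int_eq: "real_of_int (binom_int n m) = real_of_int n gchoose m"
proof -
  have "fact m dvd (\<Prod>j<m. n - int j)"
    using dvdI[OF gbinomial_int_mult_fact[of m n, symmetric]] by (simp add: atLeast0LessThan)
  then have "real_of_int (binom_int n m) = real_of_int (\<Prod>j<m. n - int j) / real_of_int (fact m)"
    unfolding binom_int_def by (rule real_of_int_div)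
  then show ?thesis by (simp add: gbinomial_prod_rev atLeast0LessThan)
qed

section \<open>Polynomial sequences read off from degrees of matrix entries\<close>

context unitriangular
begin

text \<open>Degrees are bounded by weights, and products respect this because weights add along a
  path \<open>i, l, j\<close>. The criterion can be checked entrywise;
  \<open>poly_mat_in_poly_seq\<close> converts it into the form with binomial exponents.\<close>

definition poly_mat :: "(int \<Rightarrow> real mat) \<Rightarrow> bool" where
  "poly_mat A \<longleftrightarrow> (\<forall>n. A n \<in> G) \<and> (\<forall>i<N. \<forall>j<N. poly_deg (W i) (W j) (\<lambda>n. A n $$ (i, j)))"

lemma poly_mat_mult:
  assumes "poly_mat A" "poly_mat B"
  shows "poly_mat (\<lambda>n. A n * B n)"
  unfolding poly_mat_def
proof (intro conjI allI impI)
  have G: "A n \<in> G" "B n \<in> G" for n using assms unfolding poly_mat_def by auto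
  show "A n * B n \<in> G" for n using G by (rule unip_mult)
  fix i j assume ij: "i < N" "j < N"
  show "poly_deg (W i) (W j) (\<lambda>n. (A n * B n) $$ (i, j))"
    unfolding mult_entry[OF unip_carrier[OF G(1)] unip_carrier[OF G(2)] ij]
    using assms ij unfolding poly_mat_def by (intro poly_deg_sum poly_deg_mult) auto
qed

text \<open>The \<open>r\<close>-th power of \<open>g - 1\<close> vanishes at weights below
  \<open>m * r\<close>, while its coefficient \<open>z n gchoose r\<close> has degree at most
  \<open>m * r\<close> in \<open>n\<close>; so degree never exceeds weight.\<close>

lemma poly_mat_bin_pow:
  fixes P :: "real poly"
  assumes g: "g \<in> filt m" and P: "degree P \<le> m" and z: "\<And>n. poly P (of_int n) = of_int (z n)"
  shows "poly_mat (\<lambda>n. bin_pow N (g - 1\<^sub>m N) (of_int (z n)))"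
  unfolding poly_mat_def
proof (intro conjI allI impI)
  have gG: "g \<in> G" using g unip_mono[of _ N W "max 1 m" 1] unfolding filt_def by auto
  then show "bin_pow N (g - 1\<^sub>m N) (of_int (z n)) \<in> G" for n by (rule bin_pow_unip)
  let ?X = "g - 1\<^sub>m N"
  have X: "?X \<in> carrier_mat N N" "?X \<in> graded N W m"
    using unip_carrier[OF gG] unip_graded[OF g[unfolded filt_def]] graded_mono by auto
  fix i j assume ij: "i < N" "j < N"
  have e: "bin_pow N ?X x $$ (i, j) = (\<Sum>r<N. (x gchoose r) * mpow N ?X r $$ (i, j))" for x
  proof -
    have "bin_pow N ?X x $$ (i, j) = (\<Sum>r<N. ((x gchoose r) \<cdot>\<^sub>m mpow N ?X r) $$ (i, j))"
      unfolding bin_pow_def using X(1) ij by (intro msum_entry) auto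
    then show ?thesis using smult_entry[OF mpow_carrier[OF X(1)] ij] by simp
  qed
  show "poly_deg (W i) (W j) (\<lambda>n. bin_pow N ?X (of_int (z n)) $$ (i, j))"
    unfolding e
  proof (rule poly_deg_sum)
    fix r
    show "poly_deg (W i) (W j) (\<lambda>n. (of_int (z n) gchoose r) * mpow N ?X r $$ (i, j))"
    proof (cases "W i < W j + m * r")
      case True
      then have "mpow N ?X r $$ (i, j) = 0" using gradedD[OF graded_mpow[OF X(2)] ij] by simp
      then show ?thesis by (simp add: poly_deg_zero)
    next
      case False
      let ?Q = "smult (mpow N ?X r $$ (i, j)) (pcompose (binom_poly r) P)"
      have "degree ?Q \<le> degree (binom_poly r) * degree P"
        using degree_smult_le[of _ "pcompose (binom_poly r) P"] degree_pcompose_le le_trans by blast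
      also have "\<dots> \<le> r * m" using binom_poly(2) P by (rule mult_le_mono)
      finally have "degree ?Q + W j \<le> W i" using False by (simp add: mult.commute)
      then show ?thesis unfolding poly_deg_def
        by (intro exI[of _ ?Q]) (simp add: poly_pcompose binom_poly(1) z)
    qed
  qed simp
qed

text \<open>The factor \<open>g\<^sub>m\<close> is the value at \<open>m\<close> of what remains after \<open>m\<close> steps: an entry of weight below \<open>m\<close> is a
  polynomial of degree below \<open>m\<close> vanishing at \<open>0, \<dots>, m - 1\<close>, so \<open>g\<^sub>m\<close> lies in the \<open>m\<close>-th filtration term.\<close>

lemma poly_mat_peel:
  assumes "poly_mat A"
  shows "\<exists>gs R. (\<forall>i<m. gs i \<in> filt i) \<and> poly_mat R \<and> (\<forall>k<m. R (int k) = 1\<^sub>m N)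
      \<and> (\<forall>n. A n = mprod N (\<lambda>i. gpow N (gs i) (binom_int n i)) m * R n)"
proof (induction m)
  case 0
  have "A n \<in> carrier_mat N N" for n using assms unip_carrier unfolding poly_mat_def by blast
  then show ?case using assms by (intro exI[of _ "\<lambda>i::nat. 1\<^sub>m N"] exI[of _ A]) (simp add: left_mult_one_mat[of _ N N])
next
  case (Suc m)
  then obtain gs R where gs: "\<And>i. i < m \<Longrightarrow> gs i \<in> filt i" and R: "poly_mat R" "\<And>k. k < m \<Longrightarrow> R (int k) = 1\<^sub>m N"
    and A: "\<And>n. A n = mprod N (\<lambda>i. gpow N (gs i) (binom_int n i)) m * R n"
    by blast
  define g where "g = R (int m)"
  have RG: "R n \<in> G" for n using R(1) unfolding poly_mat_def by blast
  have gG: "g \<in> G" unfolding g_def by (rule RG)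
  have g: "g \<in> filt m"
    unfolding filt_def unip_def
  proof (intro CollectI conjI IntI)
    show c: "g \<in> carrier_mat N N" using unip_carrier[OF gG] .
    show u: "g - 1\<^sub>m N \<in> upper N" using unip_upper[OF gG] .
    show "g - 1\<^sub>m N \<in> graded N W (max 1 m)"
    proof (rule gradedI)
      fix i j assume ij: "i < N" "j < N" and w: "W i < W j + max 1 m"
      show "(g - 1\<^sub>m N) $$ (i, j) = 0"
      proof (cases "i < j")
        case True
        \<comment> \<open>Above the diagonal the weight is at least 1, so the inequality with
          \<open>max 1 m\<close> can only come from \<open>m\<close>.\<close>
        then have "W i < W j + m" using dec[OF True ij(2)] w by auto
        moreover have "R (int k) $$ (i, j) = 0" if "k < m" for k using R(2)[OF that] ij True by simp
        moreover have "poly_deg (W i) (W j) (\<lambda>n. R n $$ (i, j))" using R(1) ij unfolding poly_mat_def by simp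
        ultimately have "R (int m) $$ (i, j) = 0"
          using poly_deg_vanish[of "W i" "W j" "\<lambda>n. R n $$ (i, j)" m "int m"] by simp
        then show ?thesis using c ij True by (simp add: g_def minus_entry[of _ N])
      qed (use upperD[OF u] ij in simp)
    qed (use c in simp)
  qed
  \<comment> \<open>At \<open>n = m\<close> the binomial coefficient is 1 and the new factor cancels
    \<open>g\<close>; at \<open>n < m\<close> it is 0, so the values already equal to 1 are
    kept.\<close>
  define R' where "R' n = bin_pow N (g - 1\<^sub>m N) (of_int (- binom_int n m)) * R n" for n
  have "poly_mat R'" unfolding R'_def
    by (intro poly_mat_mult R(1) poly_mat_bin_pow[OF g, of "- binom_poly m"])
       (auto simp: binom_poly binom_int_eq)
  moreover have "R' (int k) = 1\<^sub>m N" if "k < Suc m" for k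
  proof (cases "k = m")
    case True
    have "binom_int (int m) m = 1"
      using binom_int_eq[of "int m" m] binomial_gbinomial[of m m, where ?'a = real] by simp
    then show ?thesis using bin_pow_gpow(4)[OF gG] minv_inverse[OF gG] True by (simp add: R'_def g_def)
  next
    case False
    then have k: "k < m" using that by simp
    have "real k gchoose m = 0"
      using binomial_gbinomial[of k m, where ?'a = real] binomial_eq_0[OF k] by simp
    then have "binom_int (int k) m = 0" using binom_int_eq[of "int k" m] by simp
    then show ?thesis using R(2)[OF k] bin_pow_zero[of "g - 1\<^sub>m N" N] unip_carrier[OF gG] by (simp add: R'_def)
  qed
  moreover have "A n = mprod N (\<lambda>i. gpow N ((gs(m := g)) i) (binom_int n i)) (Suc m) * R' n" for n
  proof -
    let ?M = "mprod N (\<lambda>i. gpow N (gs i) (binom_int n i)) m" and ?b = "bin_pow N (g - 1\<^sub>m N)" and ?z = "real_of_int (binom_int n m)"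
    have gp: "gpow N (gs i) z \<in> carrier_mat N N" if "i < m" for i z
      using gs[OF that] unip_carrier bin_pow_unip bin_pow_gpow(2) unfolding filt_def by metis
    have c: "?M \<in> carrier_mat N N" "?b x \<in> carrier_mat N N" "R n \<in> carrier_mat N N" for x
      using gp unip_carrier[OF gG] unip_carrier[OF RG] by (auto intro: bin_pow_carrier)
    have "mprod N (\<lambda>i. gpow N ((gs(m := g)) i) (binom_int n i)) (Suc m) = ?M * ?b ?z"
      using mprod_cong[of m "\<lambda>i. gpow N ((gs(m := g)) i) (binom_int n i)" "\<lambda>i. gpow N (gs i) (binom_int n i)" N]
      by (simp add: bin_pow_gpow(2)[OF gG])
    moreover have "?M * ?b ?z * (?b (- ?z) * R n) = ?M * ((?b ?z * ?b (- ?z)) * R n)"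
      using c by (simp add: sq_assoc[of _ N])
    moreover have "\<dots> = A n" unfolding bin_pow_gpow(3)[OF gG] A using c by (simp add: left_mult_one_mat[of _ N N])
    ultimately show ?thesis by (simp add: R'_def)
  qed
  moreover have "(gs(m := g)) i \<in> filt i" if "i < Suc m" for i using gs g that by (cases "i = m") auto
  ultimately show ?case by (intro exI[of _ "gs(m := g)"] exI[of _ R']) blast
qed

text \<open>After \<open>s + 1\<close> factors are split off, the entries of the remainder above the
  diagonal have degree at most \<open>s\<close> and vanish at \<open>0, ..., s\<close>, so the
  remainder is the identity.\<close>

lemma poly_mat_in_poly_seq:
  assumes A: "poly_mat A" and s: "\<And>i. i < N \<Longrightarrow> W i \<le> s"
  shows "in_poly_seq N s filt A"
proof -
  obtain gs R where gs: "\<And>i. i < Suc s \<Longrightarrow> gs i \<in> filt i" and R: "poly_mat R" "\<And>k. k < Suc s \<Longrightarrow> R (int k) = 1\<^sub>m N"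
    and An: "\<And>n. A n = mprod N (\<lambda>i. gpow N (gs i) (binom_int n i)) (Suc s) * R n"
    using poly_mat_peel[OF A, of "Suc s"] by blast
  have "R n = 1\<^sub>m N" for n
  proof (rule G_eqI[OF _ unip_one])
    show "R n \<in> G" using R(1) unfolding poly_mat_def by blast
    fix i j assume ij: "i < j" "j < N"
    have "R n $$ (i, j) = 0"
      by (rule poly_deg_vanish[of "W i" "W j" "\<lambda>n. R n $$ (i, j)" "Suc s"])
         (use R ij s[of i] in \<open>auto simp: poly_mat_def\<close>)
    then show "R n $$ (i, j) = 1\<^sub>m N $$ (i, j)" using ij by simp
  qed
  moreover have gp: "gpow N (gs i) z \<in> carrier_mat N N" if "i < Suc s" for i z
    using gs[OF that] unip_carrier bin_pow_unip bin_pow_gpow(2) unfolding filt_def by metis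
  have "mprod N (\<lambda>i. gpow N (gs i) (binom_int n i)) (Suc s) \<in> carrier_mat N N" for n
    by (rule mprod_carrier) (rule gp)
  ultimately have "A n = poly_seq N s gs n" for n
    unfolding poly_seq_def An by (simp add: right_mult_one_mat[of _ N N] del: mprod.simps)
  then show ?thesis unfolding in_poly_seq_def using gs by (intro exI[of _ gs]) auto
qed

end

section \<open>Choice of the weights and assembly of the nilmanifold\<close>

text \<open>Each weight is at least twice any later one, so for \<open>i < k < j\<close> one has
  \<open>W i - W k \<ge> W k > W k - W j\<close>. This is the convexity demanded of the
  ordering.\<close>

lemma unitriangular_exists:
  assumes "1 \<le> K"
  shows "\<exists>L. unitriangular N (\<lambda>i. K * 2 ^ (N - i)) L"
proof -
  let ?W = "\<lambda>i. K * 2 ^ (N - i) :: nat" and ?S = "{(i, j). i < j \<and> j < N}"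
  have "finite ?S" by (rule finite_subset[of _ "{..<N} \<times> {..<N}"]) auto
  then obtain xs where xs: "set xs = ?S" "distinct xs" using finite_distinct_list by blast
  have dbl: "2 * ?W j \<le> ?W i" if "i < j" "j < N" for i j
  proof -
    have "(2::nat) * 2 ^ (N - j) \<le> 2 ^ (N - i)"
      using that power_increasing[of "Suc (N - j)" "N - i" "2::nat"] by simp
    then show ?thesis using mult_le_mono2[of _ _ K] by (metis mult.left_commute)
  qed
  have pos: "0 < ?W i" for i using assms by simp
  have "unitriangular N ?W (sort_key (\<lambda>(i, j). ?W i - ?W j) xs)"
  proof
    show "?W j < ?W i" if "i < j" "j < N" for i j using dbl[OF that] pos[of j] by linarith
    show "?W k - ?W j < ?W i - ?W k" if "i < k" "k < j" "j < N" for i k j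
    proof -
      have "k < N" using that by simp
      then show ?thesis using dbl[OF that(1)] dbl[OF that(2,3)] pos[of j] by linarith
    qed
  qed (use xs in \<open>auto intro: sorted_sort_key\<close>)
  then show ?thesis by blast
qed

theorem theorem4p4:
  fixes f :: "int \<Rightarrow> real" and d :: nat
  assumes "gen_poly_map f"
    and "\<exists>B. \<forall>n. \<bar>f n\<bar> \<le> B"
  shows "\<exists>(N::nat) (X::nat \<Rightarrow> real mat) (D::nat) (s::nat) (Gf::nat \<Rightarrow> real mat set) (F::real mat \<Rightarrow> real).
           (\<forall>Y\<in>mspan N X 0 D. \<forall>Z\<in>mspan N X 0 D. bracket Y Z \<in> mspan N X 0 D)
         \<and> is_lattice N (mal_lattice N X D) (lie_group N X D)
         \<and> is_filtration N (lie_group N X D) s Gf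
         \<and> malcev_basis N X D Gf
         \<and> piecewise_poly N X D F
         \<and> (\<forall>p :: real poly. degree p \<le> d \<longrightarrow>
              (\<exists>g. in_poly_seq N s Gf g \<and> (\<forall>n. f \<lfloor>poly p (of_int n)\<rfloor> = F (g n))))"
proof -
  obtain h where h: "gen_poly_real h" "\<And>n. f n = h (of_int n)"
    using assms(1) unfolding gen_poly_map_def by blast
  obtain B where B: "\<And>n. \<bar>f n\<bar> \<le> B" using assms(2) by blast
  \<comment> \<open>The representation ranges over all indices \<open>p\<close>, so polynomials of
    degree above \<open>d\<close> are replaced by 0 to keep the degree bound uniform.\<close>
  define trunc :: "real poly \<Rightarrow> real poly" where "trunc p = (if degree p \<le> d then p else 0)" for p
  have "bounded_degree trunc" unfolding bounded_degree_def trunc_def by (intro exI[of _ d]) auto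
  then have "gen_poly_family (\<lambda>p n. h (of_int \<lfloor>poly (trunc p) (of_int n)\<rfloor>))"
    by (intro gen_poly_family_compose[OF h(1)] gen_poly_family_floor gen_poly_family_poly)
  then have "nil_rep (\<lambda>p n. f \<lfloor>poly (trunc p) (of_int n)\<rfloor>)"
    using B unfolding h(2)[symmetric] by (rule nil_rep_bounded)
  then obtain N K \<Phi> where \<Phi>: "floor_poly {(i, j). i < j \<and> j < N} \<Phi>"
    and rep: "\<And>p. \<exists>P. (\<forall>i j. degree (P i j) \<le> K) \<and> (\<forall>n. f \<lfloor>poly (trunc p) (of_int n)\<rfloor>
        = \<Phi> (\<lambda>(i, j). frac (red_aux (\<lambda>i j. poly (P i j) (of_int n)) i j)))"
    unfolding nil_rep_def by blast
  \<comment> \<open>Distinct powers of two differ by at least 1, so every weight above the diagonal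
    is at least \<open>K + 1\<close>. The successor also keeps the weights positive when
    \<open>K = 0\<close>.\<close>
  define W where "W i = Suc K * 2 ^ (N - i)" for i
  obtain L where "unitriangular N W L" using unitriangular_exists[of "Suc K" N] unfolding W_def by auto
  then interpret unitriangular N W L .
  define F where "F g = \<Phi> (\<lambda>(i, j). frac (red_aux (\<lambda>i j. g $$ (i, j)) i j))" for g :: "real mat"
  \<comment> \<open>The largest weight \<open>W 0\<close> serves as the degree of the
    filtration.\<close>
  have s: "W i \<le> W 0" for i unfolding W_def by (intro mult_le_mono2 power_increasing) auto
  have seq: "\<exists>g. in_poly_seq N (W 0) filt g \<and> (\<forall>n. f \<lfloor>poly p (of_int n)\<rfloor> = F (g n))" if "degree p \<le> d" for p :: "real poly"
  proof -
    have t: "trunc p = p" using that unfolding trunc_def by simp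
    obtain P where P: "\<And>i j. degree (P i j) \<le> K"
      "\<And>n. f \<lfloor>poly p (of_int n)\<rfloor> = \<Phi> (\<lambda>(i, j). frac (red_aux (\<lambda>i j. poly (P i j) (of_int n)) i j))"
      using rep[of p] unfolding t by blast
    \<comment> \<open>The entries of \<open>P\<close> on and below the diagonal are unspecified;
      \<open>red_aux\<close> does not read them, so they may be overwritten to obtain a unipotent
      matrix.\<close>
    define A where "A n = mat N N (\<lambda>(i, j). if i < j then poly (P i j) (of_int n) else if i = j then 1 else 0)" for n :: int
    have "A n \<in> G" for n
      unfolding A_def unip_def upper_graded_W[symmetric] upper_def strict_upper_def by auto
    moreover have "poly_deg (W i) (W j) (\<lambda>n. A n $$ (i, j))" if ij: "i < N" "j < N" for i j
    proof -
      have "degree (P i j) + W j \<le> W i" if "i < j"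
      proof -
        have "N - j < N - i" using that ij by simp
        then have "(2::nat) ^ (N - j) < 2 ^ (N - i)" by (rule power_strict_increasing) simp
        then have "(2::nat) ^ (N - j) + 1 \<le> 2 ^ (N - i)" by linarith
        then have "Suc K * (2 ^ (N - j) + 1) \<le> W i" unfolding W_def by (rule mult_le_mono2)
        then show ?thesis using P(1)[of i j] unfolding W_def by (simp add: algebra_simps)
      qed
      then show ?thesis using ij unfolding poly_deg_def A_def
        by (intro exI[of _ "if i < j then P i j else if i = j then 1 else 0"]) auto
    qed
    ultimately have "poly_mat A" unfolding poly_mat_def by blast
    then have "in_poly_seq N (W 0) filt A" by (rule poly_mat_in_poly_seq) (rule s)
    moreover have "f \<lfloor>poly p (of_int n)\<rfloor> = F (A n)" for n
      unfolding P(2) F_def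
    proof (rule floor_poly_cong[OF \<Phi>], clarify)
      fix i j assume ij: "i < j" "j < N"
      have "red_aux (\<lambda>i j. poly (P i j) (of_int n)) i j = red_aux (\<lambda>i j. A n $$ (i, j)) i j"
        using ij by (intro red_aux_cong) (auto simp: A_def)
      then show "frac (red_aux (\<lambda>i j. poly (P i j) (of_int n)) i j) = frac (red_aux (\<lambda>i j. A n $$ (i, j)) i j)"
        by simp
    qed
    ultimately show ?thesis by blast
  qed
  show ?thesis
  proof (rule exI[of _ N], rule exI[of _ basis], rule exI[of _ D], rule exI[of _ "W 0"], rule exI[of _ filt],
      rule exI[of _ F], intro conjI)
    show "\<forall>Y\<in>mspan N basis 0 D. \<forall>Z\<in>mspan N basis 0 D. bracket Y Z \<in> mspan N basis 0 D"
      using mspan_bracket by blast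
    show "is_lattice N (mal_lattice N basis D) (lie_group N basis D)" by (rule lattice)
    show "is_filtration N (lie_group N basis D) (W 0) filt" unfolding lie_group_eq by (rule filtration) (rule s)
    show "malcev_basis N basis D filt" by (rule malcev)
    show "piecewise_poly N basis D F" unfolding F_def by (rule piecewise[OF \<Phi>])
    show "\<forall>p :: real poly. degree p \<le> d \<longrightarrow> (\<exists>g. in_poly_seq N (W 0) filt g \<and> (\<forall>n. f \<lfloor>poly p (of_int n)\<rfloor> = F (g n)))"
      using seq by blast
  qed
qed

end
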